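(* For every $n\in\mathbb N$, there is an equivalence of categories $$\mathcal S_{[n]}\simeq\mathrm{Fam}\Big(\prod_{M\in\mathcal M_n}\mathcal S_{\mathrm{cod}(M)}\Big).$$
   Context: Base category. Let $\mathcal C$ be the category generated by the following graph modulo relations. Objects: $\star$; $[n]$ ($n\in\mathbb N$); for each $n$: $\mathrm{tick}_n,\mathrm{paral}_n,\mathrm{parar}_n,\nu_n,\mathrm{para}_n$; for each $n$, $1\le i\le n$: $\iota^+_{n,i},\iota^-_{n,i}$; for $n,m$, $1\le i\le n$, $1\le j\le m$: $\tau_{n,i,m,j}$. Arrows: $d_1,\dots,d_n\colon\star\to[n]$; $s,t\colon[n]\to c$ for $c\in\{\mathrm{tick}_n,\mathrm{paral}_n,\mathrm{parar}_n,\iota^\pm_{n,i}\}$; $s\colon[n]\to\nu_n$, $t\colon[n+1]\to\nu_n$; $l\colon\mathrm{paral}_n\to\mathrm{para}_n$, $r\colon\mathrm{parar}_n\to\mathrm{para}_n$; $\epsilon\colon\iota^+_{n,i}\to\tau_{n,i,m,j}$, $\rho\colon\iota^-_{m,j}\to\tau_{n,i,m,j}$. Relations: $s\circ d_i=t\circ d_i$ ($1\le i\le n$) for each pair $s,t$ into a common object; $l\circ s=r\circ s$; $\epsilon\circ s\circ d_i=\rho\circ s\circ d_j$. $\widehat{\mathcal C}=[\mathcal C^{op},\mathbf{Set}]$, objects identified with representables. A position is a finite presheaf empty outside $\star$ and the $[n]$ (channels over $\star$, players knowing $n$ channels over $[n]$). Basic moves: for $c\in\{\mathrm{tick}_n,\mathrm{paral}_n,\mathrm{parar}_n,\nu_n,\iota^\pm_{n,i}\}$,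 the cospan $[n]\xrightarrow{s}c\xleftarrow{t}[n']$ in $\widehat{\mathcal C}$ ($n'=n+1$ for $\nu_n$, else $n'=n$), with interface $n\cdot\star$ mapped into $[n]$, $[n']$ by $[d_1,\dots,d_n]$; any isomorphic cospan is also a basic move. Extended moves: push a move with interface $I$ out along a morphism $I\to Z$ to a position $Z$. Plays: monos $X_0\hookrightarrow U$ with $U$ the colimit of a finite or countable chain of extended moves starting at $X_0$. Views: plays $[n]\hookrightarrow V$ from finite (possibly empty) chains of extended basic moves. $\mathcal E_X$: plays $Y\hookrightarrow U$ with a morphism $Y\to X$; morphisms pairs $(h,k)$ commuting with inclusions and maps to $X$. $\mathcal V_X$: full subcategory of views; $\mathcal S_X=[\mathcal V_X^{op},\mathbf{Set}]$ (innocent strategies). $[n]$ also denotes the position given by the representable on $[n]$. $\mathcal M_n$ is the set of isomorphism classes (as cospans in $\widehat{\mathcal C}$) of basic moves with initial position $[n]$; for $M\colon [n]\to M\leftarrow[n']$ in $\mathcal M_n$, $\mathrm{cod}(M)=[n']$. For a locally small category $\mathcal D$, $\mathrm{Fam}(\mathcal D)$ has as objects pairs $(Y,p)$ of a set $Y$ and a function $p\colon Y\to\mathrm{ob}(\mathcal D)$, and as morphisms $(Y,p)\to(Z,q)$ pairs $(u\colon Y\to Z,\ v\colon Y\to\mathrm{mor}(\mathcal D))$ with $\mathrm{dom}\circ v=p$ and $\mathrm{cod}\circ v=q\circ u$. *)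

theory Defs
  imports
    "HOL-Library.FuncSet"
    "HOL-Library.Countable_Set"
    "HOL-Library.Extended_Nat"
    "HOL-Library.Infinite_Typeclass"
begin

section \<open>Categories\<close>

record ('o, 'a) cat =
  Ob :: "'o set"
  Arr :: "'a set"
  Dom :: "'a \<Rightarrow> 'o"
  Cod :: "'a \<Rightarrow> 'o"
  Ide :: "'o \<Rightarrow> 'a"
  Cmp :: "'a \<Rightarrow> 'a \<Rightarrow> 'a"  \<comment> \<open>\<open>Cmp C g f\<close> is \<open>g\<close> after \<open>f\<close>\<close>

definition hom :: "('o, 'a) cat \<Rightarrow> 'o \<Rightarrow> 'o \<Rightarrow> 'a set" where
  "hom C a b = {f \<in> Arr C. Dom C f = a \<and> Cod C f = b}"

locale category =
  fixes C :: "('o, 'a) cat"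
  assumes dom_cod: "f \<in> Arr C \<Longrightarrow> Dom C f \<in> Ob C \<and> Cod C f \<in> Ob C"
    and ide: "a \<in> Ob C \<Longrightarrow> Ide C a \<in> hom C a a"
    and cmp: "f \<in> hom C a b \<Longrightarrow> g \<in> hom C b c \<Longrightarrow> Cmp C g f \<in> hom C a c"
    and ide_right: "f \<in> hom C a b \<Longrightarrow> Cmp C f (Ide C a) = f"
    and ide_left: "f \<in> hom C a b \<Longrightarrow> Cmp C (Ide C b) f = f"
    and assoc: "f \<in> hom C a b \<Longrightarrow> g \<in> hom C b c \<Longrightarrow> h \<in> hom C c d \<Longrightarrow>
      Cmp C h (Cmp C g f) = Cmp C (Cmp C h g) f"

definition is_iso :: "('o, 'a) cat \<Rightarrow> 'a \<Rightarrow> bool" where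
  "is_iso C f \<longleftrightarrow> f \<in> Arr C \<and>
    (\<exists>g \<in> hom C (Cod C f) (Dom C f). Cmp C g f = Ide C (Dom C f) \<and> Cmp C f g = Ide C (Cod C f))"

definition is_mono :: "('o, 'a) cat \<Rightarrow> 'a \<Rightarrow> bool" where
  "is_mono C m \<longleftrightarrow> m \<in> Arr C \<and>
    (\<forall>a. \<forall>f \<in> hom C a (Dom C m). \<forall>g \<in> hom C a (Dom C m). Cmp C m f = Cmp C m g \<longrightarrow> f = g)"

definition op_cat :: "('o, 'a) cat \<Rightarrow> ('o, 'a) cat" where
  "op_cat C = C\<lparr>Dom := Cod C, Cod := Dom C, Cmp := (\<lambda>g f. Cmp C f g)\<rparr>"

definition full_subcat :: "('o, 'a) cat \<Rightarrow> ('o \<Rightarrow> bool) \<Rightarrow> ('o, 'a) cat" where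
  "full_subcat C P = C\<lparr>Ob := {a \<in> Ob C. P a}, Arr := {f \<in> Arr C. P (Dom C f) \<and> P (Cod C f)}\<rparr>"

subsection \<open>Functors and equivalences\<close>

record ('o1, 'a1, 'o2, 'a2) ftor =
  FO :: "'o1 \<Rightarrow> 'o2"
  FA :: "'a1 \<Rightarrow> 'a2"

definition is_functor :: "('o1, 'a1) cat \<Rightarrow> ('o2, 'a2) cat \<Rightarrow> ('o1, 'a1, 'o2, 'a2) ftor \<Rightarrow> bool" where
  "is_functor A B F \<longleftrightarrow>
    (\<forall>a \<in> Ob A. FO F a \<in> Ob B) \<and>
    (\<forall>f \<in> Arr A. FA F f \<in> hom B (FO F (Dom A f)) (FO F (Cod A f))) \<and>
    (\<forall>a \<in> Ob A. FA F (Ide A a) = Ide B (FO F a)) \<and>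
    (\<forall>f \<in> Arr A. \<forall>g \<in> Arr A. Cod A f = Dom A g \<longrightarrow> FA F (Cmp A g f) = Cmp B (FA F g) (FA F f))"

definition id_ftor :: "('o, 'a, 'o, 'a) ftor" where
  "id_ftor = \<lparr>FO = (\<lambda>a. a), FA = (\<lambda>f. f)\<rparr>"

definition comp_ftor ::
  "('o2, 'a2, 'o3, 'a3) ftor \<Rightarrow> ('o1, 'a1, 'o2, 'a2) ftor \<Rightarrow> ('o1, 'a1, 'o3, 'a3) ftor" where
  "comp_ftor G F = \<lparr>FO = FO G \<circ> FO F, FA = FA G \<circ> FA F\<rparr>"

definition is_nat_trans :: "('o1, 'a1) cat \<Rightarrow> ('o2, 'a2) cat \<Rightarrow>
    ('o1, 'a1, 'o2, 'a2) ftor \<Rightarrow> ('o1, 'a1, 'o2, 'a2) ftor \<Rightarrow> ('o1 \<Rightarrow> 'a2) \<Rightarrow> bool" where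
  "is_nat_trans A B F G \<alpha> \<longleftrightarrow>
    (\<forall>a \<in> Ob A. \<alpha> a \<in> hom B (FO F a) (FO G a)) \<and>
    (\<forall>f \<in> Arr A. Cmp B (\<alpha> (Cod A f)) (FA F f) = Cmp B (FA G f) (\<alpha> (Dom A f)))"

definition naturally_isomorphic :: "('o1, 'a1) cat \<Rightarrow> ('o2, 'a2) cat \<Rightarrow>
    ('o1, 'a1, 'o2, 'a2) ftor \<Rightarrow> ('o1, 'a1, 'o2, 'a2) ftor \<Rightarrow> bool" where
  "naturally_isomorphic A B F G \<longleftrightarrow> (\<exists>\<alpha>. is_nat_trans A B F G \<alpha> \<and> (\<forall>a \<in> Ob A. is_iso B (\<alpha> a)))"

definition equivalent_categories :: "('o1, 'a1) cat \<Rightarrow> ('o2, 'a2) cat \<Rightarrow> bool" where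
  "equivalent_categories A B \<longleftrightarrow> category A \<and> category B \<and>
    (\<exists>F G. is_functor A B F \<and> is_functor B A G \<and>
      naturally_isomorphic A A (comp_ftor G F) id_ftor \<and>
      naturally_isomorphic B B (comp_ftor F G) id_ftor)"

subsection \<open>Colimits\<close>

text \<open>A diagram has nodes \<open>J\<close>, an object \<open>D j\<close> at each node \<open>j\<close>, and a set \<open>E\<close> of
  labelled edges: \<open>(j, k, f) \<in> E\<close> stands for \<open>f : D j \<rightarrow> D k\<close>.\<close>

definition is_cocone :: "('o, 'a) cat \<Rightarrow> 'j set \<Rightarrow> ('j \<Rightarrow> 'o) \<Rightarrow> ('j \<times> 'j \<times> 'a) set \<Rightarrow>
    'o \<Rightarrow> ('j \<Rightarrow> 'a) \<Rightarrow> bool" where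
  "is_cocone C J D E P q \<longleftrightarrow> P \<in> Ob C \<and> (\<forall>j \<in> J. q j \<in> hom C (D j) P) \<and>
    (\<forall>(j, k, f) \<in> E. Cmp C (q k) f = q j)"

definition is_colimit :: "('o, 'a) cat \<Rightarrow> 'j set \<Rightarrow> ('j \<Rightarrow> 'o) \<Rightarrow> ('j \<times> 'j \<times> 'a) set \<Rightarrow>
    'o \<Rightarrow> ('j \<Rightarrow> 'a) \<Rightarrow> bool" where
  "is_colimit C J D E P q \<longleftrightarrow>
    (\<forall>j \<in> J. D j \<in> Ob C) \<and> (\<forall>(j, k, f) \<in> E. j \<in> J \<and> k \<in> J \<and> f \<in> hom C (D j) (D k)) \<and>
    is_cocone C J D E P q \<and>
    (\<forall>Q r. is_cocone C J D E Q r \<longrightarrow> (\<exists>!m. m \<in> hom C P Q \<and> (\<forall>j \<in> J. Cmp C m (q j) = r j)))"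

definition comm_square :: "('o, 'a) cat \<Rightarrow> 'a \<Rightarrow> 'a \<Rightarrow> 'a \<Rightarrow> 'a \<Rightarrow> bool" where
  "comm_square C f g p q \<longleftrightarrow> {f, g, p, q} \<subseteq> Arr C \<and>
    Dom C f = Dom C g \<and> Dom C p = Cod C f \<and> Dom C q = Cod C g \<and> Cod C p = Cod C q \<and>
    Cmp C p f = Cmp C q g"

definition is_pushout :: "('o, 'a) cat \<Rightarrow> 'a \<Rightarrow> 'a \<Rightarrow> 'a \<Rightarrow> 'a \<Rightarrow> bool" where
  "is_pushout C f g p q \<longleftrightarrow> comm_square C f g p q \<and>
    (\<forall>p' q'. comm_square C f g p' q' \<longrightarrow>
      (\<exists>!m. m \<in> hom C (Cod C p) (Cod C p') \<and> Cmp C m p = p' \<and> Cmp C m q = q'))"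

subsection \<open>Sets, functor categories, products, families\<close>

datatype ('o, 'x) arrow = Arrow (src: 'o) (val: 'x) (tgt: 'o)

text \<open>The universe of small sets consists of the subsets of a type \<open>'u\<close>; it is only ever used
  for infinite \<open>'u\<close>.\<close>

type_synonym 'u sarr = "('u set, 'u \<Rightarrow> 'u) arrow"

definition Sets :: "('u set, 'u sarr) cat" where
  "Sets = \<lparr>Ob = UNIV, Arr = {Arrow A f B | A f B. f \<in> A \<rightarrow>\<^sub>E B}, Dom = src, Cod = tgt,
    Ide = (\<lambda>A. Arrow A (\<lambda>x\<in>A. x) A),
    Cmp = (\<lambda>g f. Arrow (src f) (compose (src f) (val g) (val f)) (tgt g))\<rparr>"

definition functor_cat :: "('o1, 'a1) cat \<Rightarrow> ('o2, 'a2) cat \<Rightarrow>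
    (('o1, 'a1, 'o2, 'a2) ftor, (('o1, 'a1, 'o2, 'a2) ftor, 'o1 \<Rightarrow> 'a2) arrow) cat" where
  "functor_cat A B =
    (let Fs = {F. is_functor A B F \<and> FO F \<in> extensional (Ob A) \<and> FA F \<in> extensional (Arr A)} in
    \<lparr>Ob = Fs,
     Arr = {Arrow F \<alpha> G | F \<alpha> G. F \<in> Fs \<and> G \<in> Fs \<and> is_nat_trans A B F G \<alpha> \<and> \<alpha> \<in> extensional (Ob A)},
     Dom = src, Cod = tgt,
     Ide = (\<lambda>F. Arrow F (\<lambda>a\<in>Ob A. Ide B (FO F a)) F),
     Cmp = (\<lambda>\<beta> \<alpha>. Arrow (src \<alpha>) (\<lambda>a\<in>Ob A. Cmp B (val \<beta> a) (val \<alpha> a)) (tgt \<beta>))\<rparr>)"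

definition product_cat :: "'i set \<Rightarrow> ('i \<Rightarrow> ('o, 'a) cat) \<Rightarrow> ('i \<Rightarrow> 'o, 'i \<Rightarrow> 'a) cat" where
  "product_cat I C =
    \<lparr>Ob = (\<Pi>\<^sub>E i\<in>I. Ob (C i)), Arr = (\<Pi>\<^sub>E i\<in>I. Arr (C i)),
     Dom = (\<lambda>f. \<lambda>i\<in>I. Dom (C i) (f i)), Cod = (\<lambda>f. \<lambda>i\<in>I. Cod (C i) (f i)),
     Ide = (\<lambda>a. \<lambda>i\<in>I. Ide (C i) (a i)),
     Cmp = (\<lambda>g f. \<lambda>i\<in>I. Cmp (C i) (g i) (f i))\<rparr>"

type_synonym ('u, 'o) fam = "'u set \<times> ('u \<Rightarrow> 'o)"
type_synonym ('u, 'o, 'a) fam_arr = "(('u, 'o) fam, ('u \<Rightarrow> 'u) \<times> ('u \<Rightarrow> 'a)) arrow"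

definition Fam :: "('o, 'a) cat \<Rightarrow> (('u, 'o) fam, ('u, 'o, 'a) fam_arr) cat" where
  "Fam D =
    (let Fs = {(Y, p). p \<in> Y \<rightarrow>\<^sub>E Ob D} in
    \<lparr>Ob = Fs,
     Arr = {Arrow (Y, p) (u, v) (Z, q) | Y p u v Z q.
       (Y, p) \<in> Fs \<and> (Z, q) \<in> Fs \<and> u \<in> Y \<rightarrow>\<^sub>E Z \<and> v \<in> Y \<rightarrow>\<^sub>E Arr D \<and>
       (\<forall>y\<in>Y. Dom D (v y) = p y \<and> Cod D (v y) = q (u y))},
     Dom = src, Cod = tgt,
     Ide = (\<lambda>(Y, p). Arrow (Y, p) (\<lambda>y\<in>Y. y, \<lambda>y\<in>Y. Ide D (p y)) (Y, p)),
     Cmp = (\<lambda>g f. case (src f, val f, val g) of ((Y, p), (u, v), (u', v')) \<Rightarrow>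
       Arrow (Y, p) (compose Y u' u, \<lambda>y\<in>Y. Cmp D (v' (u y)) (v y)) (tgt g))\<rparr>)"

section \<open>The base category\<close>

datatype bobj = Star | Pl nat
  | Tick nat | ParaL nat | ParaR nat | Nu nat | IotaP nat nat | IotaM nat nat
  | Para nat | Tau nat nat nat nat

instance bobj :: countable by countable_datatype

definition bobjs :: "bobj set" where
  "bobjs = {Star} \<union> (\<Union>n. {Pl n, Tick n, ParaL n, ParaR n, Nu n, Para n}) \<union>
    {c. \<exists>n. \<exists>i\<in>{1..n}. c = IotaP n i \<or> c = IotaM n i} \<union>
    {Tau n i m j | n i m j. i \<in> {1..n} \<and> j \<in> {1..m}}"

text \<open>\<open>st_obj c n n'\<close>: the object \<open>c\<close> carries arrows \<open>s : [n] \<rightarrow> c\<close> and \<open>t : [n'] \<rightarrow> c\<close>.\<close>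

inductive st_obj :: "bobj \<Rightarrow> nat \<Rightarrow> nat \<Rightarrow> bool" where
  "st_obj (Tick n) n n"
| "st_obj (ParaL n) n n"
| "st_obj (ParaR n) n n"
| "st_obj (Nu n) n (Suc n)"
| "i \<in> {1..n} \<Longrightarrow> st_obj (IotaP n i) n n"
| "i \<in> {1..n} \<Longrightarrow> st_obj (IotaM n i) n n"

datatype gen = Gd nat nat | Gs bobj | Gt bobj | Gl nat | Gr nat
  | Geps nat nat nat nat | Grho nat nat nat nat

instance gen :: countable by countable_datatype

inductive edge :: "bobj \<Rightarrow> gen \<Rightarrow> bobj \<Rightarrow> bool" where
  "i \<in> {1..n} \<Longrightarrow> edge Star (Gd n i) (Pl n)"
| "st_obj c n n' \<Longrightarrow> edge (Pl n) (Gs c) c"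
| "st_obj c n n' \<Longrightarrow> edge (Pl n') (Gt c) c"
| "edge (ParaL n) (Gl n) (Para n)"
| "edge (ParaR n) (Gr n) (Para n)"
| "i \<in> {1..n} \<Longrightarrow> j \<in> {1..m} \<Longrightarrow> edge (IotaP n i) (Geps n i m j) (Tau n i m j)"
| "i \<in> {1..n} \<Longrightarrow> j \<in> {1..m} \<Longrightarrow> edge (IotaM m j) (Grho n i m j) (Tau n i m j)"

text \<open>Paths list the generators in diagrammatic order: \<open>[f, g]\<close> is \<open>g\<close> after \<open>f\<close>.\<close>

inductive bpath :: "bobj \<Rightarrow> gen list \<Rightarrow> bobj \<Rightarrow> bool" where
  "a \<in> bobjs \<Longrightarrow> bpath a [] a"
| "edge a g b \<Longrightarrow> bpath b p c \<Longrightarrow> bpath a (g # p) c"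

inductive brel :: "gen list \<Rightarrow> gen list \<Rightarrow> bool" where
  "st_obj c n n' \<Longrightarrow> i \<in> {1..n} \<Longrightarrow> brel [Gd n i, Gs c] [Gd n' i, Gt c]"
| "brel [Gs (ParaL n), Gl n] [Gs (ParaR n), Gr n]"
| "i \<in> {1..n} \<Longrightarrow> j \<in> {1..m} \<Longrightarrow>
    brel [Gd n i, Gs (IotaP n i), Geps n i m j] [Gd m j, Gs (IotaM m j), Grho n i m j]"

inductive bcong :: "gen list \<Rightarrow> gen list \<Rightarrow> bool" where
  bcong_rel: "brel u v \<Longrightarrow> bcong (p @ u @ q) (p @ v @ q)"
| bcong_refl: "bcong p p"
| bcong_sym: "bcong p q \<Longrightarrow> bcong q p"
| bcong_trans: "bcong p q \<Longrightarrow> bcong q r \<Longrightarrow> bcong p r"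

type_synonym barr = "(bobj, gen list set) arrow"

definition barrow :: "bobj \<Rightarrow> gen list \<Rightarrow> bobj \<Rightarrow> barr" where
  "barrow a p b = Arrow a {q. bcong p q} b"

definition Base :: "(bobj, barr) cat" where
  "Base = \<lparr>Ob = bobjs, Arr = {barrow a p b | a p b. bpath a p b}, Dom = src, Cod = tgt,
    Ide = (\<lambda>a. barrow a [] a),
    Cmp = (\<lambda>g f. Arrow (src f) {r. \<exists>p\<in>val f. \<exists>q\<in>val g. bcong (p @ q) r} (tgt g))\<rparr>"

section \<open>Presheaves on the base category\<close>

type_synonym 'u psh = "(bobj, barr, 'u set, 'u sarr) ftor"
type_synonym 'u parr = "('u psh, bobj \<Rightarrow> 'u sarr) arrow"

definition Chat :: "('u psh, 'u parr) cat" where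
  "Chat = functor_cat (op_cat Base) Sets"

abbreviation ccmp :: "'u parr \<Rightarrow> 'u parr \<Rightarrow> 'u parr" (infixl "\<odot>" 70) where
  "g \<odot> f \<equiv> Cmp Chat g f"

text \<open>The arrows of the base category form a countable set, so they can be named injectively by
  elements of any infinite type; this turns its hom-sets into small sets.\<close>

definition enc :: "barr \<Rightarrow> 'u::infinite" where
  "enc = (SOME f. inj_on f (Arr Base))"

lemma inj_on_enc: "inj_on (enc :: barr \<Rightarrow> 'u::infinite) (Arr Base)"
proof -
  have "Arr Base \<subseteq> (\<lambda>x. barrow (fst x) (fst (snd x)) (snd (snd x))) ` UNIV"
  proof
    fix f assume "f \<in> Arr Base"
    then obtain a p b where "f = barrow a p b" by (auto simp: Base_def)
    then show "f \<in> (\<lambda>x. barrow (fst x) (fst (snd x)) (snd (snd x))) ` UNIV"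
      by (intro image_eqI[where x = "(a, p, b)"]) auto
  qed
  then have "countable (Arr Base)"
    by (rule countable_subset) auto
  then obtain h :: "barr \<Rightarrow> nat" where h: "inj_on h (Arr Base)"
    by (auto simp: countable_def)
  obtain k :: "nat \<Rightarrow> 'u" where "inj k"
    using infinite_countable_subset[OF infinite_UNIV] by blast
  then have "inj_on (k \<circ> h) (Arr Base)"
    using h by (auto intro: comp_inj_on inj_on_subset)
  then show ?thesis unfolding enc_def by (rule someI[where P = "\<lambda>f. inj_on f (Arr Base)"])
qed

definition dec :: "'u::infinite \<Rightarrow> barr" where
  "dec = inv_into (Arr Base) enc"

definition yo :: "bobj \<Rightarrow> 'u::infinite psh" where
  "yo c = \<lparr>FO = (\<lambda>d\<in>Ob Base. enc ` hom Base d c),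
    FA = (\<lambda>f\<in>Arr Base. Arrow (enc ` hom Base (tgt f) c)
      (\<lambda>x\<in>enc ` hom Base (tgt f) c. enc (Cmp Base (dec x) f)) (enc ` hom Base (src f) c))\<rparr>"

definition yo_arr :: "barr \<Rightarrow> 'u::infinite parr" where
  "yo_arr f = Arrow (yo (src f))
    (\<lambda>d\<in>Ob Base. Arrow (enc ` hom Base d (src f))
      (\<lambda>x\<in>enc ` hom Base d (src f). enc (Cmp Base f (dec x))) (enc ` hom Base d (tgt f)))
    (yo (tgt f))"

text \<open>The image under the Yoneda embedding of the arrow denoted by a path.\<close>

abbreviation yo_path :: "bobj \<Rightarrow> gen list \<Rightarrow> bobj \<Rightarrow> 'u::infinite parr" where
  "yo_path a p b \<equiv> yo_arr (barrow a p b)"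

abbreviation yd :: "nat \<Rightarrow> nat \<Rightarrow> 'u::infinite parr" where
  "yd n i \<equiv> yo_path Star [Gd n i] (Pl n)"

definition is_position :: "'u psh \<Rightarrow> bool" where
  "is_position X \<longleftrightarrow> X \<in> Ob Chat \<and> (\<forall>c \<in> Ob Base - ({Star} \<union> range Pl). FO X c = {}) \<and>
    finite (SIGMA c : Ob Base. FO X c)"

section \<open>Moves\<close>

text \<open>A cospan is a pair \<open>(s, t)\<close> of arrows of presheaves with common target; its initial position
  is the source of \<open>s\<close> and its final position the source of \<open>t\<close>.\<close>

type_synonym 'u cospan = "'u parr \<times> 'u parr"

definition is_cospan :: "'u cospan \<Rightarrow> bool" where
  "is_cospan M \<longleftrightarrow> fst M \<in> Arr Chat \<and> snd M \<in> Arr Chat \<and> tgt (fst M) = tgt (snd M)"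

definition cospan_iso_by :: "'u parr \<Rightarrow> 'u parr \<Rightarrow> 'u parr \<Rightarrow> 'u cospan \<Rightarrow> 'u cospan \<Rightarrow> bool" where
  "cospan_iso_by x u y M N \<longleftrightarrow> is_cospan M \<and> is_cospan N \<and>
    is_iso Chat x \<and> src x = src (fst M) \<and> tgt x = src (fst N) \<and>
    is_iso Chat u \<and> src u = tgt (fst M) \<and> tgt u = tgt (fst N) \<and>
    is_iso Chat y \<and> src y = src (snd M) \<and> tgt y = src (snd N) \<and>
    fst N \<odot> x = u \<odot> fst M \<and> snd N \<odot> y = u \<odot> snd M"

definition basic_cospan :: "bobj \<Rightarrow> nat \<Rightarrow> nat \<Rightarrow> 'u::infinite cospan" where
  "basic_cospan c n n' = (yo_path (Pl n) [Gs c] c, yo_path (Pl n') [Gt c] c)"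

text \<open>\<open>I\<close> is \<open>n \<cdot> \<star>\<close> with injections \<open>\<iota>\<close>.\<close>

definition is_copower_star :: "nat \<Rightarrow> 'u::infinite psh \<Rightarrow> (nat \<Rightarrow> 'u parr) \<Rightarrow> bool" where
  "is_copower_star n I \<iota> \<longleftrightarrow> is_colimit Chat {1..n} (\<lambda>_. yo Star) {} I \<iota>"

text \<open>\<open>basic_move M a b\<close>: the cospan \<open>M\<close> is a basic move, with interface included by
  \<open>a\<close> into the initial and by \<open>b\<close> into the final position.\<close>

definition basic_move :: "'u::infinite cospan \<Rightarrow> 'u parr \<Rightarrow> 'u parr \<Rightarrow> bool" where
  "basic_move M a b \<longleftrightarrow>
    (\<exists>c n n' x u y I \<iota>. st_obj c n n' \<and> cospan_iso_by x u y (basic_cospan c n n') M \<and>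
      is_copower_star n I \<iota> \<and> a \<in> hom Chat I (src (fst M)) \<and> b \<in> hom Chat I (src (snd M)) \<and>
      (\<forall>i\<in>{1..n}. a \<odot> \<iota> i = x \<odot> yd n i \<and> b \<odot> \<iota> i = y \<odot> yd n' i))"

text \<open>Forking, \<open>[n] \<rightarrow> para_n \<leftarrow> [n] | [n]\<close>, and synchronisation,
  \<open>[n] _i|_j [m] \<rightarrow> \<tau> \<leftarrow> [n] _i|_j [m]\<close>, where \<open>|\<close> glues two players along all
  their channels, and \<open>_i|_j\<close> along the \<open>i\<close>-th channel of the first and the \<open>j\<close>-th channel of the
  second. They occur in plays but not in views.\<close>

definition fork_move :: "'u::infinite cospan \<Rightarrow> 'u parr \<Rightarrow> 'u parr \<Rightarrow> bool" where
  "fork_move M a b \<longleftrightarrow> is_cospan M \<and>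
    (\<exists>n x u I \<iota> e y1 y2.
      is_iso Chat x \<and> src x = yo (Pl n) \<and> tgt x = src (fst M) \<and>
      is_iso Chat u \<and> src u = yo (Para n) \<and> tgt u = tgt (fst M) \<and>
      is_copower_star n I \<iota> \<and> e \<in> hom Chat I (yo (Pl n)) \<and> (\<forall>i\<in>{1..n}. e \<odot> \<iota> i = yd n i) \<and>
      is_pushout Chat e e y1 y2 \<and> tgt y1 = src (snd M) \<and>
      fst M \<odot> x = u \<odot> yo_path (Pl n) [Gs (ParaL n), Gl n] (Para n) \<and>
      snd M \<odot> y1 = u \<odot> yo_path (Pl n) [Gt (ParaL n), Gl n] (Para n) \<and>
      snd M \<odot> y2 = u \<odot> yo_path (Pl n) [Gt (ParaR n), Gr n] (Para n) \<and>
      a = x \<odot> e \<and> b = y1 \<odot> e)"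

definition sync_move :: "'u::infinite cospan \<Rightarrow> 'u parr \<Rightarrow> 'u parr \<Rightarrow> bool" where
  "sync_move M a b \<longleftrightarrow> is_cospan M \<and>
    (\<exists>n i m j u x1 x2 y1 y2 I1 \<iota>1 e1 I2 \<iota>2 e2 k1 k2.
      i \<in> {1..n} \<and> j \<in> {1..m} \<and>
      is_iso Chat u \<and> src u = yo (Tau n i m j) \<and> tgt u = tgt (fst M) \<and>
      is_pushout Chat (yd n i) (yd m j) x1 x2 \<and> tgt x1 = src (fst M) \<and>
      is_pushout Chat (yd n i) (yd m j) y1 y2 \<and> tgt y1 = src (snd M) \<and>
      fst M \<odot> x1 = u \<odot> yo_path (Pl n) [Gs (IotaP n i), Geps n i m j] (Tau n i m j) \<and>
      fst M \<odot> x2 = u \<odot> yo_path (Pl m) [Gs (IotaM m j), Grho n i m j] (Tau n i m j) \<and>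
      snd M \<odot> y1 = u \<odot> yo_path (Pl n) [Gt (IotaP n i), Geps n i m j] (Tau n i m j) \<and>
      snd M \<odot> y2 = u \<odot> yo_path (Pl m) [Gt (IotaM m j), Grho n i m j] (Tau n i m j) \<and>
      is_copower_star n I1 \<iota>1 \<and> e1 \<in> hom Chat I1 (yo (Pl n)) \<and> (\<forall>k\<in>{1..n}. e1 \<odot> \<iota>1 k = yd n k) \<and>
      is_copower_star m I2 \<iota>2 \<and> e2 \<in> hom Chat I2 (yo (Pl m)) \<and> (\<forall>k\<in>{1..m}. e2 \<odot> \<iota>2 k = yd m k) \<and>
      is_pushout Chat (\<iota>1 i) (\<iota>2 j) k1 k2 \<and>
      a \<in> hom Chat (tgt k1) (src (fst M)) \<and> a \<odot> k1 = x1 \<odot> e1 \<and> a \<odot> k2 = x2 \<odot> e2 \<and>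
      b \<in> hom Chat (tgt k1) (src (snd M)) \<and> b \<odot> k1 = y1 \<odot> e1 \<and> b \<odot> k2 = y2 \<odot> e2)"

definition move :: "'u::infinite cospan \<Rightarrow> 'u parr \<Rightarrow> 'u parr \<Rightarrow> bool" where
  "move M a b \<longleftrightarrow> basic_move M a b \<or> fork_move M a b \<or> sync_move M a b"

text \<open>\<open>N\<close> is obtained from a move \<open>M\<close> of kind \<open>K\<close> by pushing it out along \<open>z : I \<rightarrow> Z\<close>.\<close>

definition extended :: "('u cospan \<Rightarrow> 'u parr \<Rightarrow> 'u parr \<Rightarrow> bool) \<Rightarrow> 'u cospan \<Rightarrow> bool" where
  "extended K N \<longleftrightarrow> is_cospan N \<and>
    (\<exists>M a b z x zx u zu y zy. K M a b \<and> z \<in> hom Chat (src a) (tgt z) \<and> is_position (tgt z) \<and>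
      is_pushout Chat a z x zx \<and> tgt x = src (fst N) \<and>
      is_pushout Chat (fst M \<odot> a) z u zu \<and> tgt u = tgt (fst N) \<and>
      is_pushout Chat b z y zy \<and> tgt y = src (snd N) \<and>
      fst N \<odot> x = u \<odot> fst M \<and> fst N \<odot> zx = zu \<and>
      snd N \<odot> y = u \<odot> snd M \<and> snd N \<odot> zy = zu)"

section \<open>Plays, views and innocent strategies\<close>

text \<open>\<open>i : X 0 \<rightarrow> U\<close> is the inclusion into the colimit of the zigzag
  \<open>X 0 \<rightarrow> U 0 \<leftarrow> X 1 \<rightarrow> U 1 \<leftarrow> X 2 \<rightarrow> \<dots>\<close> formed by \<open>N\<close> successive cospans \<open>M 0, M 1, \<dots>\<close>
  satisfying \<open>K\<close>; the node \<open>Inl k\<close> carries \<open>X k\<close> and \<open>Inr k\<close> carries \<open>U k\<close>.\<close>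

definition chain_play :: "('u cospan \<Rightarrow> bool) \<Rightarrow> enat \<Rightarrow> 'u parr \<Rightarrow> bool" where
  "chain_play K N i \<longleftrightarrow> is_mono Chat i \<and> is_position (src i) \<and>
    (\<exists>(X :: nat \<Rightarrow> 'u psh) (M :: nat \<Rightarrow> 'u cospan) (q :: nat + nat \<Rightarrow> 'u parr).
      X 0 = src i \<and> q (Inl 0) = i \<and>
      (\<forall>k. enat k < N \<longrightarrow> K (M k) \<and> src (fst (M k)) = X k \<and> src (snd (M k)) = X (Suc k)) \<and>
      is_colimit Chat (Inl ` {k. enat k \<le> N} \<union> Inr ` {k. enat k < N})
        (case_sum X (\<lambda>k. tgt (fst (M k))))
        ((\<lambda>k. (Inl k, Inr k, fst (M k))) ` {k. enat k < N} \<union>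
         (\<lambda>k. (Inl (Suc k), Inr k, snd (M k))) ` {k. enat k < N})
        (tgt i) q)"

definition is_play :: "'u::infinite parr \<Rightarrow> bool" where
  "is_play i \<longleftrightarrow> (\<exists>N. chain_play (extended move) N i)"

definition is_view :: "'u::infinite parr \<Rightarrow> bool" where
  "is_view i \<longleftrightarrow> (\<exists>n. src i = yo (Pl n)) \<and> (\<exists>N. chain_play (extended basic_move) (enat N) i)"

type_synonym 'u play_over = "'u parr \<times> 'u parr"
type_synonym 'u play_arr = "('u play_over, 'u parr \<times> 'u parr) arrow"

definition Plays :: "'u::infinite psh \<Rightarrow> ('u play_over, 'u play_arr) cat" where
  "Plays X =
    (let Ps = {(i, p). is_play i \<and> p \<in> hom Chat (src i) X} in
    \<lparr>Ob = Ps,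
     Arr = {Arrow (i, p) (h, k) (i', p') | i p h k i' p'. (i, p) \<in> Ps \<and> (i', p') \<in> Ps \<and>
       h \<in> hom Chat (src i) (src i') \<and> k \<in> hom Chat (tgt i) (tgt i') \<and>
       k \<odot> i = i' \<odot> h \<and> p' \<odot> h = p},
     Dom = src, Cod = tgt,
     Ide = (\<lambda>(i, p). Arrow (i, p) (Ide Chat (src i), Ide Chat (tgt i)) (i, p)),
     Cmp = (\<lambda>g f. Arrow (src f) (fst (val g) \<odot> fst (val f), snd (val g) \<odot> snd (val f)) (tgt g))\<rparr>)"

definition Views :: "'u::infinite psh \<Rightarrow> ('u play_over, 'u play_arr) cat" where
  "Views X = full_subcat (Plays X) (\<lambda>(i, p). is_view i)"

type_synonym 'u strategy = "('u play_over, 'u play_arr, 'u set, 'u sarr) ftor"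
type_synonym 'u strategy_arr = "('u strategy, 'u play_over \<Rightarrow> 'u sarr) arrow"

definition Strat :: "'u::infinite psh \<Rightarrow> ('u strategy, 'u strategy_arr) cat" where
  "Strat X = functor_cat (op_cat (Views X)) Sets"

definition basic_moves_from :: "nat \<Rightarrow> 'u::infinite cospan set" where
  "basic_moves_from n = {M. src (fst M) = yo (Pl n) \<and> (\<exists>a b. basic_move M a b)}"

definition move_classes :: "nat \<Rightarrow> 'u::infinite cospan set set" where
  "move_classes n =
    basic_moves_from n // {(M, N) \<in> basic_moves_from n \<times> basic_moves_from n. \<exists>x u y. cospan_iso_by x u y M N}"

definition cod_pos :: "'u::infinite cospan set \<Rightarrow> 'u psh" where
  "cod_pos \<M> = yo (Pl (THE n'. \<exists>M\<in>\<M>. src (snd M) = yo (Pl n')))"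

end

theory Submission
  imports Defs "HOL-Library.Sublist"
begin

text \<open>
  Extending a basic move along a position yields a single player only if nothing is added, so a
  view from \<open>[n]\<close> is, up to isomorphism, a composable word of objects \<open>c\<close> with arrows \<open>s\<close>, \<open>t\<close>,
  starting at \<open>[n]\<close>. A map of views preserving the initial player sends the \<open>k\<close>-th move to the
  \<open>k\<close>-th move; hence it is unique, and it exists iff one word is a prefix of the other. So the
  category of views over \<open>[n]\<close> is equivalent to the poset of words, whose part above the empty word
  is the disjoint union, over the first letters, of the posets of words for the codomains of these
  letters. A presheaf \<open>P\<close> on such a tree is the set \<open>P(root)\<close> together with, for each of its
  elements, the fibres of \<open>P\<close> over it in each branch.
\<close>

text \<open>The pushouts that extend moves and the colimits that form plays are never computed. A
  view is characterised by the maps out of it: \<open>univ\<close> says that these are the threads,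
  an initial player followed by moves, each starting at the player reached so far. This can be read
  off the zigzag because each of its nodes is isomorphic to a representable. The explicit presheaf
  \<open>wview\<close> has the same universal property and is concrete enough to serve as a test
  object. The obstacle lies in the extended moves. The map from the interface to the position
  \<open>Z\<close> is arbitrary: it may identify channels or miss elements of \<open>Z\<close>. That
  nothing of the kind happens has to be extracted from the universal property of the pushout alone,
  knowing only that the initial position is a player. Views with the same word are isomorphic but
  not equal. The category of views is therefore handled as a preorder labelled by words, with chosen
  representatives, and the equivalence is obtained from a fully faithful, essentially surjective
  functor. Since small sets are subsets of one infinite type, disjoint unions have to be coded
  inside that type.\<close>

lemma homI: "f \<in> Arr C \<Longrightarrow> Dom C f = a \<Longrightarrow> Cod C f = b \<Longrightarrow> f \<in> hom C a b"
  by (simp add: hom_def)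

lemma homD: "f \<in> hom C a b \<Longrightarrow> f \<in> Arr C \<and> Dom C f = a \<and> Cod C f = b"
  by (simp add: hom_def)

lemma (in category) hom_Ob: "f \<in> hom C a b \<Longrightarrow> a \<in> Ob C \<and> b \<in> Ob C"
  using dom_cod by (auto simp: hom_def)

lemma op_cat_simps [simp]:
  "Ob (op_cat C) = Ob C" "Arr (op_cat C) = Arr C" "Dom (op_cat C) = Cod C" "Cod (op_cat C) = Dom C"
  "Ide (op_cat C) = Ide C" "Cmp (op_cat C) g f = Cmp C f g" "hom (op_cat C) a b = hom C b a"
  by (auto simp: op_cat_def hom_def)

lemma category_op: "category C \<Longrightarrow> category (op_cat C)"
proof -
  assume "category C"
  then interpret category C .
  show ?thesis
    by (unfold_locales; simp) (use dom_cod ide cmp ide_left ide_right assoc[symmetric] in blast)+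
qed

lemma (in category) is_isoI:
  "f \<in> hom C a b \<Longrightarrow> g \<in> hom C b a \<Longrightarrow> Cmp C g f = Ide C a \<Longrightarrow> Cmp C f g = Ide C b \<Longrightarrow> is_iso C f"
  by (auto simp: is_iso_def hom_def)

lemma (in category) is_isoE:
  assumes "is_iso C f" "f \<in> hom C a b"
  obtains g where "g \<in> hom C b a" "Cmp C g f = Ide C a" "Cmp C f g = Ide C b" "is_iso C g"
  using assms by (fastforce simp: is_iso_def hom_def)

lemma (in category) is_iso_Ide: "a \<in> Ob C \<Longrightarrow> is_iso C (Ide C a)"
  using ide ide_left by (auto intro!: is_isoI)

lemma (in category) is_iso_Cmp:
  assumes "is_iso C f" "is_iso C g" "f \<in> hom C a b" "g \<in> hom C b c"
  shows "is_iso C (Cmp C g f)"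
proof -
  obtain f' where f': "f' \<in> hom C b a" "Cmp C f' f = Ide C a" "Cmp C f f' = Ide C b"
    using is_isoE[OF assms(1,3)] by metis
  obtain g' where g': "g' \<in> hom C c b" "Cmp C g' g = Ide C b" "Cmp C g g' = Ide C c"
    using is_isoE[OF assms(2,4)] by metis
  show ?thesis
  proof (rule is_isoI[where g = "Cmp C f' g'"])
    have "Cmp C (Cmp C f' g') (Cmp C g f) = Cmp C f' (Cmp C (Cmp C g' g) f)"
      using assoc[OF cmp[OF assms(3,4)] g'(1) f'(1)] assoc[OF assms(3,4) g'(1)] by simp
    then show "Cmp C (Cmp C f' g') (Cmp C g f) = Ide C a"
      using assms f' g' by (simp add: ide_left)
    have "Cmp C (Cmp C g f) (Cmp C f' g') = Cmp C g (Cmp C (Cmp C f f') g')"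
      using assoc[OF cmp[OF g'(1) f'(1)] assms(3,4)] assoc[OF g'(1) f'(1) assms(3)] by simp
    then show "Cmp C (Cmp C g f) (Cmp C f' g') = Ide C c"
      using assms f' g' by (simp add: ide_left)
  qed (use assms f' g' cmp in auto)
qed

section \<open>Categories of sets, functors, products and families\<close>

lemma Sets_hom: "f \<in> hom Sets A B \<longleftrightarrow> src f = A \<and> tgt f = B \<and> val f \<in> A \<rightarrow>\<^sub>E B"
  by (cases f) (auto simp: Sets_def hom_def)

lemma Sets_simps:
  "Ob Sets = UNIV" "Dom Sets = src" "Cod Sets = tgt" "Ide Sets A = Arrow A (\<lambda>x\<in>A. x) A"
  "Cmp Sets g f = Arrow (src f) (compose (src f) (val g) (val f)) (tgt g)"
  by (simp_all add: Sets_def)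

lemma category_Sets: "category Sets"
proof
  show "Dom Sets f \<in> Ob Sets \<and> Cod Sets f \<in> Ob Sets" for f :: "'a sarr"
    by (simp add: Sets_simps)
next
  show "Ide Sets A \<in> hom Sets A A" for A :: "'a set"
    by (simp add: Sets_simps Sets_hom)
next
  fix f g :: "'a sarr" and A B C assume "f \<in> hom Sets A B" "g \<in> hom Sets B C"
  then show "Cmp Sets g f \<in> hom Sets A C"
    by (auto simp: Sets_simps Sets_hom compose_def)
next
  fix f :: "'a sarr" and A B assume "f \<in> hom Sets A B"
  then show "Cmp Sets f (Ide Sets A) = f" "Cmp Sets (Ide Sets B) f = f"
    by (cases f; auto simp: Sets_simps Sets_hom compose_Id Id_compose PiE_iff Pi_iff)+
next
  fix f g h :: "'a sarr" and A B C D
  assume "f \<in> hom Sets A B" "g \<in> hom Sets B C" "h \<in> hom Sets C D"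
  then show "Cmp Sets h (Cmp Sets g f) = Cmp Sets (Cmp Sets h g) f"
    by (auto simp: Sets_simps Sets_hom intro!: compose_assoc)
qed

lemma functor_cat_Ob:
  "F \<in> Ob (functor_cat A B) \<longleftrightarrow>
    is_functor A B F \<and> FO F \<in> extensional (Ob A) \<and> FA F \<in> extensional (Arr A)"
  by (simp add: functor_cat_def)

lemma functor_cat_hom:
  "\<alpha> \<in> hom (functor_cat A B) F G \<longleftrightarrow> F \<in> Ob (functor_cat A B) \<and> G \<in> Ob (functor_cat A B) \<and>
    src \<alpha> = F \<and> tgt \<alpha> = G \<and> is_nat_trans A B F G (val \<alpha>) \<and> val \<alpha> \<in> extensional (Ob A)"
  by (cases \<alpha>) (auto simp: functor_cat_def hom_def)

lemma functor_cat_simps: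
  "Dom (functor_cat A B) = src" "Cod (functor_cat A B) = tgt"
  "Ide (functor_cat A B) F = Arrow F (\<lambda>a\<in>Ob A. Ide B (FO F a)) F"
  "Cmp (functor_cat A B) \<beta> \<alpha> =
    Arrow (src \<alpha>) (\<lambda>a\<in>Ob A. Cmp B (val \<beta> a) (val \<alpha> a)) (tgt \<beta>)"
  by (simp_all add: functor_cat_def)

lemma category_functor_cat:
  assumes "category A" "category B"
  shows "category (functor_cat A B)"
proof -
  interpret A: category A by fact
  interpret B: category B by fact
  have natD: "val \<alpha> a \<in> hom B (FO F a) (FO G a)"
    if "\<alpha> \<in> hom (functor_cat A B) F G" "a \<in> Ob A" for \<alpha> F G a
    using that by (auto simp: functor_cat_hom is_nat_trans_def)
  have nat: "Cmp B (val \<alpha> (Cod A f)) (FA F f) = Cmp B (FA G f) (val \<alpha> (Dom A f))"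
    if "\<alpha> \<in> hom (functor_cat A B) F G" "f \<in> Arr A" for \<alpha> F G f
    using that by (auto simp: functor_cat_hom is_nat_trans_def)
  have FA: "FA F f \<in> hom B (FO F (Dom A f)) (FO F (Cod A f))"
    if "F \<in> Ob (functor_cat A B)" "f \<in> Arr A" for F f
    using that by (auto simp: functor_cat_Ob is_functor_def)
  have FOb: "FO F a \<in> Ob B" if "F \<in> Ob (functor_cat A B)" "a \<in> Ob A" for F a
    using that by (auto simp: functor_cat_Ob is_functor_def)
  have cmp': "Cmp (functor_cat A B) \<beta> \<alpha> \<in> hom (functor_cat A B) F H"
    if \<alpha>: "\<alpha> \<in> hom (functor_cat A B) F G" and \<beta>: "\<beta> \<in> hom (functor_cat A B) G H" for \<alpha> \<beta> F G H
  proof -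
    have Obs: "F \<in> Ob (functor_cat A B)" "G \<in> Ob (functor_cat A B)" "H \<in> Ob (functor_cat A B)"
      using \<alpha> \<beta> by (auto simp: functor_cat_hom)
    have "Cmp B (Cmp B (val \<beta> (Cod A f)) (val \<alpha> (Cod A f))) (FA F f) =
        Cmp B (FA H f) (Cmp B (val \<beta> (Dom A f)) (val \<alpha> (Dom A f)))" if f: "f \<in> Arr A" for f
    proof -
      note h = natD[OF \<alpha>, of "Dom A f"] natD[OF \<alpha>, of "Cod A f"] natD[OF \<beta>, of "Dom A f"]
        natD[OF \<beta>, of "Cod A f"] FA[OF Obs(1) f] FA[OF Obs(2) f] FA[OF Obs(3) f]
      have ob: "Dom A f \<in> Ob A" "Cod A f \<in> Ob A" using A.dom_cod[OF f] by auto
      show ?thesis using B.assoc[OF h(5) h(2)[OF ob(2)] h(4)[OF ob(2)]] nat[OF \<alpha> f]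
          B.assoc[OF h(1)[OF ob(1)] h(6) h(4)[OF ob(2)]] nat[OF \<beta> f]
          B.assoc[OF h(1)[OF ob(1)] h(3)[OF ob(1)] h(7)] by simp
    qed
    then show ?thesis using \<alpha> \<beta> Obs natD[OF \<alpha>] natD[OF \<beta>] A.dom_cod
      by (auto simp: functor_cat_hom functor_cat_simps is_nat_trans_def intro!: B.cmp)
  qed
  show ?thesis
  proof
    fix f assume "f \<in> Arr (functor_cat A B)"
    then show "Dom (functor_cat A B) f \<in> Ob (functor_cat A B) \<and> Cod (functor_cat A B) f \<in>
        Ob (functor_cat A B)"
      by (auto simp: functor_cat_def)
  next
    fix a assume a: "a \<in> Ob (functor_cat A B)"
    then show "Ide (functor_cat A B) a \<in> hom (functor_cat A B) a a"
      using A.dom_cod FOb[OF a] B.ide_left[OF FA[OF a]] B.ide_right[OF FA[OF a]]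
      by (auto simp: functor_cat_hom functor_cat_simps is_nat_trans_def B.ide)
  next
    show "\<And>f a b g c. \<lbrakk>f \<in> hom (functor_cat A B) a b; g \<in> hom (functor_cat A B) b c\<rbrakk>
      \<Longrightarrow> Cmp (functor_cat A B) g f \<in> hom (functor_cat A B) a c" by (rule cmp')
  next
    fix f a b assume f: "f \<in> hom (functor_cat A B) a b"
    show "Cmp (functor_cat A B) f (Ide (functor_cat A B) a) = f"
      using f B.ide_right[OF natD[OF f]] by (cases f)
        (auto simp: functor_cat_hom functor_cat_simps fun_eq_iff restrict_def extensional_def)
    show "Cmp (functor_cat A B) (Ide (functor_cat A B) b) f = f"
      using f B.ide_left[OF natD[OF f]] by (cases f)
        (auto simp: functor_cat_hom functor_cat_simps fun_eq_iff restrict_def extensional_def)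
  next
    fix f a b g c h d
    assume f: "f \<in> hom (functor_cat A B) a b" and g: "g \<in> hom (functor_cat A B) b c"
      and h: "h \<in> hom (functor_cat A B) c d"
    show "Cmp (functor_cat A B) h (Cmp (functor_cat A B) g f) =
        Cmp (functor_cat A B) (Cmp (functor_cat A B) h g) f"
      using B.assoc[OF natD[OF f] natD[OF g] natD[OF h]]
      by (auto simp: functor_cat_simps fun_eq_iff restrict_def)
  qed
qed

lemma product_cat_hom:
  "f \<in> hom (product_cat I C) a b \<longleftrightarrow>
    f \<in> extensional I \<and> a \<in> extensional I \<and> b \<in> extensional I \<and> (\<forall>i\<in>I. f i \<in> hom (C i) (a i) (b i))"
proof
  assume *: "f \<in> extensional I \<and> a \<in> extensional I \<and> b \<in> extensional I \<and>
      (\<forall>i\<in>I. f i \<in> hom (C i) (a i) (b i))"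
  then have "(\<lambda>i\<in>I. Dom (C i) (f i)) = a" "(\<lambda>i\<in>I. Cod (C i) (f i)) = b"
    by (auto simp: fun_eq_iff restrict_def hom_def extensional_def)
  with * show "f \<in> hom (product_cat I C) a b"
    by (auto simp: hom_def product_cat_def PiE_def)
qed (auto simp: hom_def product_cat_def PiE_def)

lemma category_product_cat:
  assumes "\<And>i. i \<in> I \<Longrightarrow> category (C i)"
  shows "category (product_cat I C)"
proof
  fix f assume "f \<in> Arr (product_cat I C)"
  then show "Dom (product_cat I C) f \<in> Ob (product_cat I C) \<and> Cod (product_cat I C) f \<in>
      Ob (product_cat I C)"
    using category.dom_cod[OF assms] by (auto simp: product_cat_def)
next
  fix a assume "a \<in> Ob (product_cat I C)"
  then show "Ide (product_cat I C) a \<in> hom (product_cat I C) a a"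
    unfolding product_cat_hom using category.ide[OF assms] by (auto simp: product_cat_def PiE_iff)
next
  fix f a b g c assume "f \<in> hom (product_cat I C) a b" "g \<in> hom (product_cat I C) b c"
  then show "Cmp (product_cat I C) g f \<in> hom (product_cat I C) a c"
    unfolding product_cat_hom using category.cmp[OF assms] by (auto simp: product_cat_def)
next
  fix f a b assume "f \<in> hom (product_cat I C) a b"
  then show "Cmp (product_cat I C) f (Ide (product_cat I C) a) = f"
    "Cmp (product_cat I C) (Ide (product_cat I C) b) f = f"
    unfolding product_cat_hom using category.ide_right[OF assms] category.ide_left[OF assms]
    by (auto simp: product_cat_def fun_eq_iff restrict_def extensional_def)
next
  fix f a b g c h d
  assume "f \<in> hom (product_cat I C) a b" "g \<in> hom (product_cat I C) b c" "h \<in> hom (product_cat I C) c d"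
  then show "Cmp (product_cat I C) h (Cmp (product_cat I C) g f) =
      Cmp (product_cat I C) (Cmp (product_cat I C) h g) f"
    unfolding product_cat_hom using category.assoc[OF assms]
    by (fastforce simp: product_cat_def fun_eq_iff restrict_def)
qed

lemma product_cat_is_iso:
  assumes cat: "\<And>i. i \<in> I \<Longrightarrow> category (C i)" and f: "f \<in> hom (product_cat I C) a b"
    and iso: "\<And>i. i \<in> I \<Longrightarrow> is_iso (C i) (f i)"
  shows "is_iso (product_cat I C) f"
proof -
  have "\<exists>g. g \<in> hom (C i) (b i) (a i) \<and> Cmp (C i) g (f i) = Ide (C i) (a i) \<and>
      Cmp (C i) (f i) g = Ide (C i) (b i)" if i: "i \<in> I" for i
    using category.is_isoE[OF cat[OF i] iso[OF i], of "a i" "b i"] f i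
    unfolding product_cat_hom by metis
  then obtain g where g: "\<And>i. i \<in> I \<Longrightarrow> g i \<in> hom (C i) (b i) (a i) \<and>
      Cmp (C i) (g i) (f i) = Ide (C i) (a i) \<and> Cmp (C i) (f i) (g i) = Ide (C i) (b i)"
    by metis
  have h: "restrict g I \<in> hom (product_cat I C) b a"
    using f g by (auto simp: product_cat_hom)
  show ?thesis
    by (rule category.is_isoI[OF category_product_cat[OF cat] f h])
      (use g in \<open>auto simp: product_cat_def fun_eq_iff\<close>)
qed

lemma Fam_hom:
  "f \<in> hom (Fam D) (Y, p) (Z, q) \<longleftrightarrow> p \<in> Y \<rightarrow>\<^sub>E Ob D \<and> q \<in> Z \<rightarrow>\<^sub>E Ob D \<and>
    (\<exists>u v. f = Arrow (Y, p) (u, v) (Z, q) \<and> u \<in> Y \<rightarrow>\<^sub>E Z \<and> v \<in> extensional Y \<and>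
      (\<forall>y\<in>Y. v y \<in> hom D (p y) (q (u y))))"
  by (cases f) (auto simp: Fam_def hom_def PiE_iff)

lemma Fam_simps:
  "Ob (Fam D) = {(Y, p). p \<in> Y \<rightarrow>\<^sub>E Ob D}" "Dom (Fam D) = src" "Cod (Fam D) = tgt"
  "Ide (Fam D) (Y, p) = Arrow (Y, p) (\<lambda>y\<in>Y. y, \<lambda>y\<in>Y. Ide D (p y)) (Y, p)"
  "Cmp (Fam D) (Arrow Q (u', v') R) (Arrow (Y, p) (u, v) S) =
    Arrow (Y, p) (compose Y u' u, \<lambda>y\<in>Y. Cmp D (v' (u y)) (v y)) R"
  by (auto simp: Fam_def)

lemma category_Fam:
  assumes "category D"
  shows "category (Fam D)"
proof -
  interpret D: category D by fact
  show ?thesis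
  proof
    fix f assume "f \<in> Arr (Fam D)"
    then show "Dom (Fam D) f \<in> Ob (Fam D) \<and> Cod (Fam D) f \<in> Ob (Fam D)"
      by (auto simp: Fam_def)
  next
    fix a assume "a \<in> Ob (Fam D)"
    then show "Ide (Fam D) a \<in> hom (Fam D) a a"
      by (cases a) (auto simp: Fam_hom Fam_simps D.ide PiE_def Pi_def)
  next
    fix f a b g c assume "f \<in> hom (Fam D) a b" "g \<in> hom (Fam D) b c"
    then show "Cmp (Fam D) g f \<in> hom (Fam D) a c"
      by (cases a; cases b; cases c)
        (fastforce simp: Fam_hom Fam_simps compose_def PiE_def Pi_def intro: D.cmp)
  next
    fix f a b assume "f \<in> hom (Fam D) a b"
    then show "Cmp (Fam D) f (Ide (Fam D) a) = f" "Cmp (Fam D) (Ide (Fam D) b) f = f"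
      by (cases a; cases b; auto simp: Fam_hom Fam_simps compose_def PiE_def Pi_def fun_eq_iff
          extensional_def intro: D.ide_right D.ide_left)+
  next
    fix f a b g c h d
    assume "f \<in> hom (Fam D) a b" "g \<in> hom (Fam D) b c" "h \<in> hom (Fam D) c d"
    then show "Cmp (Fam D) h (Cmp (Fam D) g f) = Cmp (Fam D) (Cmp (Fam D) h g) f"
      by (cases a; cases b; cases c; cases d)
        (fastforce simp: Fam_hom Fam_simps compose_def PiE_def Pi_def fun_eq_iff intro: D.assoc)
  qed
qed

text \<open>The reindexing is the identity because the comparison map in the proof of essential
  surjectivity keeps the index set. Inverses of the components then assemble to an inverse over the
  same index set.\<close>

lemma Fam_is_iso:
  assumes "category D" and f: "Arrow (Y, p) (\<lambda>y\<in>Y. y, v) (Y, q) \<in> hom (Fam D) (Y, p) (Y, q)"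
    and iso: "\<And>y. y \<in> Y \<Longrightarrow> is_iso D (v y)"
  shows "is_iso (Fam D) (Arrow (Y, p) (\<lambda>y\<in>Y. y, v) (Y, q))"
proof -
  interpret D: category D by fact
  have v: "v y \<in> hom D (p y) (q y)" if "y \<in> Y" for y
    using f that by (auto simp: Fam_hom)
  have "\<exists>g. g \<in> hom D (q y) (p y) \<and> Cmp D g (v y) = Ide D (p y) \<and> Cmp D (v y) g = Ide D (q y)"
    if y: "y \<in> Y" for y
    using D.is_isoE[OF iso[OF y] v[OF y]] by metis
  then obtain g where g: "\<And>y. y \<in> Y \<Longrightarrow> g y \<in> hom D (q y) (p y) \<and>
      Cmp D (g y) (v y) = Ide D (p y) \<and> Cmp D (v y) (g y) = Ide D (q y)"
    by metis
  have h: "Arrow (Y, q) (\<lambda>y\<in>Y. y, restrict g Y) (Y, p) \<in> hom (Fam D) (Y, q) (Y, p)"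
    using f g by (auto simp: Fam_hom)
  show ?thesis
    by (rule category.is_isoI[OF category_Fam[OF assms(1)] f h])
      (use g in \<open>auto simp: Fam_simps compose_def fun_eq_iff\<close>)
qed

text \<open>The quasi-inverse is built by choice: \<open>go b\<close> is a preimage of
  \<open>b\<close> up to the isomorphism \<open>e b\<close>, and \<open>ga g\<close> is the unique
  preimage of the conjugate of \<open>g\<close> by these isomorphisms. Equations between arrows of
  \<open>A\<close> are checked after applying \<open>F\<close>, by faithfulness
  (\<open>inj\<close>).\<close>

lemma equivalent_categoriesI:
  assumes "category A" "category B" and F: "is_functor A B F"
    and ff: "\<And>a a' g. a \<in> Ob A \<Longrightarrow> a' \<in> Ob A \<Longrightarrow> g \<in> hom B (FO F a) (FO F a') \<Longrightarrow>
      \<exists>!f. f \<in> hom A a a' \<and> FA F f = g"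
    and es: "\<And>b. b \<in> Ob B \<Longrightarrow> \<exists>a\<in>Ob A. \<exists>f\<in>hom B (FO F a) b. is_iso B f"
  shows "equivalent_categories A B"
proof -
  interpret A: category A by fact
  interpret B: category B by fact
  have FO: "FO F a \<in> Ob B" if "a \<in> Ob A" for a using F that by (auto simp: is_functor_def)
  have FA: "FA F f \<in> hom B (FO F a) (FO F a')" if "f \<in> hom A a a'" for f a a'
    using F that by (auto simp: is_functor_def hom_def)
  have FI: "FA F (Ide A a) = Ide B (FO F a)" if "a \<in> Ob A" for a
    using F that by (auto simp: is_functor_def)
  have FC: "FA F (Cmp A g f) = Cmp B (FA F g) (FA F f)" if "f \<in> hom A a b" "g \<in> hom A b c" for f g a b c
    using F that by (auto simp: is_functor_def hom_def)
  obtain go where go: "\<And>b. b \<in> Ob B \<Longrightarrow> go b \<in> Ob A \<and> (\<exists>f\<in>hom B (FO F (go b)) b. is_iso B f)"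
    using es by metis
  then obtain e where e: "\<And>b. b \<in> Ob B \<Longrightarrow> e b \<in> hom B (FO F (go b)) b \<and> is_iso B (e b)"
    by metis
  then obtain e' where e': "\<And>b. b \<in> Ob B \<Longrightarrow> e' b \<in> hom B b (FO F (go b)) \<and>
      Cmp B (e' b) (e b) = Ide B (FO F (go b)) \<and> Cmp B (e b) (e' b) = Ide B b"
  proof -
    assume *: thesis if "\<And>b. b \<in> Ob B \<Longrightarrow> e' b \<in> hom B b (FO F (go b)) \<and>
      Cmp B (e' b) (e b) = Ide B (FO F (go b)) \<and> Cmp B (e b) (e' b) = Ide B b" for e'
    have "\<exists>k. k \<in> hom B b (FO F (go b)) \<and>
      Cmp B k (e b) = Ide B (FO F (go b)) \<and> Cmp B (e b) k = Ide B b" if "b \<in> Ob B" for b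
      using B.is_isoE[of "e b"] e[OF that] by blast
    then show thesis using * by metis
  qed
  have hb: "\<exists>f. f \<in> hom A (go (Dom B g)) (go (Cod B g)) \<and>
      FA F f = Cmp B (e' (Cod B g)) (Cmp B g (e (Dom B g)))" if "g \<in> Arr B" for g
  proof -
    have "Cmp B (e' (Cod B g)) (Cmp B g (e (Dom B g))) \<in>
        hom B (FO F (go (Dom B g))) (FO F (go (Cod B g)))"
      using B.dom_cod[OF that] e e' that by (intro B.cmp[where b = "Cod B g"] B.cmp[where b = "Dom B g"])
        (auto intro: homI)
    then show ?thesis using ff[of "go (Dom B g)" "go (Cod B g)"] go B.dom_cod[OF that] by blast
  qed
  then obtain ga where ga: "\<And>g. g \<in> Arr B \<Longrightarrow> ga g \<in> hom A (go (Dom B g)) (go (Cod B g)) \<and>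
      FA F (ga g) = Cmp B (e' (Cod B g)) (Cmp B g (e (Dom B g)))" by metis
  let ?G = "\<lparr>FO = go, FA = ga\<rparr>"
  have inj: "f = f'" if "f \<in> hom A a a'" "f' \<in> hom A a a'" "FA F f = FA F f'" for f f' a a'
    using ff[of a a' "FA F f'"] FA that A.hom_Ob by metis
  have G: "is_functor B A ?G"
    unfolding is_functor_def
  proof (intro conjI ballI impI; simp)
    fix a assume a: "a \<in> Ob B"
    show "go a \<in> Ob A" using go a by auto
    have I: "Ide B a \<in> Arr B" "Dom B (Ide B a) = a" "Cod B (Ide B a) = a"
      using B.ide[OF a] by (auto simp: hom_def)
    show "ga (Ide B a) = Ide A (go a)"
      using a I ga[OF I(1)] go[OF a] e[OF a] e'[OF a]
      by (intro inj[of _ "go a" "go a"]) (auto simp: A.ide FI B.ide_left)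
  next
    fix f assume "f \<in> Arr B" then show "ga f \<in> hom A (go (Dom B f)) (go (Cod B f))"
      using ga by auto
  next
    fix f g assume f: "f \<in> Arr B" and g: "g \<in> Arr B" and fg: "Cod B f = Dom B g"
    let ?a = "Dom B f" and ?b = "Dom B g" and ?c = "Cod B g"
    have fh: "f \<in> hom B ?a ?b" and gh: "g \<in> hom B ?b ?c" using f g fg by (auto simp: hom_def)
    have obs: "?a \<in> Ob B" "?b \<in> Ob B" "?c \<in> Ob B" using B.dom_cod f g by auto
    have gf: "Cmp B g f \<in> hom B ?a ?c" using B.cmp[OF fh gh] .
    have gaf: "ga f \<in> hom A (go ?a) (go ?b)" "FA F (ga f) = Cmp B (e' ?b) (Cmp B f (e ?a))"
      using ga[OF f] fg by auto
    have gag: "ga g \<in> hom A (go ?b) (go ?c)" "FA F (ga g) = Cmp B (e' ?c) (Cmp B g (e ?b))"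
      using ga[OF g] by auto
    have gagf: "ga (Cmp B g f) \<in> hom A (go ?a) (go ?c)"
      "FA F (ga (Cmp B g f)) = Cmp B (e' ?c) (Cmp B (Cmp B g f) (e ?a))"
      using ga[of "Cmp B g f"] homD[OF gf] by auto
    have ea: "e ?a \<in> hom B (FO F (go ?a)) ?a" and eb: "e ?b \<in> hom B (FO F (go ?b)) ?b"
      and e'b: "e' ?b \<in> hom B ?b (FO F (go ?b))" and e'c: "e' ?c \<in> hom B ?c (FO F (go ?c))"
      and eb': "Cmp B (e ?b) (e' ?b) = Ide B ?b"
      using e e' obs by auto
    have fe: "Cmp B f (e ?a) \<in> hom B (FO F (go ?a)) ?b" using B.cmp[OF ea fh] .
    \<comment> \<open>Composing two conjugates, the inner pair \<open>e ?b\<close>,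
      \<open>e' ?b\<close> cancels.\<close>
    have "Cmp B (Cmp B (e' ?c) (Cmp B g (e ?b))) (Cmp B (e' ?b) (Cmp B f (e ?a))) =
       Cmp B (e' ?c) (Cmp B g (Cmp B (Cmp B (e ?b) (e' ?b)) (Cmp B f (e ?a))))"
      using B.assoc[OF B.cmp[OF fe e'b] B.cmp[OF eb gh] e'c] B.assoc[OF B.cmp[OF fe e'b] eb gh]
        B.assoc[OF fe e'b eb] by simp
    also have "\<dots> = Cmp B (e' ?c) (Cmp B (Cmp B g f) (e ?a))"
      using eb' fe B.ide_left[OF fe] B.assoc[OF ea fh gh] by simp
    finally show "ga (Cmp B g f) = Cmp A (ga g) (ga f)"
      using gaf gag gagf A.cmp[OF gaf(1) gag(1)] FC[OF gaf(1) gag(1)]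
      by (intro inj[of _ "go ?a" "go ?c"]) auto
  qed
  have n2: "naturally_isomorphic B B (comp_ftor F ?G) id_ftor"
    unfolding naturally_isomorphic_def
  proof (intro exI[of _ e] conjI ballI)
    have "Cmp B (e (Cod B f)) (FA F (ga f)) = Cmp B f (e (Dom B f))" if f: "f \<in> Arr B" for f
    proof -
      have ob: "Dom B f \<in> Ob B" "Cod B f \<in> Ob B" using B.dom_cod f by auto
      have fh: "f \<in> hom B (Dom B f) (Cod B f)" using f by (auto simp: hom_def)
      have fe: "Cmp B f (e (Dom B f)) \<in> hom B (FO F (go (Dom B f))) (Cod B f)"
        using B.cmp[OF _ fh] e ob by auto
      show ?thesis using ga[OF f] e[OF ob(2)] e'[OF ob(2)] B.ide_left[OF fe]
          B.assoc[OF fe, of "e' (Cod B f)" _ "e (Cod B f)"] by auto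
    qed
    then show "is_nat_trans B B (comp_ftor F ?G) id_ftor e"
      using e by (auto simp: is_nat_trans_def comp_ftor_def id_ftor_def)
  qed (use e in auto)
  \<comment> \<open>The other natural isomorphism is the preimage under \<open>F\<close> of
    \<open>e (FO F a)\<close>; its naturality and invertibility are reflected by
    \<open>F\<close>.\<close>
  have "\<exists>f. f \<in> hom A (go (FO F a)) a \<and> FA F f = e (FO F a)" if "a \<in> Ob A" for a
    using ff[of "go (FO F a)" a] e FO[OF that] go that by blast
  then obtain h where h: "\<And>a. a \<in> Ob A \<Longrightarrow> h a \<in> hom A (go (FO F a)) a \<and> FA F (h a) = e (FO F a)"
    by metis
  have "naturally_isomorphic A A (comp_ftor ?G F) id_ftor"
    unfolding naturally_isomorphic_def
  proof (intro exI[of _ h] conjI ballI)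
    have "Cmp A (h (Cod A f)) (ga (FA F f)) = Cmp A f (h (Dom A f))" if f: "f \<in> Arr A" for f
    proof -
      let ?a = "Dom A f" and ?b = "Cod A f"
      have ob: "?a \<in> Ob A" "?b \<in> Ob A" using A.dom_cod f by auto
      have fh: "f \<in> hom A ?a ?b" using f by (auto simp: hom_def)
      have Ff: "FA F f \<in> Arr B" "Dom B (FA F f) = FO F ?a" "Cod B (FA F f) = FO F ?b"
        using FA[OF fh] by (auto simp: hom_def)
      have gf: "ga (FA F f) \<in> hom A (go (FO F ?a)) (go (FO F ?b))"
        "FA F (ga (FA F f)) = Cmp B (e' (FO F ?b)) (Cmp B (FA F f) (e (FO F ?a)))"
        using ga[OF Ff(1)] Ff by auto
      have fe: "Cmp B (FA F f) (e (FO F ?a)) \<in> hom B (FO F (go (FO F ?a))) (FO F ?b)"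
        using B.cmp[OF _ FA[OF fh]] e FO[OF ob(1)] by auto
      have "Cmp B (e (FO F ?b)) (FA F (ga (FA F f))) = Cmp B (FA F f) (e (FO F ?a))"
        using gf(2) e[OF FO[OF ob(2)]] e'[OF FO[OF ob(2)]] B.ide_left[OF fe]
          B.assoc[OF fe, of "e' (FO F ?b)" _ "e (FO F ?b)"] by auto
      then show ?thesis using h[OF ob(1)] h[OF ob(2)]
          A.cmp[OF gf(1), of "h ?b" ?b] A.cmp[OF _ fh, of "h ?a" "go (FO F ?a)"]
          FC[OF gf(1), of "h ?b" ?b] FC[OF _ fh, of "h ?a" "go (FO F ?a)"]
        by (intro inj[of _ "go (FO F ?a)" ?b]) auto
    qed
    then show "is_nat_trans A A (comp_ftor ?G F) id_ftor h"
      using h by (auto simp: is_nat_trans_def comp_ftor_def id_ftor_def)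
  next
    fix a assume a: "a \<in> Ob A"
    then have Fa: "FO F a \<in> Ob B" by (rule FO)
    obtain k where k: "k \<in> hom A a (go (FO F a))" "FA F k = e' (FO F a)"
      using ff[of a "go (FO F a)" "e' (FO F a)"] e'[OF Fa] go[OF Fa] a by blast
    have hh: "h a \<in> hom A (go (FO F a)) a" "FA F (h a) = e (FO F a)" using h[OF a] by auto
    show "is_iso A (h a)"
    proof (rule A.is_isoI[OF hh(1) k(1)])
      show "Cmp A k (h a) = Ide A (go (FO F a))"
        using A.cmp[OF hh(1) k(1)] A.ide go[OF Fa] FC[OF hh(1) k(1)] hh(2) k(2) e'[OF Fa] FI
        by (intro inj) auto
      show "Cmp A (h a) k = Ide A a"
        using A.cmp[OF k(1) hh(1)] A.ide a FC[OF k(1) hh(1)] hh(2) k(2) e'[OF Fa] FI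
        by (intro inj) auto
    qed
  qed
  with n2 G F assms(1,2) show ?thesis unfolding equivalent_categories_def by blast
qed

section \<open>Presheaves in terms of their elements\<close>

abbreviation PSh :: "('o, 'a) cat \<Rightarrow> _" where
  "PSh V \<equiv> functor_cat (op_cat V) Sets"

definition act :: "('o, 'a, 'u set, 'u sarr) ftor \<Rightarrow> 'a \<Rightarrow> 'u \<Rightarrow> 'u" where
  "act P f = val (FA P f)"

definition app :: "('f, 'o \<Rightarrow> 'u sarr) arrow \<Rightarrow> 'o \<Rightarrow> 'u \<Rightarrow> 'u" where
  "app \<alpha> a = val (val \<alpha> a)"

text \<open>The restrictions produce the extensional form that objects of a functor category are
  required to have, so that \<open>S\<close> and \<open>A\<close> may be given as unrestricted
  functions.\<close>

definition mk_psh :: "('o, 'a) cat \<Rightarrow> ('o \<Rightarrow> 'u set) \<Rightarrow> ('a \<Rightarrow> 'u \<Rightarrow> 'u) \<Rightarrow>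
    ('o, 'a, 'u set, 'u sarr) ftor" where
  "mk_psh V S A = \<lparr>FO = restrict S (Ob V),
    FA = (\<lambda>f\<in>Arr V. Arrow (S (Cod V f)) (restrict (A f) (S (Cod V f))) (S (Dom V f)))\<rparr>"

definition mk_nat :: "('o, 'a) cat \<Rightarrow> ('o, 'a, 'u set, 'u sarr) ftor \<Rightarrow> ('o \<Rightarrow> 'u \<Rightarrow> 'u) \<Rightarrow>
    ('o, 'a, 'u set, 'u sarr) ftor \<Rightarrow> (('o, 'a, 'u set, 'u sarr) ftor, 'o \<Rightarrow> 'u sarr) arrow" where
  "mk_nat V P h Q =
    Arrow P (\<lambda>a\<in>Ob V. Arrow (FO P a) (restrict (h a) (FO P a)) (FO Q a)) Q"

context category
begin

lemma category_PSh: "category (PSh C)"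
  by (intro category_functor_cat category_op category_Sets category_axioms)

lemma act_in:
  assumes "P \<in> Ob (PSh C)" "f \<in> hom C a b" "x \<in> FO P b"
  shows "act P f x \<in> FO P a"
proof -
  have "FA P f \<in> hom Sets (FO P b) (FO P a)"
    using assms by (auto simp: functor_cat_Ob is_functor_def hom_def)
  with assms(3) show ?thesis by (auto simp: Sets_hom act_def)
qed

lemma act_Ide: "P \<in> Ob (PSh C) \<Longrightarrow> a \<in> Ob C \<Longrightarrow> x \<in> FO P a \<Longrightarrow> act P (Ide C a) x = x"
  by (auto simp: functor_cat_Ob is_functor_def act_def Sets_simps)

lemma act_Cmp:
  assumes "P \<in> Ob (PSh C)" "f \<in> hom C a b" "g \<in> hom C b c" "x \<in> FO P c"
  shows "act P (Cmp C g f) x = act P f (act P g x)"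
proof -
  have "FA P g \<in> hom Sets (FO P c) (FO P b)"
    using assms by (auto simp: functor_cat_Ob is_functor_def hom_def)
  moreover have "FA P (Cmp C g f) = Cmp Sets (FA P f) (FA P g)"
    using assms by (auto simp: functor_cat_Ob is_functor_def hom_def)
  ultimately show ?thesis using assms(4) by (auto simp: Sets_hom act_def Sets_simps compose_def)
qed

lemma mk_psh_in:
  assumes "\<And>f a b x. f \<in> hom C a b \<Longrightarrow> x \<in> S b \<Longrightarrow> A f x \<in> S a"
    and "\<And>a x. a \<in> Ob C \<Longrightarrow> x \<in> S a \<Longrightarrow> A (Ide C a) x = x"
    and "\<And>f g a b c x. f \<in> hom C a b \<Longrightarrow> g \<in> hom C b c \<Longrightarrow> x \<in> S c \<Longrightarrow>
      A (Cmp C g f) x = A f (A g x)"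
  shows "mk_psh C S A \<in> Ob (PSh C)"
proof -
  have I: "Ide C a \<in> Arr C" "Dom C (Ide C a) = a" "Cod C (Ide C a) = a" if "a \<in> Ob C" for a
    using ide[OF that] by (auto simp: hom_def)
  have M: "Cmp C g f \<in> Arr C" "Dom C (Cmp C g f) = Dom C f" "Cod C (Cmp C g f) = Cod C g"
    if "f \<in> Arr C" "g \<in> Arr C" "Dom C g = Cod C f" for f g
    using cmp[of f "Dom C f" "Dom C g" g "Cod C g"] that by (auto simp: hom_def)
  have m: "A f x \<in> S (Dom C f)" if "f \<in> Arr C" "x \<in> S (Cod C f)" for f x
    using assms(1)[of f "Dom C f" "Cod C f"] that by (auto simp: hom_def)
  have c: "A (Cmp C g f) x = A f (A g x)"
    if "f \<in> Arr C" "g \<in> Arr C" "Dom C g = Cod C f" "x \<in> S (Cod C g)" for f g x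
    using assms(3)[of f "Dom C f" "Dom C g" g "Cod C g"] that by (auto simp: hom_def)
  have m': "A g x \<in> S (Cod C f)" if "g \<in> Arr C" "Dom C g = Cod C f" "x \<in> S (Cod C g)" for f g x
    using m[of g x] that by simp
  show ?thesis
    using dom_cod I M m m' c assms(2)
    by (auto simp: functor_cat_Ob is_functor_def mk_psh_def Sets_hom Sets_simps compose_def fun_eq_iff
        restrict_def extensional_def)
qed

lemma FO_mk_psh [simp]: "a \<in> Ob C \<Longrightarrow> FO (mk_psh C S A) a = S a"
  by (simp add: mk_psh_def)

lemma act_mk_psh: "f \<in> hom C a b \<Longrightarrow> x \<in> S b \<Longrightarrow> act (mk_psh C S A) f x = A f x"
  by (auto simp: mk_psh_def act_def hom_def)

lemma PSh_hom_Ob: "\<alpha> \<in> hom (PSh C) P Q \<Longrightarrow> P \<in> Ob (PSh C) \<and> Q \<in> Ob (PSh C)"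
  by (simp add: functor_cat_hom)

lemma app_in:
  assumes "\<alpha> \<in> hom (PSh C) P Q" "a \<in> Ob C" "x \<in> FO P a"
  shows "app \<alpha> a x \<in> FO Q a"
proof -
  have "val \<alpha> a \<in> hom Sets (FO P a) (FO Q a)"
    using assms by (auto simp: functor_cat_hom is_nat_trans_def)
  with assms(3) show ?thesis by (auto simp: Sets_hom app_def)
qed

lemma app_act:
  assumes "\<alpha> \<in> hom (PSh C) P Q" "f \<in> hom C a b" "x \<in> FO P b"
  shows "app \<alpha> a (act P f x) = act Q f (app \<alpha> b x)"
proof -
  have ob: "a \<in> Ob C" "b \<in> Ob C" using hom_Ob assms(2) by auto
  note f = homD[OF assms(2)]
  have h: "val \<alpha> b \<in> hom Sets (FO P b) (FO Q b)" "FA P f \<in> hom Sets (FO P b) (FO P a)"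
    and e: "Cmp Sets (val \<alpha> a) (FA P f) = Cmp Sets (FA Q f) (val \<alpha> b)"
    using assms(1) ob f by (auto simp: functor_cat_hom functor_cat_Ob is_functor_def is_nat_trans_def)
  have "val (Cmp Sets (val \<alpha> a) (FA P f)) x = val (Cmp Sets (FA Q f) (val \<alpha> b)) x" using e by simp
  then show ?thesis using h assms(3) by (auto simp: Sets_hom Sets_simps compose_def app_def act_def)
qed

lemma mk_nat_in:
  assumes "P \<in> Ob (PSh C)" "Q \<in> Ob (PSh C)"
    and "\<And>a x. a \<in> Ob C \<Longrightarrow> x \<in> FO P a \<Longrightarrow> h a x \<in> FO Q a"
    and "\<And>f a b x. f \<in> hom C a b \<Longrightarrow> x \<in> FO P b \<Longrightarrow> h a (act P f x) = act Q f (h b x)"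
  shows "mk_nat C P h Q \<in> hom (PSh C) P Q"
proof -
  have hP: "FA P f \<in> hom Sets (FO P (Cod C f)) (FO P (Dom C f))" if "f \<in> Arr C" for f
    using assms(1) that by (auto simp: functor_cat_Ob is_functor_def)
  have hQ: "FA Q f \<in> hom Sets (FO Q (Cod C f)) (FO Q (Dom C f))" if "f \<in> Arr C" for f
    using assms(2) that by (auto simp: functor_cat_Ob is_functor_def)
  have "Cmp Sets (val (mk_nat C P h Q) (Dom C f)) (FA P f) =
      Cmp Sets (FA Q f) (val (mk_nat C P h Q) (Cod C f))" if f: "f \<in> Arr C" for f
  proof -
    have n: "h (Dom C f) (val (FA P f) x) = val (FA Q f) (h (Cod C f) x)" if "x \<in> FO P (Cod C f)" for x
      using assms(4)[of f "Dom C f" "Cod C f" x] that f by (auto simp: act_def hom_def)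
    show ?thesis
      using hP[OF f] hQ[OF f] dom_cod[OF f] assms(3) n
      by (auto simp: mk_nat_def Sets_simps Sets_hom compose_def fun_eq_iff restrict_def PiE_iff)
  qed
  then show ?thesis using assms(1-3) dom_cod
    by (auto simp: functor_cat_hom is_nat_trans_def) (auto simp: mk_nat_def Sets_hom)
qed

lemma app_mk_nat [simp]: "a \<in> Ob C \<Longrightarrow> x \<in> FO P a \<Longrightarrow> app (mk_nat C P h Q) a x = h a x"
  by (simp add: mk_nat_def app_def)

lemma nat_eqI:
  assumes \<alpha>: "\<alpha> \<in> hom (PSh C) P Q" and \<beta>: "\<beta> \<in> hom (PSh C) P Q"
    and e: "\<And>a x. a \<in> Ob C \<Longrightarrow> x \<in> FO P a \<Longrightarrow> app \<alpha> a x = app \<beta> a x"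
  shows "\<alpha> = \<beta>"
proof -
  have h: "val \<gamma> a \<in> hom Sets (FO P a) (FO Q a)" if "a \<in> Ob C" "\<gamma> \<in> hom (PSh C) P Q" for a \<gamma>
    using that by (auto simp: functor_cat_hom is_nat_trans_def)
  have "val \<alpha> a = val \<beta> a" if a: "a \<in> Ob C" for a
  proof -
    have "val (val \<alpha> a) = val (val \<beta> a)"
      using h[OF a \<alpha>] h[OF a \<beta>] e[OF a] by (intro PiE_ext[of _ "FO P a" "\<lambda>_. FO Q a"])
        (auto simp: Sets_hom app_def)
    then show ?thesis using h[OF a \<alpha>] h[OF a \<beta>] by (auto simp: Sets_hom intro: arrow.expand)
  qed
  then have "val \<alpha> = val \<beta>"
    using \<alpha> \<beta> by (auto simp: functor_cat_hom intro!: extensionalityI)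
  then show ?thesis using \<alpha> \<beta> by (auto simp: functor_cat_hom intro: arrow.expand)
qed

lemma app_Ide [simp]: "a \<in> Ob C \<Longrightarrow> x \<in> FO P a \<Longrightarrow> app (Ide (PSh C) P) a x = x"
  by (simp add: app_def functor_cat_simps Sets_simps)

lemma app_Cmp [simp]:
  assumes "\<alpha> \<in> hom (PSh C) P Q" "a \<in> Ob C" "x \<in> FO P a"
  shows "app (Cmp (PSh C) \<beta> \<alpha>) a x = app \<beta> a (app \<alpha> a x)"
proof -
  have "val \<alpha> a \<in> hom Sets (FO P a) (FO Q a)"
    using assms by (auto simp: functor_cat_hom is_nat_trans_def)
  then show ?thesis using assms(2,3)
    by (auto simp: app_def functor_cat_simps Sets_simps Sets_hom compose_def)
qed

text \<open>Pointwise inverses are automatically natural: by naturality of \<open>\<alpha>\<close>,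
  \<open>act Q f x\<close> is the image of \<open>act P f\<close> applied to the preimage of
  \<open>x\<close>.\<close>

lemma PSh_is_isoI:
  assumes \<alpha>: "\<alpha> \<in> hom (PSh C) P Q" and bij: "\<And>a. a \<in> Ob C \<Longrightarrow> bij_betw (app \<alpha> a) (FO P a) (FO Q a)"
  shows "is_iso (PSh C) \<alpha>"
proof -
  interpret P: category "PSh C" by (rule category_PSh)
  let ?h = "\<lambda>a. inv_into (FO P a) (app \<alpha> a)"
  note ob = PSh_hom_Ob[OF \<alpha>]
  have h: "?h a x \<in> FO P a" "app \<alpha> a (?h a x) = x" if "a \<in> Ob C" "x \<in> FO Q a" for a x
    using bij[OF that(1)] that(2) by (auto simp: bij_betw_def inv_into_into f_inv_into_f)
  have h': "?h a (app \<alpha> a x) = x" if "a \<in> Ob C" "x \<in> FO P a" for a x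
    using bij[OF that(1)] that(2) by (auto simp: bij_betw_def)
  have \<beta>: "mk_nat C Q ?h P \<in> hom (PSh C) Q P"
  proof (rule mk_nat_in)
    fix f a b x assume f: "f \<in> hom C a b" and x: "x \<in> FO Q b"
    have ab: "a \<in> Ob C" "b \<in> Ob C" using hom_Ob[OF f] by auto
    have "act Q f x = app \<alpha> a (act P f (?h b x))"
      using app_act[OF \<alpha> f h(1)[OF ab(2) x]] h(2)[OF ab(2) x] by simp
    then show "?h a (act Q f x) = act P f (?h b x)"
      using h'[OF ab(1) act_in[OF conjunct1[OF ob] f h(1)[OF ab(2) x]]] by simp
  qed (use ob h in auto)
  show ?thesis
    by (rule P.is_isoI[OF \<alpha> \<beta>]; rule nat_eqI)
      (use \<alpha> \<beta> ob in \<open>auto intro!: P.ide P.cmp[OF \<alpha> \<beta>] P.cmp[OF \<beta> \<alpha>] simp: h h' app_in\<close>)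
qed

end

section \<open>Presheaves on categories of words\<close>

text \<open>In a thin category the choice of the arrow does not matter. Indexing restriction by a
  pair of objects removes arrows from all later formulas.\<close>

definition res :: "('o, 'a) cat \<Rightarrow> ('o, 'a, 'u set, 'u sarr) ftor \<Rightarrow> 'o \<Rightarrow> 'o \<Rightarrow> 'u \<Rightarrow> 'u" where
  "res V P a b = act P (SOME f. f \<in> hom V a b)"

text \<open>A preorder labelled by words. The labelling is onto \<open>L\<close> but need not be
  injective: objects with the same word have arrows both ways and are isomorphic by thinness,
  without being equal.\<close>

locale word_category = category C for C :: "('o, 'a) cat" +
  fixes wd :: "'o \<Rightarrow> 'l list" and L :: "'l list set"
  assumes thin: "f \<in> hom C a b \<Longrightarrow> g \<in> hom C a b \<Longrightarrow> f = g"
    and hom_iff_prefix: "a \<in> Ob C \<Longrightarrow> b \<in> Ob C \<Longrightarrow> hom C a b \<noteq> {} \<longleftrightarrow> prefix (wd a) (wd b)"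
    and wd_image: "wd ` Ob C = L"
begin

definition le :: "'o \<Rightarrow> 'o \<Rightarrow> bool" where
  "le a b \<longleftrightarrow> a \<in> Ob C \<and> b \<in> Ob C \<and> prefix (wd a) (wd b)"

lemma some_hom: "le a b \<Longrightarrow> (SOME f. f \<in> hom C a b) \<in> hom C a b"
  using hom_iff_prefix[of a b] by (auto simp: le_def some_in_eq)

lemma hom_le: "f \<in> hom C a b \<Longrightarrow> le a b"
  using hom_iff_prefix[of a b] hom_Ob[of f a b] by (auto simp: le_def)

lemma act_res: "f \<in> hom C a b \<Longrightarrow> act P f = res C P a b"
  using thin some_hom[OF hom_le] by (metis res_def)

lemma res_in: "P \<in> Ob (PSh C) \<Longrightarrow> le a b \<Longrightarrow> x \<in> FO P b \<Longrightarrow> res C P a b x \<in> FO P a"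
  unfolding res_def by (rule act_in[OF _ some_hom])

lemma res_refl: "P \<in> Ob (PSh C) \<Longrightarrow> a \<in> Ob C \<Longrightarrow> x \<in> FO P a \<Longrightarrow> res C P a a x = x"
  using act_res[OF ide, of a P] act_Ide[of P a x] by simp

lemma res_res: 
  "P \<in> Ob (PSh C) \<Longrightarrow> le a b \<Longrightarrow> le b c \<Longrightarrow> x \<in> FO P c \<Longrightarrow> res C P a b (res C P b c x) = res C P a c x"
  using act_res[OF cmp[OF some_hom some_hom], of a b c P] act_Cmp[OF _ some_hom some_hom, of P a b c x]
  by (simp add: act_res[OF some_hom])

lemma app_res: "\<alpha> \<in> hom (PSh C) P Q \<Longrightarrow> le a b \<Longrightarrow> x \<in> FO P b \<Longrightarrow>
    app \<alpha> a (res C P a b x) = res C Q a b (app \<alpha> b x)"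
  using app_act[OF _ some_hom] by (simp add: res_def)

text \<open>By thinness an action is determined by the ends of the arrows, so it can be given as a
  function \<open>R\<close> of two comparable objects.\<close>

lemma word_psh_in:
  assumes "\<And>a b x. le a b \<Longrightarrow> x \<in> S b \<Longrightarrow> R a b x \<in> S a"
    and "\<And>a x. a \<in> Ob C \<Longrightarrow> x \<in> S a \<Longrightarrow> R a a x = x"
    and "\<And>a b c x. le a b \<Longrightarrow> le b c \<Longrightarrow> x \<in> S c \<Longrightarrow> R a b (R b c x) = R a c x"
  shows "mk_psh C S (\<lambda>f. R (Dom C f) (Cod C f)) \<in> Ob (PSh C)"
proof (rule mk_psh_in)
  fix f g a b c x assume *: "f \<in> hom C a b" "g \<in> hom C b c" "x \<in> S c"
  then show "R (Dom C (Cmp C g f)) (Cod C (Cmp C g f)) x =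
      R (Dom C f) (Cod C f) (R (Dom C g) (Cod C g) x)"
    using assms(3)[of a b c x] hom_le homD[OF cmp[OF *(1,2)]] by (auto simp: hom_def)
next
  fix f a b x assume "f \<in> hom C a b" "x \<in> S b"
  then show "R (Dom C f) (Cod C f) x \<in> S a" using assms(1)[of a b x] hom_le by (auto simp: hom_def)
next
  fix a x assume "a \<in> Ob C" "x \<in> S a"
  then show "R (Dom C (Ide C a)) (Cod C (Ide C a)) x = x"
    using assms(2) homD[OF ide, of a] by auto
qed

lemma res_word_psh: "le a b \<Longrightarrow> x \<in> S b \<Longrightarrow>
    res C (mk_psh C S (\<lambda>f. R (Dom C f) (Cod C f))) a b x = R a b x"
  using act_mk_psh[OF some_hom, of a b x S "\<lambda>f. R (Dom C f) (Cod C f)"] homD[OF some_hom, of a b]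
  by (auto simp: res_def)

lemma word_nat_in:
  assumes "P \<in> Ob (PSh C)" "Q \<in> Ob (PSh C)"
    and "\<And>a x. a \<in> Ob C \<Longrightarrow> x \<in> FO P a \<Longrightarrow> h a x \<in> FO Q a"
    and "\<And>a b x. le a b \<Longrightarrow> x \<in> FO P b \<Longrightarrow> h a (res C P a b x) = res C Q a b (h b x)"
  shows "mk_nat C P h Q \<in> hom (PSh C) P Q"
  using assms by (intro mk_nat_in) (auto simp: act_res dest: hom_le)

lemma le_Ob: "le a b \<Longrightarrow> a \<in> Ob C \<and> b \<in> Ob C"
  by (simp add: le_def)

end

text \<open>\<open>I\<close> indexes the possible first letters, and \<open>W i\<close> is labelled
  by the words that may follow the letter of \<open>i\<close>. The categories \<open>W i\<close> are
  not subcategories of \<open>V\<close>; only the labels tie them to it.\<close>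

locale word_branching = word_category V wd L
  for V :: "('o, 'a) cat" and wd :: "'o \<Rightarrow> 'l list" and L :: "'l list set" +
  fixes I :: "'i set" and letter :: "'i \<Rightarrow> 'l" and W :: "'i \<Rightarrow> ('o2, 'a2) cat"
    and wdW :: "'i \<Rightarrow> 'o2 \<Rightarrow> 'l list"
  assumes Nil_in: "[] \<in> L"
    and letter_inj: "inj_on letter I"
    and letter_ex: "c # w \<in> L \<Longrightarrow> c \<in> letter ` I"
    and branch: "i \<in> I \<Longrightarrow> word_category (W i) (wdW i) {w. letter i # w \<in> L}"
begin

definition root :: 'o where
  "root = (SOME a. a \<in> Ob V \<and> wd a = [])"

text \<open>Puts the letter of \<open>i\<close> in front of the word of \<open>v\<close>. Any object
  with that label serves, since all of them are isomorphic. Together with \<open>rp\<close> this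
  inverts the labelling only up to isomorphism, which is why representatives are compared through
  their words below.\<close>

definition cn :: "'i \<Rightarrow> 'o2 \<Rightarrow> 'o" where
  "cn i v = (SOME a. a \<in> Ob V \<and> wd a = letter i # wdW i v)"

definition rp :: "'i \<Rightarrow> 'l list \<Rightarrow> 'o2" where
  "rp i w = (SOME v. v \<in> Ob (W i) \<and> wdW i v = w)"

lemma root: "root \<in> Ob V" "wd root = []"
proof -
  have "\<exists>a. a \<in> Ob V \<and> wd a = []" using Nil_in wd_image by (metis imageE)
  from someI_ex[OF this] show "root \<in> Ob V" "wd root = []" by (simp_all add: root_def)
qed

lemma cn:
  assumes "i \<in> I" "v \<in> Ob (W i)"
  shows "cn i v \<in> Ob V" "wd (cn i v) = letter i # wdW i v"
proof -
  have "letter i # wdW i v \<in> L"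
    using word_category.wd_image[OF branch[OF assms(1)]] assms(2) by auto
  then have "\<exists>a. a \<in> Ob V \<and> wd a = letter i # wdW i v" using wd_image by (metis imageE)
  from someI_ex[OF this] show "cn i v \<in> Ob V" "wd (cn i v) = letter i # wdW i v"
    by (simp_all add: cn_def)
qed

lemma rp:
  assumes "i \<in> I" "letter i # w \<in> L"
  shows "rp i w \<in> Ob (W i)" "wdW i (rp i w) = w"
proof -
  have "w \<in> wdW i ` Ob (W i)"
    using word_category.wd_image[OF branch[OF assms(1)]] assms(2) by auto
  then have "\<exists>v. v \<in> Ob (W i) \<and> wdW i v = w" by auto
  from someI_ex[OF this] show "rp i w \<in> Ob (W i)" "wdW i (rp i w) = w"
    by (simp_all add: rp_def)
qed

lemma rp_wdW:
  assumes "i \<in> I" "v \<in> Ob (W i)"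
  shows "rp i (wdW i v) \<in> Ob (W i)" "wdW i (rp i (wdW i v)) = wdW i v"
  using rp[OF assms(1), of "wdW i v"] assms word_category.wd_image[OF branch[OF assms(1)]] by auto

abbreviation leW :: "'i \<Rightarrow> 'o2 \<Rightarrow> 'o2 \<Rightarrow> bool" where
  "leW i \<equiv> word_category.le (W i) (wdW i)"

lemma le_cn: "i \<in> I \<Longrightarrow> leW i v v' \<Longrightarrow> le (cn i v) (cn i v')"
  by (simp add: word_category.le_def[OF branch] le_def cn)

lemma le_root: "a \<in> Ob V \<Longrightarrow> le root a"
  by (simp add: le_def root)

lemma leW_Ob: "i \<in> I \<Longrightarrow> leW i v v' \<Longrightarrow> v \<in> Ob (W i) \<and> v' \<in> Ob (W i)"
  by (simp add: word_category.le_def[OF branch])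

lemma W_category: "i \<in> I \<Longrightarrow> category (W i)"
  using branch by (simp add: word_category_def)

text \<open>Up to isomorphism every object is the root or some \<open>cn i v\<close>; the second
  case supplies the representative of the tail that plays the role of \<open>v\<close>.\<close>

lemma Ob_cases:
  assumes "a \<in> Ob V"
  obtains "wd a = []" | i where "i \<in> I" "wd a = letter i # tl (wd a)" "rp i (tl (wd a)) \<in> Ob (W i)"
    "wdW i (rp i (tl (wd a))) = tl (wd a)"
proof (cases "wd a")
  case (Cons c w)
  then have "c # w \<in> L" using assms wd_image by (metis imageI)
  then obtain i where "i \<in> I" "c = letter i" using letter_ex by blast
  then show ?thesis using Cons rp[of i w] that(2)[of i] \<open>c # w \<in> L\<close> by simp
qed (use that in auto)

definition ix :: "'l \<Rightarrow> 'i" where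
  "ix c = inv_into I letter c"

lemma ix [simp]: "i \<in> I \<Longrightarrow> ix (letter i) = i"
  by (simp add: ix_def letter_inj)

definition fib :: "('o, 'a, 'u set, 'u sarr) ftor \<Rightarrow> 'u \<Rightarrow> 'i \<Rightarrow> ('o2, 'a2, 'u set, 'u sarr) ftor" where
  "fib P y i = mk_psh (W i) (\<lambda>v. {x \<in> FO P (cn i v). res V P root (cn i v) x = y})
    (\<lambda>f. res V P (cn i (Dom (W i) f)) (cn i (Cod (W i) f)))"

definition fib_nat where
  "fib_nat \<alpha> y i = mk_nat (W i) (fib (src \<alpha>) y i) (\<lambda>v. app \<alpha> (cn i v)) (fib (tgt \<alpha>) (app \<alpha> root y) i)"

text \<open>Restriction inside a branch does not change the restriction to the root, so the fibre
  over \<open>y\<close> is closed under the action.\<close>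

lemma fib_in:
  assumes P: "P \<in> Ob (PSh V)" and i: "i \<in> I"
  shows "fib P y i \<in> Ob (PSh (W i))"
  unfolding fib_def
proof (rule word_category.word_psh_in[OF branch[OF i], where R = "\<lambda>a b. res V P (cn i a) (cn i b)"])
  fix v v' x assume "leW i v v'" "x \<in> {x \<in> FO P (cn i v'). res V P root (cn i v') x = y}"
  then show "res V P (cn i v) (cn i v') x \<in> {x \<in> FO P (cn i v). res V P root (cn i v) x = y}"
    using res_in[OF P le_cn[OF i]] res_res[OF P le_root le_cn[OF i]] cn(1)[OF i] leW_Ob[OF i] by auto
next
  fix v x assume "v \<in> Ob (W i)" "x \<in> {x \<in> FO P (cn i v). res V P root (cn i v) x = y}"
  then show "res V P (cn i v) (cn i v) x = x" using res_refl[OF P] cn(1)[OF i] by auto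
next
  fix a b c x assume "leW i a b" "leW i b c" "x \<in> {x \<in> FO P (cn i c). res V P root (cn i c) x = y}"
  then show "res V P (cn i a) (cn i b) (res V P (cn i b) (cn i c) x) = res V P (cn i a) (cn i c) x"
    using res_res[OF P le_cn[OF i] le_cn[OF i]] by auto
qed

lemma FO_fib: "i \<in> I \<Longrightarrow> v \<in> Ob (W i) \<Longrightarrow>
    FO (fib P y i) v = {x \<in> FO P (cn i v). res V P root (cn i v) x = y}"
  by (simp add: fib_def category.FO_mk_psh[OF W_category])

lemma res_fib:
  assumes i: "i \<in> I" and v: "leW i v v'" and x: "x \<in> FO (fib P y i) v'"
  shows "res (W i) (fib P y i) v v' x = res V P (cn i v) (cn i v') x"
proof -
  have v': "v' \<in> Ob (W i)" using leW_Ob[OF i v] by simp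
  show ?thesis
    unfolding fib_def
    by (rule word_category.res_word_psh[OF branch[OF i] v, where R = "\<lambda>a b. res V P (cn i a) (cn i b)"])
      (use x in \<open>simp add: FO_fib[OF i v']\<close>)
qed

lemma fib_nat_in:
  assumes \<alpha>: "\<alpha> \<in> hom (PSh V) P Q" and i: "i \<in> I" and y: "y \<in> FO P root"
  shows "fib_nat \<alpha> y i \<in> hom (PSh (W i)) (fib P y i) (fib Q (app \<alpha> root y) i)"
proof -
  have PQ: "P \<in> Ob (PSh V)" "Q \<in> Ob (PSh V)" "src \<alpha> = P" "tgt \<alpha> = Q"
    using \<alpha> by (auto simp: functor_cat_hom)
  have h: "app \<alpha> (cn i v) x \<in> FO (fib Q (app \<alpha> root y) i) v"
      if "v \<in> Ob (W i)" "x \<in> FO (fib P y i) v" for v x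
    using that i cn[OF i] app_in[OF \<alpha>] app_res[OF \<alpha> le_root] by (auto simp: FO_fib)
  show ?thesis
    unfolding fib_nat_def PQ
  proof (rule word_category.word_nat_in[OF branch[OF i] fib_in[OF PQ(1) i] fib_in[OF PQ(2) i] h])
    fix v v' x assume v: "leW i v v'" and x: "x \<in> FO (fib P y i) v'"
    have v': "v' \<in> Ob (W i)" using leW_Ob[OF i v] by simp
    have "x \<in> FO P (cn i v')" using x by (simp add: FO_fib[OF i v'])
    then show "app \<alpha> (cn i v) (res (W i) (fib P y i) v v' x) =
        res (W i) (fib Q (app \<alpha> root y) i) v v' (app \<alpha> (cn i v') x)"
      using app_res[OF \<alpha> le_cn[OF i v]] by (simp add: res_fib[OF i v x] res_fib[OF i v h[OF v' x]])
  qed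
qed

lemma app_fib_nat: "\<alpha> \<in> hom (PSh V) P Q \<Longrightarrow> i \<in> I \<Longrightarrow> v \<in> Ob (W i) \<Longrightarrow> x \<in> FO (fib P y i) v \<Longrightarrow>
    app (fib_nat \<alpha> y i) v x = app \<alpha> (cn i v) x"
  by (auto simp: fib_nat_def functor_cat_hom category.app_mk_nat[OF W_category])

section \<open>The fibre functor is fully faithful and essentially surjective\<close>

definition fibre_functor where
  "fibre_functor = \<lparr>FO = (\<lambda>P. (FO P root, \<lambda>y\<in>FO P root. \<lambda>i\<in>I. fib P y i)),
    FA = (\<lambda>\<alpha>. Arrow (FO (src \<alpha>) root, \<lambda>y\<in>FO (src \<alpha>) root. \<lambda>i\<in>I. fib (src \<alpha>) y i)
      (\<lambda>y\<in>FO (src \<alpha>) root. app \<alpha> root y, \<lambda>y\<in>FO (src \<alpha>) root. \<lambda>i\<in>I. fib_nat \<alpha> y i)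
      (FO (tgt \<alpha>) root, \<lambda>y\<in>FO (tgt \<alpha>) root. \<lambda>i\<in>I. fib (tgt \<alpha>) y i))\<rparr>"

abbreviation ProdW where
  "ProdW \<equiv> product_cat I (\<lambda>i. PSh (W i))"

lemma category_ProdW: "category ProdW"
  by (intro category_product_cat category.category_PSh W_category)

lemma fibre_functor: "is_functor (PSh V) (Fam ProdW) fibre_functor"
proof -
  interpret P: category "PSh V" by (rule category_PSh)
  have 1: "FO fibre_functor P \<in> Ob (Fam ProdW)" if "P \<in> Ob (PSh V)" for P
    using fib_in[OF that] by (auto simp: fibre_functor_def Fam_simps product_cat_def)
  have 2: "FA fibre_functor \<alpha> \<in> hom (Fam ProdW) (FO fibre_functor P) (FO fibre_functor Q)"
    if \<alpha>: "\<alpha> \<in> hom (PSh V) P Q" for \<alpha> P Q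
    using 1 PSh_hom_Ob[OF \<alpha>] fib_nat_in[OF \<alpha>] app_in[OF \<alpha> root(1)] \<alpha>
    by (auto simp: fibre_functor_def Fam_simps Fam_hom product_cat_hom functor_cat_hom)
  have 3: "FA fibre_functor (Ide (PSh V) P) = Ide (Fam ProdW) (FO fibre_functor P)"
    if P: "P \<in> Ob (PSh V)" for P
  proof -
    have I: "Ide (PSh V) P \<in> hom (PSh V) P P" using P.ide[OF P] .
    have "fib_nat (Ide (PSh V) P) y i = Ide (PSh (W i)) (fib P y i)"
      if i: "i \<in> I" and y: "y \<in> FO P root" for y i
    proof (rule category.nat_eqI[OF W_category[OF i]])
      show "fib_nat (Ide (PSh V) P) y i \<in> hom (PSh (W i)) (fib P y i) (fib P y i)"
        using fib_nat_in[OF I i y] app_Ide[OF root(1) y] by simp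
      show "Ide (PSh (W i)) (fib P y i) \<in> hom (PSh (W i)) (fib P y i) (fib P y i)"
        using category.ide[OF category.category_PSh[OF W_category[OF i]] fib_in[OF P i]] .
      fix v x assume v: "v \<in> Ob (W i)" and x: "x \<in> FO (fib P y i) v"
      then show "app (fib_nat (Ide (PSh V) P) y i) v x = app (Ide (PSh (W i)) (fib P y i)) v x"
        using cn(1)[OF i v]
        by (simp add: app_fib_nat[OF I i v x] category.app_Ide[OF W_category[OF i] v x] FO_fib[OF i v])
    qed
    then show ?thesis using P root(1) I
      by (auto simp: fibre_functor_def Fam_simps product_cat_def functor_cat_hom fun_eq_iff)
  qed
  have 4: "FA fibre_functor (Cmp (PSh V) \<beta> \<alpha>) =
      Cmp (Fam ProdW) (FA fibre_functor \<beta>) (FA fibre_functor \<alpha>)"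
    if \<alpha>: "\<alpha> \<in> hom (PSh V) P Q" and \<beta>: "\<beta> \<in> hom (PSh V) Q R" for \<alpha> \<beta> P Q R
  proof -
    have c: "Cmp (PSh V) \<beta> \<alpha> \<in> hom (PSh V) P R" using P.cmp[OF \<alpha> \<beta>] .
    have "fib_nat (Cmp (PSh V) \<beta> \<alpha>) y i = Cmp (PSh (W i)) (fib_nat \<beta> (app \<alpha> root y) i) (fib_nat \<alpha> y i)"
      if i: "i \<in> I" and y: "y \<in> FO P root" for y i
    proof (rule category.nat_eqI[OF W_category[OF i]])
      note y' = app_in[OF \<alpha> root(1) y]
      show "fib_nat (Cmp (PSh V) \<beta> \<alpha>) y i \<in>
          hom (PSh (W i)) (fib P y i) (fib R (app \<beta> root (app \<alpha> root y)) i)"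
        using fib_nat_in[OF c i y] app_Cmp[OF \<alpha> root(1) y] by simp
      show "Cmp (PSh (W i)) (fib_nat \<beta> (app \<alpha> root y) i) (fib_nat \<alpha> y i) \<in>
          hom (PSh (W i)) (fib P y i) (fib R (app \<beta> root (app \<alpha> root y)) i)"
        using category.cmp[OF category.category_PSh[OF W_category[OF i]] fib_nat_in[OF \<alpha> i y]
            fib_nat_in[OF \<beta> i y']] .
      fix v x assume v: "v \<in> Ob (W i)" and x: "x \<in> FO (fib P y i) v"
      have "app \<alpha> (cn i v) x \<in> FO (fib Q (app \<alpha> root y) i) v"
        using category.app_in[OF W_category[OF i] fib_nat_in[OF \<alpha> i y] v x] app_fib_nat[OF \<alpha> i v x]
            by simp
      then show "app (fib_nat (Cmp (PSh V) \<beta> \<alpha>) y i) v x =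
          app (Cmp (PSh (W i)) (fib_nat \<beta> (app \<alpha> root y) i) (fib_nat \<alpha> y i)) v x"
        using app_fib_nat[OF c i v x] app_fib_nat[OF \<alpha> i v x]
            app_fib_nat[OF \<beta> i v, of "app \<alpha> (cn i v) x"]
          category.app_Cmp[OF W_category[OF i] fib_nat_in[OF \<alpha> i y] v x, of "fib_nat \<beta> (app \<alpha> root y) i"]
          app_Cmp[OF \<alpha> cn(1)[OF i v], of x \<beta>] x by (simp add: FO_fib[OF i v])
    qed
    moreover have "src \<alpha> = P" "tgt \<alpha> = Q" "src \<beta> = Q" "tgt \<beta> = R"
      "src (Cmp (PSh V) \<beta> \<alpha>) = P" "tgt (Cmp (PSh V) \<beta> \<alpha>) = R"
      using \<alpha> \<beta> c by (auto simp: functor_cat_hom)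
    ultimately show ?thesis using app_in[OF \<alpha> root(1)] app_Cmp[OF \<alpha> root(1)]
      by (auto simp: fibre_functor_def Fam_simps product_cat_def fun_eq_iff compose_def)
  qed
  show ?thesis
    unfolding is_functor_def
  proof (intro conjI ballI impI 1 3)
    fix f assume "f \<in> Arr (PSh V)"
    then show "FA fibre_functor f \<in> hom (Fam ProdW) (FO fibre_functor (Dom (PSh V) f))
        (FO fibre_functor (Cod (PSh V) f))" by (intro 2) (auto simp: hom_def)
  next
    fix f g assume "f \<in> Arr (PSh V)" "g \<in> Arr (PSh V)" "Cod (PSh V) f = Dom (PSh V) g"
    then show "FA fibre_functor (Cmp (PSh V) g f) =
        Cmp (Fam ProdW) (FA fibre_functor g) (FA fibre_functor f)"
      by (intro 4[of f "Dom (PSh V) f" "Cod (PSh V) f" g "Cod (PSh V) g"]) (auto simp: hom_def)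
  qed
qed

text \<open>The image of \<open>\<alpha>\<close> records its values at the root and, fibre by fibre,
  at every \<open>cn i v\<close>. Every other object is isomorphic to one of these.\<close>

lemma fibre_functor_eqD:
  assumes \<alpha>: "\<alpha> \<in> hom (PSh V) P Q" and \<beta>: "\<beta> \<in> hom (PSh V) P Q"
    and eq: "FA fibre_functor \<alpha> = FA fibre_functor \<beta>"
  shows "\<alpha> = \<beta>"
proof (rule nat_eqI[OF \<alpha> \<beta>])
  fix a x assume a: "a \<in> Ob V" and x: "x \<in> FO P a"
  have P: "P \<in> Ob (PSh V)" using PSh_hom_Ob[OF \<alpha>] by simp
  have s: "src \<alpha> = P" "src \<beta> = P" using \<alpha> \<beta> by (auto simp: functor_cat_hom)
  have r: "app \<alpha> root y = app \<beta> root y" if "y \<in> FO P root" for y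
    using eq s that by (auto simp: fibre_functor_def fun_eq_iff restrict_def split: if_splits)
  have fn: "fib_nat \<alpha> y i = fib_nat \<beta> y i" if y: "y \<in> FO P root" and i: "i \<in> I" for y i
  proof -
    have "(\<lambda>y\<in>FO P root. \<lambda>i\<in>I. fib_nat \<alpha> y i) = (\<lambda>y\<in>FO P root. \<lambda>i\<in>I. fib_nat \<beta> y i)"
      using eq s by (auto simp: fibre_functor_def)
    from fun_cong[OF fun_cong[OF this, of y], of i] show ?thesis using y i by simp
  qed
  have c: "app \<alpha> (cn i v) z = app \<beta> (cn i v) z" if i: "i \<in> I" and v: "v \<in> Ob (W i)"
      and z: "z \<in> FO P (cn i v)" for i v z
  proof -
    let ?y = "res V P root (cn i v) z"
    have y: "?y \<in> FO P root" using res_in[OF P le_root[OF cn(1)[OF i v]] z] .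
    have z': "z \<in> FO (fib P ?y i) v" using z by (simp add: FO_fib[OF i v])
    show ?thesis using app_fib_nat[OF \<alpha> i v z'] app_fib_nat[OF \<beta> i v z'] fn[OF y i] by simp
  qed
  \<comment> \<open>Objects \<open>a\<close> and \<open>b\<close> with the same word restrict to
    each other, so \<open>x\<close> is a restriction of an element over \<open>b\<close>, and
    naturality transports the equality.\<close>
  have key: "app \<alpha> a x = app \<beta> a x"
    if b: "b \<in> Ob V" "wd b = wd a" and e: "\<And>z. z \<in> FO P b \<Longrightarrow> app \<alpha> b z = app \<beta> b z" for b
  proof -
    have ab: "le a b" "le b a" using a b by (auto simp: le_def)
    have z: "res V P b a x \<in> FO P b" using res_in[OF P ab(2) x] .
    have "x = res V P a b (res V P b a x)" using res_res[OF P ab x] res_refl[OF P a x] by simp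
    then show ?thesis using app_res[OF \<alpha> ab(1) z] app_res[OF \<beta> ab(1) z] e[OF z] by simp
  qed
  show "app \<alpha> a x = app \<beta> a x"
    using a
  proof (cases rule: Ob_cases)
    case 1 then show ?thesis using key[OF root(1)] root(2) r by simp
  next
    case (2 i) then show ?thesis using key[OF cn(1)] cn(2) c by metis
  qed
qed

text \<open>The preimage of \<open>g = (u, v)\<close> is forced at the root, where it is
  \<open>u\<close>, and on each \<open>cn i w\<close>, where it is \<open>v\<close> on the fibres.
  Elsewhere it is the detour through the chosen object with the same word; naturality is then
  checked according to which of the two words are empty.\<close>

lemma fibre_functor_full:
  assumes P: "P \<in> Ob (PSh V)" and Q: "Q \<in> Ob (PSh V)"
    and g: "g \<in> hom (Fam ProdW) (FO fibre_functor P) (FO fibre_functor Q)"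
  shows "\<exists>\<alpha>. \<alpha> \<in> hom (PSh V) P Q \<and> FA fibre_functor \<alpha> = g"
proof -
  obtain u v where g_eq: "g = Arrow (FO fibre_functor P) (u, v) (FO fibre_functor Q)"
    and u: "u \<in> FO P root \<rightarrow>\<^sub>E FO Q root" and v_ext: "v \<in> extensional (FO P root)"
    and v0: "\<And>y. y \<in> FO P root \<Longrightarrow> v y \<in> hom ProdW (\<lambda>i\<in>I. fib P y i) (\<lambda>i\<in>I. fib Q (u y) i)"
    using g unfolding fibre_functor_def by (auto simp: Fam_hom PiE_iff)
  have v_ext': "v y \<in> extensional I" if "y \<in> FO P root" for y
    using v0[OF that] by (simp add: product_cat_hom)
  have v: "v y i \<in> hom (PSh (W i)) (fib P y i) (fib Q (u y) i)" if "y \<in> FO P root" "i \<in> I" for y i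
    using v0[OF that(1)] that(2) by (auto simp: product_cat_hom)
  have v_in: "app (v y i) w x \<in> FO Q (cn i w) \<and> res V Q root (cn i w) (app (v y i) w x) = u y"
    if "y \<in> FO P root" "i \<in> I" "w \<in> Ob (W i)" "x \<in> FO P (cn i w)" "res V P root (cn i w) x = y"
        for y i w x
    using category.app_in[OF W_category[OF that(2)] v[OF that(1,2)] that(3)] that
    by (auto simp: FO_fib)
  have v_res: "app (v y i) w (res V P (cn i w) (cn i w') x) =
      res V Q (cn i w) (cn i w') (app (v y i) w' x)"
    if y: "y \<in> FO P root" and i: "i \<in> I" and w: "leW i w w'"
      and x: "x \<in> FO P (cn i w')" "res V P root (cn i w') x = y" for y i w w' x
  proof -
    have w': "w' \<in> Ob (W i)" using leW_Ob[OF i w] by simp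
    have x': "x \<in> FO (fib P y i) w'" using x by (simp add: FO_fib[OF i w'])
    show ?thesis
      using word_category.app_res[OF branch[OF i] v[OF y i] w x'] res_fib[OF i w x']
        res_fib[OF i w category.app_in[OF W_category[OF i] v[OF y i] w' x']] by simp
  qed
  \<comment> \<open>For a nonempty word, \<open>j a\<close> is the branch containing
    \<open>a\<close> and \<open>b a\<close> the chosen object of that branch labelled by the tail,
    so \<open>a\<close> is isomorphic to \<open>cn (j a) (b a)\<close>.\<close>
  define j where "j a = ix (hd (wd a))" for a
  define b where "b a = rp (j a) (tl (wd a))" for a
  define h where "h a x = (if wd a = [] then res V Q a root (u (res V P root a x))
    else res V Q a (cn (j a) (b a)) (app (v (res V P root a x) (j a)) (b a)
        (res V P (cn (j a) (b a)) a x)))" for a x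
  have nonNil: "j a \<in> I \<and> b a \<in> Ob (W (j a)) \<and> letter (j a) = hd (wd a) \<and> wdW (j a) (b a) = tl (wd a) \<and>
      le a (cn (j a) (b a)) \<and> le (cn (j a) (b a)) a" if "a \<in> Ob V" "wd a \<noteq> []" for a
    using that(1)
  proof (cases rule: Ob_cases)
    case (2 i)
    then have hd: "hd (wd a) = letter i" by (metis list.sel(1))
    then have "j a = i" using 2 by (simp add: j_def)
    then show ?thesis using 2 hd that cn[of i "b a"] by (auto simp: b_def le_def)
  qed (use that in auto)
  have yin: "res V P root a x \<in> FO P root" if "a \<in> Ob V" "x \<in> FO P a" for a x
    using res_in[OF P le_root[OF that(1)] that(2)] .
  have u_in: "u y \<in> FO Q root" if "y \<in> FO P root" for y using u that by auto
  have inner: "app (v (res V P root a x) (j a)) (b a) (res V P (cn (j a) (b a)) a x) \<in>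
      FO Q (cn (j a) (b a)) \<and>
      res V Q root (cn (j a) (b a)) (app (v (res V P root a x) (j a)) (b a)
          (res V P (cn (j a) (b a)) a x))
        = u (res V P root a x) \<and>
      res V P (cn (j a) (b a)) a x \<in> FO P (cn (j a) (b a)) \<and>
      res V P root (cn (j a) (b a)) (res V P (cn (j a) (b a)) a x) = res V P root a x"
    if a: "a \<in> Ob V" "wd a \<noteq> []" and x: "x \<in> FO P a" for a x
  proof -
    note n = nonNil[OF a]
    have 1: "res V P (cn (j a) (b a)) a x \<in> FO P (cn (j a) (b a))" using res_in[OF P _ x] n by simp
    have 2: "res V P root (cn (j a) (b a)) (res V P (cn (j a) (b a)) a x) = res V P root a x"
      using res_res[OF P le_root _ x, of "cn (j a) (b a)"] n le_Ob by blast
    show ?thesis using v_in[OF yin[OF a(1) x] _ _ 1 2] n 1 2 by blast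
  qed
  have h_in: "h a x \<in> FO Q a" if a: "a \<in> Ob V" and x: "x \<in> FO P a" for a x
  proof (cases "wd a = []")
    case True
    then have "le a root" using a root by (simp add: le_def)
    then show ?thesis using res_in[OF Q _ u_in[OF yin[OF a x]]] True by (simp add: h_def)
  next
    case False
    then show ?thesis using res_in[OF Q] nonNil[OF a False] inner[OF a False x] by (simp add: h_def)
  qed
  have h_res: "h a (res V P a c x) = res V Q a c (h c x)" if ac: "le a c" and x: "x \<in> FO P c" for a c x
  proof -
    have a: "a \<in> Ob V" and c: "c \<in> Ob V" and pre: "prefix (wd a) (wd c)" using ac by (auto simp: le_def)
    have y: "res V P root a (res V P a c x) = res V P root c x"
      using res_res[OF P le_root[OF a] ac x] .
    let ?y = "res V P root c x"
    consider "wd c = []" "wd a = []" | "wd a = []" "wd c \<noteq> []" | "wd a \<noteq> []" "wd c \<noteq> []"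
      using pre by (cases "wd a = []"; cases "wd c = []") auto
    then show ?thesis
    proof cases
      case 1
      then have "le c root" using c root by (simp add: le_def)
      then show ?thesis using 1 y res_res[OF Q ac _ u_in[OF yin[OF c x]]] by (simp add: h_def)
    next
      \<comment> \<open>The lower object is root-like and the upper one lies in a branch. What makes
        the square commute is that \<open>v\<close> maps the fibre over \<open>?y\<close> into the
        fibre over \<open>u ?y\<close>.\<close>
      case 2
      note n = nonNil[OF c 2(2)] and m = inner[OF c 2(2) x]
      let ?w = "app (v ?y (j c)) (b c) (res V P (cn (j c) (b c)) c x)"
      have ar: "le a root" using a root 2 by (simp add: le_def)
      have "res V Q a c (res V Q c (cn (j c) (b c)) ?w) = res V Q a (cn (j c) (b c)) ?w"
        using res_res[OF Q ac, of "cn (j c) (b c)" ?w] n m by simp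
      also have "\<dots> = res V Q a root (res V Q root (cn (j c) (b c)) ?w)"
        using res_res[OF Q ar le_root, of "cn (j c) (b c)" ?w] n m le_Ob by auto
      finally show ?thesis using 2 y m by (simp add: h_def)
    next
      \<comment> \<open>A nonempty prefix shares the first letter, so both objects lie in the same
        branch, where the square is naturality of the component of \<open>v\<close> at
        \<open>?y\<close>.\<close>
      case 3
      note na = nonNil[OF a 3(1)] and nc = nonNil[OF c 3(2)] and m = inner[OF c 3(2) x]
      have "hd (wd a) = hd (wd c)" using 3 pre by (cases "wd a"; cases "wd c") auto
      then have jj: "j a = j c" by (simp add: j_def)
      let ?i = "j c" and ?a' = "cn (j c) (b a)" and ?c' = "cn (j c) (b c)"
      have "prefix (tl (wd a)) (tl (wd c))" using 3 pre by (cases "wd a"; cases "wd c") auto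
      then have lw: "leW ?i (b a) (b c)" using na nc jj by (simp add: word_category.le_def[OF branch])
      have la: "le a ?a'" "le ?a' a" and lc: "le c ?c'" "le ?c' c" using na nc jj by auto
      have lac: "le ?a' ?c'" using le_cn[OF _ lw] nc by simp
      let ?z = "res V P ?c' c x"
      have "res V P ?a' a (res V P a c x) = res V P ?a' ?c' ?z"
        using res_res[OF P la(2) ac x] res_res[OF P lac lc(2) x] by simp
      then have "h a (res V P a c x) = res V Q a ?a' (app (v ?y ?i) (b a) (res V P ?a' ?c' ?z))"
        using 3 y jj by (simp add: h_def)
      also have "\<dots> = res V Q a ?a' (res V Q ?a' ?c' (app (v ?y ?i) (b c) ?z))"
        using v_res[OF yin[OF c x] _ lw, of ?z] m nc by simp
      also have "\<dots> = res V Q a c (res V Q c ?c' (app (v ?y ?i) (b c) ?z))"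
        using res_res[OF Q la(1) lac, of "app (v ?y ?i) (b c) ?z"]
          res_res[OF Q ac lc(1), of "app (v ?y ?i) (b c) ?z"] m by simp
      finally show ?thesis using 3 by (simp add: h_def)
    qed
  qed
  define \<alpha> where "\<alpha> = mk_nat V P h Q"
  have \<alpha>: "\<alpha> \<in> hom (PSh V) P Q" unfolding \<alpha>_def by (rule word_nat_in[OF P Q h_in h_res])
  have s: "src \<alpha> = P" "tgt \<alpha> = Q" using \<alpha> by (auto simp: functor_cat_hom)
  have app_root: "app \<alpha> root y = u y" if y: "y \<in> FO P root" for y
    using y root res_refl[OF P root(1) y] res_refl[OF Q root(1) u_in[OF y]] by (simp add: \<alpha>_def h_def)
  have fn: "fib_nat \<alpha> y i = v y i" if y: "y \<in> FO P root" and i: "i \<in> I" for y i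
  proof (rule category.nat_eqI[OF W_category[OF i] _ v[OF y i]])
    show "fib_nat \<alpha> y i \<in> hom (PSh (W i)) (fib P y i) (fib Q (u y) i)"
      using fib_nat_in[OF \<alpha> i y] app_root[OF y] by simp
    fix w x assume w: "w \<in> Ob (W i)" and x: "x \<in> FO (fib P y i) w"
    have x': "x \<in> FO P (cn i w)" "res V P root (cn i w) x = y" using x by (auto simp: FO_fib[OF i w])
    \<comment> \<open>The definition of \<open>h\<close> at \<open>cn i w\<close> passes through
      \<open>?b\<close>, which has the word of \<open>w\<close> but may differ from
      \<open>w\<close>; naturality of \<open>v y i\<close> along the isomorphism between them closes
      the gap.\<close>
    let ?a = "cn i w" and ?b = "rp i (wdW i w)"
    have jj: "j ?a = i" "b ?a = ?b" using i w by (auto simp: j_def b_def cn)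
    have b: "?b \<in> Ob (W i)" "wdW i ?b = wdW i w" using rp_wdW[OF i w] .
    have lw: "leW i w ?b" "leW i ?b w" using w b by (auto simp: word_category.le_def[OF branch[OF i]])
    let ?z = "res V P (cn i ?b) ?a x"
    have z: "?z \<in> FO P (cn i ?b)" using res_in[OF P le_cn[OF i lw(2)] x'(1)] .
    have zy: "res V P root (cn i ?b) ?z = y"
      using res_res[OF P le_root le_cn[OF i lw(2)] x'(1)] x'(2) cn[OF i b(1)] by simp
    have zx: "res V P (cn i w) (cn i ?b) ?z = x"
      using res_res[OF P le_cn[OF i lw(1)] le_cn[OF i lw(2)] x'(1)]
          res_refl[OF P cn(1)[OF i w] x'(1)] by simp
    have "app (fib_nat \<alpha> y i) w x = h ?a x"
      using app_fib_nat[OF \<alpha> i w x] cn(1)[OF i w] x' by (simp add: \<alpha>_def)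
    also have "\<dots> = res V Q ?a (cn i ?b) (app (v y i) ?b ?z)"
      using cn(2)[OF i w] x' by (simp add: h_def jj)
    also have "\<dots> = app (v y i) w x" using v_res[OF y i lw(1) z zy] zx by simp
    finally show "app (fib_nat \<alpha> y i) w x = app (v y i) w x" .
  qed
  have "(\<lambda>y\<in>FO P root. app \<alpha> root y) = u"
    using u app_root by (auto simp: fun_eq_iff restrict_def PiE_iff extensional_def)
  moreover have "(\<lambda>y\<in>FO P root. \<lambda>i\<in>I. fib_nat \<alpha> y i) = v"
  proof (rule extensionalityI[OF _ v_ext])
    fix y assume y: "y \<in> FO P root"
    have "(\<lambda>i\<in>I. fib_nat \<alpha> y i) = v y"
      by (rule extensionalityI[OF _ v_ext'[OF y]]) (use fn[OF y] in auto)
    then show "(\<lambda>y\<in>FO P root. \<lambda>i\<in>I. fib_nat \<alpha> y i) y = v y" using y by simp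
  qed simp
  ultimately have "FA fibre_functor \<alpha> = g"
    unfolding g_eq by (simp add: fibre_functor_def s)
  with \<alpha> show ?thesis by blast
qed

text \<open>The family is glued to a presheaf with \<open>Y\<close> at the empty word and, on branch
  \<open>i\<close>, the disjoint union over \<open>y\<close> in \<open>Y\<close> of the presheaves
  \<open>p y i\<close>. Its fibres are these presheaves with a tag attached, hence isomorphic to the
  given ones.\<close>

lemma fibre_functor_ess_surj:
  fixes B :: "('u::infinite, 'i \<Rightarrow> ('o2, 'a2, 'u set, 'u sarr) ftor) fam"
  assumes B: "B \<in> Ob (Fam ProdW)"
  shows "\<exists>P\<in>Ob (PSh V). \<exists>f\<in>hom (Fam ProdW) (FO fibre_functor P) B. is_iso (Fam ProdW) f"
proof -
  obtain Y p where B_eq: "B = (Y, p)" and p: "p \<in> Y \<rightarrow>\<^sub>E Ob ProdW"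
    using B by (auto simp: Fam_simps)
  have p_in: "p y i \<in> Ob (PSh (W i))" if "y \<in> Y" "i \<in> I" for y i
    using p that by (auto simp: product_cat_def PiE_iff)
  \<comment> \<open>An infinite type is equipotent with its square, so tagged elements can be coded
    in \<open>'u\<close> itself.\<close>
  obtain pr :: "'u \<times> 'u \<Rightarrow> 'u" where pr: "inj pr"
  proof -
    have "\<exists>f. bij_betw f (UNIV \<times> UNIV :: ('u \<times> 'u) set) (UNIV :: 'u set)"
      unfolding card_of_ordIso by (rule card_of_Times_same_infinite) (rule infinite_UNIV)
    then show ?thesis using that by (auto simp: bij_betw_def)
  qed
  define q where "q = inv pr"
  have q [simp]: "q (pr z) = z" for z using pr by (simp add: q_def)
  define j where "j a = ix (hd (wd a))" for a
  define b where "b a = rp (j a) (tl (wd a))" for a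
  define S where "S a = (if wd a = [] then Y else
      {pr (y, x) | y x. y \<in> Y \<and> x \<in> FO (p y (j a)) (b a)})" for a
  \<comment> \<open>Between root-like objects nothing changes, from a branch to the root only the
    tag survives, and inside a branch the tag is kept while the second component is
    restricted.\<close>
  define R where "R a c x = (if wd c = [] then x else if wd a = [] then fst (q x)
    else pr (fst (q x), res (W (j c)) (p (fst (q x)) (j c)) (b a) (b c) (snd (q x))))" for a c x
  have nonNil: "j a \<in> I \<and> b a \<in> Ob (W (j a)) \<and> letter (j a) = hd (wd a) \<and> wdW (j a) (b a) = tl (wd a)"
    if "a \<in> Ob V" "wd a \<noteq> []" for a
    using that(1)
  proof (cases rule: Ob_cases)
    case (2 i)
    then have hd: "hd (wd a) = letter i" by (metis list.sel(1))
    then have "j a = i" using 2 by (simp add: j_def)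
    then show ?thesis using 2 hd by (simp add: b_def)
  qed (use that in auto)
  have two: "j a = j c \<and> leW (j c) (b a) (b c) \<and> wd c \<noteq> []" if ac: "le a c" and ne: "wd a \<noteq> []" for a c
  proof -
    have pre: "prefix (wd a) (wd c)" and ob: "a \<in> Ob V" "c \<in> Ob V" using ac by (auto simp: le_def)
    then have ne': "wd c \<noteq> []" using ne by auto
    have "hd (wd a) = hd (wd c)" using ne ne' pre by (cases "wd a"; cases "wd c") auto
    then have jj: "j a = j c" by (simp add: j_def)
    have "prefix (tl (wd a)) (tl (wd c))" using ne ne' pre by (cases "wd a"; cases "wd c") auto
    then show ?thesis using nonNil[OF ob(1) ne] nonNil[OF ob(2) ne'] jj ne'
      by (simp add: word_category.le_def[OF branch])
  qed
  define P where "P = mk_psh V S (\<lambda>f. R (Dom V f) (Cod V f))"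
  have P: "P \<in> Ob (PSh V)"
    unfolding P_def
  proof (rule word_psh_in)
    fix a c x assume ac: "le a c" and x: "x \<in> S c"
    note ob = le_Ob[OF ac]
    have pre: "prefix (wd a) (wd c)" using ac by (simp add: le_def)
    show "R a c x \<in> S a"
    proof (cases "wd a = []")
      case True then show ?thesis using x by (auto simp: R_def S_def split: if_splits)
    next
      case False
      note t = two[OF ac False] and n = nonNil[OF conjunct2[OF ob]
          conjunct2[OF conjunct2[OF two[OF ac False]]]]
      obtain y z where yz: "x = pr (y, z)" "y \<in> Y" "z \<in> FO (p y (j c)) (b c)"
        using x t by (auto simp: S_def)
      then have "res (W (j c)) (p y (j c)) (b a) (b c) z \<in> FO (p y (j c)) (b a)"
        using word_category.res_in[OF branch p_in] t n by blast
      then show ?thesis using False t yz by (auto simp: R_def S_def)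
    qed
  next
    fix a x assume a: "a \<in> Ob V" and x: "x \<in> S a"
    show "R a a x = x"
    proof (cases "wd a = []")
      case False
      note n = nonNil[OF a False]
      obtain y z where yz: "x = pr (y, z)" "y \<in> Y" "z \<in> FO (p y (j a)) (b a)"
        using x False by (auto simp: S_def)
      then have "res (W (j a)) (p y (j a)) (b a) (b a) z = z"
        using word_category.res_refl[OF branch p_in] n by blast
      then show ?thesis using False yz by (simp add: R_def)
    qed (simp add: R_def)
  next
    fix a c d x assume ac: "le a c" and cd: "le c d" and x: "x \<in> S d"
    show "R a c (R c d x) = R a d x"
    proof (cases "wd a = []")
      case True
      then show ?thesis using two[OF cd] by (auto simp: R_def)
    next
      case False
      note t = two[OF ac False]
      note t' = two[OF cd conjunct2[OF conjunct2[OF t]]]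
      note n = nonNil[OF conjunct2[OF le_Ob[OF cd]] conjunct2[OF conjunct2[OF t']]]
      obtain y z where yz: "x = pr (y, z)" "y \<in> Y" "z \<in> FO (p y (j d)) (b d)"
        using x t' by (auto simp: S_def)
      have "res (W (j d)) (p y (j d)) (b a) (b c) (res (W (j d)) (p y (j d)) (b c) (b d) z) =
          res (W (j d)) (p y (j d)) (b a) (b d) z"
        using word_category.res_res[OF branch p_in[OF yz(2)], of "j d" "b a" "b c" "b d" z] t t' n
            yz by simp
      then show ?thesis using False yz t t' by (simp add: R_def)
    qed
  qed
  have FOP: "FO P a = S a" if "a \<in> Ob V" for a using that by (simp add: P_def)
  have resP: "res V P a c x = R a c x" if "le a c" "x \<in> S c" for a c x
    unfolding P_def using that by (rule res_word_psh)
  have FOr: "FO P root = Y" using root by (simp add: FOP S_def)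
  have jcn: "j (cn i w) = i" "b (cn i w) = rp i (wdW i w)" if "i \<in> I" "w \<in> Ob (W i)" for i w
    using that by (simp_all add: j_def b_def cn)
  \<comment> \<open>Restriction to the root reads off the tag, so the fibre over \<open>y\<close>
    consists of the elements tagged by \<open>y\<close>.\<close>
  have fibP: "FO (fib P y i) w = {pr (y, x) | x. x \<in> FO (p y i) (rp i (wdW i w))}"
    if i: "i \<in> I" and w: "w \<in> Ob (W i)" and y: "y \<in> Y" for y i w
  proof -
    have "res V P root (cn i w) x = fst (q x)" if "x \<in> S (cn i w)" for x
      using resP[OF le_root[OF cn(1)[OF i w]] that] root cn[OF i w] by (simp add: R_def)
    then have "FO (fib P y i) w = {x \<in> S (cn i w). fst (q x) = y}"
      unfolding FO_fib[OF i w] FOP[OF cn(1)[OF i w]] by auto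
    then show ?thesis using y cn(2)[OF i w] by (auto simp: S_def jcn[OF i w])
  qed
  \<comment> \<open>Removes the tag and moves the element from the representative of the word of
    \<open>w\<close>, where \<open>S\<close> placed it, to \<open>w\<close>.\<close>
  define e where "e y i = mk_nat (W i) (fib P y i)
    (\<lambda>w x. res (W i) (p y i) w (rp i (wdW i w)) (snd (q x))) (p y i)" for y i
  have lw: "leW i w (rp i (wdW i w))" "leW i (rp i (wdW i w)) w" if "i \<in> I" "w \<in> Ob (W i)" for i w
    using rp_wdW[OF that] that by (auto simp: word_category.le_def[OF branch])
  have e_in: "e y i \<in> hom (PSh (W i)) (fib P y i) (p y i)" if y: "y \<in> Y" and i: "i \<in> I" for y i
    unfolding e_def
  proof (rule word_category.word_nat_in[OF branch[OF i] fib_in[OF P i] p_in[OF y i]])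
    fix w x assume w: "w \<in> Ob (W i)" and x: "x \<in> FO (fib P y i) w"
    then show "res (W i) (p y i) w (rp i (wdW i w)) (snd (q x)) \<in> FO (p y i) w"
      using word_category.res_in[OF branch[OF i] p_in[OF y i] lw(1)[OF i w]]
      by (auto simp: fibP[OF i w y])
  next
    fix w w' x assume ww: "leW i w w'" and x: "x \<in> FO (fib P y i) w'"
    have w: "w \<in> Ob (W i)" and w': "w' \<in> Ob (W i)" using leW_Ob[OF i ww] by auto
    obtain z where z: "x = pr (y, z)" "z \<in> FO (p y i) (rp i (wdW i w'))"
      using x by (auto simp: fibP[OF i w' y])
    have x': "x \<in> S (cn i w')" using x by (simp add: FO_fib[OF i w'] FOP[OF cn(1)[OF i w']])
    let ?r = "rp i (wdW i w)" and ?r' = "rp i (wdW i w')"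
    have rr: "leW i ?r ?r'" using ww rp_wdW[OF i w] rp_wdW[OF i w']
      by (simp add: word_category.le_def[OF branch[OF i]])
    have "res (W i) (fib P y i) w w' x = pr (y, res (W i) (p y i) ?r ?r' z)"
      using res_fib[OF i ww x] resP[OF le_cn[OF i ww] x'] cn(2)[OF i w] cn(2)[OF i w'] z
      by (simp add: R_def jcn[OF i w] jcn[OF i w'])
    moreover have "res (W i) (p y i) w ?r (res (W i) (p y i) ?r ?r' z) =
        res (W i) (p y i) w w' (res (W i) (p y i) w' ?r' z)"
      using word_category.res_res[OF branch[OF i] p_in[OF y i] lw(1)[OF i w] rr z(2)]
        word_category.res_res[OF branch[OF i] p_in[OF y i] ww lw(1)[OF i w'] z(2)] by simp
    ultimately show "res (W i) (p y i) w ?r (snd (q (res (W i) (fib P y i) w w' x))) =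
        res (W i) (p y i) w w' (res (W i) (p y i) w' ?r' (snd (q x)))"
      using z by simp
  qed
  have e_iso: "is_iso (PSh (W i)) (e y i)" if y: "y \<in> Y" and i: "i \<in> I" for y i
  proof (rule category.PSh_is_isoI[OF W_category[OF i] e_in[OF y i]])
    fix w assume w: "w \<in> Ob (W i)"
    let ?r = "rp i (wdW i w)"
    note wc = branch[OF i] and pp = p_in[OF y i]
    have app: "app (e y i) w (pr (y, z)) = res (W i) (p y i) w ?r z" if "z \<in> FO (p y i) ?r" for z
      unfolding e_def using that w by (subst category.app_mk_nat[OF W_category[OF i]])
          (auto simp: fibP[OF i w y])
    have bwd: "res (W i) (p y i) ?r w (res (W i) (p y i) w ?r z) = z" if "z \<in> FO (p y i) ?r" for z
      using word_category.res_res[OF wc pp lw(2)[OF i w] lw(1)[OF i w] that]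
        word_category.res_refl[OF wc pp rp_wdW(1)[OF i w] that] by simp
    have fwd: "res (W i) (p y i) w ?r (res (W i) (p y i) ?r w z) = z" if "z \<in> FO (p y i) w" for z
      using word_category.res_res[OF wc pp lw(1)[OF i w] lw(2)[OF i w] that]
        word_category.res_refl[OF wc pp w that] by simp
    \<comment> \<open>The inverse restricts to the representative and puts the tag \<open>y\<close>
      back.\<close>
    show "bij_betw (app (e y i) w) (FO (fib P y i) w) (FO (p y i) w)"
      by (rule bij_betw_byWitness[where f' = "\<lambda>z. pr (y, res (W i) (p y i) ?r w z)"])
        (auto simp: fibP[OF i w y] app bwd fwd word_category.res_in[OF wc pp lw(2)[OF i w]]
          intro: word_category.res_in[OF wc pp lw(1)[OF i w]]
              word_category.res_in[OF wc pp lw(2)[OF i w]])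
  qed
  have p_ext: "p y \<in> extensional I" if "y \<in> Y" for y
    using p that by (auto simp: product_cat_def PiE_iff)
  have FOPhi: "FO fibre_functor P = (Y, \<lambda>y\<in>Y. \<lambda>i\<in>I. fib P y i)"
    by (simp add: fibre_functor_def FOr)
  have e_prod: "(\<lambda>i\<in>I. e y i) \<in> hom ProdW (\<lambda>i\<in>I. fib P y i) (p y)" if "y \<in> Y" for y
    using e_in[OF that] p_ext[OF that] by (auto simp: product_cat_hom)
  let ?f = "Arrow (Y, \<lambda>y\<in>Y. \<lambda>i\<in>I. fib P y i) (\<lambda>y\<in>Y. y, \<lambda>y\<in>Y. \<lambda>i\<in>I. e y i) (Y, p)"
  have "(\<lambda>y\<in>Y. \<lambda>i\<in>I. fib P y i) \<in> Y \<rightarrow>\<^sub>E Ob ProdW"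
    using fib_in[OF P] by (auto simp: product_cat_def)
  then have f: "?f \<in> hom (Fam ProdW) (Y, \<lambda>y\<in>Y. \<lambda>i\<in>I. fib P y i) (Y, p)"
    using p e_prod by (auto simp: Fam_hom)
  have "is_iso (Fam ProdW) ?f"
  proof (rule Fam_is_iso[OF category_ProdW f])
    fix y assume y: "y \<in> Y"
    have "is_iso ProdW (\<lambda>i\<in>I. e y i)"
      by (rule product_cat_is_iso[OF category.category_PSh[OF W_category] e_prod[OF y]])
        (use e_iso[OF y] in auto)
    then show "is_iso ProdW ((\<lambda>y\<in>Y. \<lambda>i\<in>I. e y i) y)" using y by simp
  qed
  then show ?thesis using P f FOPhi B_eq by (metis (no_types))
qed

theorem PSh_equivalent_Fam:
  "equivalent_categories (PSh V :: (('o, 'a, 'u::infinite set, 'u sarr) ftor, _) cat)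
    (Fam ProdW :: (('u, 'i \<Rightarrow> ('o2, 'a2, 'u set, 'u sarr) ftor) fam, _) cat)"
proof (rule equivalent_categoriesI[OF category_PSh category_Fam[OF category_ProdW] fibre_functor])
  fix P Q :: "('o, 'a, 'u set, 'u sarr) ftor" and g
  assume "P \<in> Ob (PSh V)" "Q \<in> Ob (PSh V)"
      "g \<in> hom (Fam ProdW) (FO fibre_functor P) (FO fibre_functor Q)"
  then show "\<exists>!f. f \<in> hom (PSh V) P Q \<and> FA fibre_functor f = g"
    using fibre_functor_full[of P Q g] fibre_functor_eqD[of _ P Q] by (metis (no_types))
qed (rule fibre_functor_ess_surj)

end

section \<open>The base category\<close>

text \<open>For the objects that carry \<open>s\<close> and \<open>t\<close> the arities are
  functions of the object, so a list of objects can be typed without further data. The value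
  \<open>0\<close> elsewhere is a mere default.\<close>

fun bsrc :: "bobj \<Rightarrow> nat" where
  "bsrc (Tick n) = n" | "bsrc (ParaL n) = n" | "bsrc (ParaR n) = n" | "bsrc (Nu n) = n"
| "bsrc (IotaP n i) = n" | "bsrc (IotaM n i) = n" | "bsrc _ = 0"

fun btgt :: "bobj \<Rightarrow> nat" where
  "btgt (Nu n) = Suc n" | "btgt c = bsrc c"

lemma st_obj_bsrc: "st_obj c n n' \<Longrightarrow> n = bsrc c \<and> n' = btgt c"
  by (induction rule: st_obj.induct) auto

lemma st_obj_le: "st_obj c n n' \<Longrightarrow> n \<le> n'"
  by (induction rule: st_obj.induct) auto

fun gsrc :: "gen \<Rightarrow> bobj" where
  "gsrc (Gd n i) = Star" | "gsrc (Gs c) = Pl (bsrc c)" | "gsrc (Gt c) = Pl (btgt c)"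
| "gsrc (Gl n) = ParaL n" | "gsrc (Gr n) = ParaR n"
| "gsrc (Geps n i m j) = IotaP n i" | "gsrc (Grho n i m j) = IotaM m j"

fun gtgt :: "gen \<Rightarrow> bobj" where
  "gtgt (Gd n i) = Pl n" | "gtgt (Gs c) = c" | "gtgt (Gt c) = c"
| "gtgt (Gl n) = Para n" | "gtgt (Gr n) = Para n"
| "gtgt (Geps n i m j) = Tau n i m j" | "gtgt (Grho n i m j) = Tau n i m j"

lemma edge_gsrc: "edge a g b \<Longrightarrow> a = gsrc g \<and> b = gtgt g"
  by (induction rule: edge.induct) (auto dest: st_obj_bsrc)

lemma st_obj_bobjs: "st_obj c n n' \<Longrightarrow> c \<in> bobjs"
  by (induction rule: st_obj.induct) (auto simp: bobjs_def)

lemma bobjs_simps [simp]: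
  "Star \<in> bobjs" "Pl n \<in> bobjs" "Tick n \<in> bobjs" "ParaL n \<in> bobjs" "ParaR n \<in> bobjs"
  "Nu n \<in> bobjs" "Para n \<in> bobjs"
  "IotaP n i \<in> bobjs \<longleftrightarrow> i \<in> {1..n}" "IotaM n i \<in> bobjs \<longleftrightarrow> i \<in> {1..n}"
  "Tau n i m j \<in> bobjs \<longleftrightarrow> i \<in> {1..n} \<and> j \<in> {1..m}"
  by (auto simp: bobjs_def)

lemma edge_bobjs: "edge a g b \<Longrightarrow> a \<in> bobjs \<and> b \<in> bobjs"
  by (induction rule: edge.induct) (auto dest: st_obj_bobjs)

lemma bpath_bobjs: "bpath a p b \<Longrightarrow> a \<in> bobjs \<and> b \<in> bobjs"
  by (induction rule: bpath.induct) (auto dest: edge_bobjs)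

lemma bpath_Nil [simp]: "bpath a [] b \<longleftrightarrow> a = b \<and> a \<in> bobjs"
  by (auto elim: bpath.cases intro: bpath.intros)

lemma bpath_Cons: "bpath a (g # p) b \<longleftrightarrow> edge a g (gtgt g) \<and> bpath (gtgt g) p b"
proof
  assume "bpath a (g # p) b"
  then show "edge a g (gtgt g) \<and> bpath (gtgt g) p b"
    by cases (use edge_gsrc in blast)
qed (auto intro: bpath.intros)

lemma bpath_append: "bpath a (p @ q) c \<longleftrightarrow> (\<exists>b. bpath a p b \<and> bpath b q c)"
  by (induction p arbitrary: a) (auto simp: bpath_Cons dest: bpath_bobjs)

lemma bpath_edge: "edge a g b \<Longrightarrow> bpath a [g] b"
  using edge_gsrc edge_bobjs by (auto simp: bpath_Cons)

text \<open>The sides of each relation are parallel. For the relation between \<open>s\<close> and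
  \<open>t\<close> this rests on \<open>n \<le> n'\<close>, which makes channel \<open>i\<close> of
  the first player available to the second.\<close>

lemma brel_bpath: "brel u v \<Longrightarrow> \<exists>a b. bpath a u b \<and> bpath a v b"
proof (induction rule: brel.induct)
  case (1 c n n' i)
  then show ?case using st_obj_le[OF 1(1)] st_obj_bobjs[OF 1(1)]
      edge.intros(1)[of i n] edge.intros(1)[of i n'] edge.intros(2,3)[OF 1(1)]
    by (intro exI[of _ Star] exI[of _ c]) (auto simp: bpath_Cons)
next
  case (2 n)
  then show ?case
    using edge.intros(4,5)[of n] edge.intros(2)[OF st_obj.intros(2)[of n]]
        edge.intros(2)[OF st_obj.intros(3)[of n]]
    by (intro exI[of _ "Pl n"] exI[of _ "Para n"]) (auto simp: bpath_Cons)
next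
  case (3 i n j m)
  then show ?case
    using edge.intros(6,7)[OF 3] edge.intros(1)[OF 3(1)] edge.intros(1)[OF 3(2)]
      edge.intros(2)[OF st_obj.intros(5)[OF 3(1)]] edge.intros(2)[OF st_obj.intros(6)[OF 3(2)]]
    by (intro exI[of _ Star] exI[of _ "Tau n i m j"]) (auto simp: bpath_Cons)
qed

lemma bpath_unique: "bpath a p b \<Longrightarrow> bpath a' p b' \<Longrightarrow> p \<noteq> [] \<Longrightarrow> a = a' \<and> b = b'"
proof (induction p arbitrary: a a')
  case (Cons g p)
  then have "edge a g (gtgt g)" "edge a' g (gtgt g)" by (auto simp: bpath_Cons)
  then have "a = a'" by (metis edge_gsrc)
  moreover have "b = b'" using Cons by (cases "p = []") (auto simp: bpath_Cons)
  ultimately show ?case by simp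
qed simp

lemma brel_nonempty: "brel u v \<Longrightarrow> 2 \<le> length u \<and> length v = length u"
  by (induction rule: brel.induct) auto

lemma brel_bpath_iff:
  assumes "brel u v"
  shows "bpath a u b \<longleftrightarrow> bpath a v b"
proof -
  obtain a' b' where uv: "bpath a' u b'" "bpath a' v b'" using brel_bpath[OF assms] by blast
  have ne: "u \<noteq> []" "v \<noteq> []" using brel_nonempty[OF assms] by auto
  show ?thesis using uv bpath_unique[OF _ uv(1) ne(1)] bpath_unique[OF _ uv(2) ne(2)] by blast
qed

text \<open>The congruence is defined on untyped lists of generators; this justifies forming its
  classes inside each hom-set.\<close>

lemma bcong_bpath: "bcong p q \<Longrightarrow> bpath a p b \<longleftrightarrow> bpath a q b"
proof (induction rule: bcong.induct)
  case (bcong_rel u v p q)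
  show ?case unfolding bpath_append brel_bpath_iff[OF bcong_rel] ..
qed simp_all

text \<open>Relations equate lists of equal length at least two, so identities and single generators
  have singleton classes. This is what keeps the channels of a player distinct.\<close>

lemma bcong_length: "bcong p q \<Longrightarrow> length p = length q \<and> (length p < 2 \<longrightarrow> p = q)"
proof (induction rule: bcong.induct)
  case (bcong_rel u v p q)
  then show ?case using brel_nonempty[OF bcong_rel] by simp
next
  case (bcong_sym p q)
  then show ?case by metis
next
  case (bcong_trans p q r)
  then show ?case by metis
qed simp

lemma bcong_context: "bcong p q \<Longrightarrow> bcong (u @ p @ v) (u @ q @ v)"
proof (induction rule: bcong.induct)
  case (bcong_rel x y p q)
  then show ?case using bcong.bcong_rel[of x y "u @ p" "q @ v"] by simp
qed (blast intro: bcong.intros)+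

lemma bcong_append: "bcong p p' \<Longrightarrow> bcong q q' \<Longrightarrow> bcong (p @ q) (p' @ q')"
  using bcong_context[of p p' "[]" q] bcong_context[of q q' p' "[]"] by (auto intro: bcong_trans)

lemma barrow_eq_iff: "barrow a p b = barrow a' q b' \<longleftrightarrow> a = a' \<and> b = b' \<and> bcong p q"
  unfolding barrow_def by (auto intro: bcong.intros)

lemma Base_simps [simp]: "Ob Base = bobjs" "Dom Base = src" "Cod Base = tgt" "Ide Base a = barrow a [] a"
  by (simp_all add: Base_def)

lemma src_barrow [simp]: "src (barrow a p b) = a" and tgt_barrow [simp]: "tgt (barrow a p b) = b"
  by (simp_all add: barrow_def)

lemma hom_Base: "f \<in> hom Base a b \<longleftrightarrow> (\<exists>p. f = barrow a p b \<and> bpath a p b)"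
  by (auto simp: hom_def) (auto simp: Base_def)

lemma barrow_hom: "bpath a p b \<Longrightarrow> barrow a p b \<in> hom Base a b"
  by (auto simp: hom_Base)

lemma Cmp_barrow [simp]: "Cmp Base (barrow b q c) (barrow a p b') = barrow a (p @ q) c"
  unfolding Base_def by (auto simp: barrow_def intro: bcong.intros bcong_append)

interpretation Base: category Base
proof
  fix f assume "f \<in> Arr Base"
  then show "Dom Base f \<in> Ob Base \<and> Cod Base f \<in> Ob Base"
    using bpath_bobjs by (auto simp: Base_def)
next
  fix f a b g c assume "f \<in> hom Base a b" "g \<in> hom Base b c"
  then obtain p q where pq: "f = barrow a p b" "g = barrow b q c" and path: "bpath a p b" "bpath b q c"
    by (auto simp: hom_Base)
  then have "bpath a (p @ q) c" by (auto simp: bpath_append)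
  then show "Cmp Base g f \<in> hom Base a c" unfolding pq Cmp_barrow by (rule barrow_hom)
qed (auto simp: hom_Base barrow_eq_iff bpath_append intro: bcong.intros)

section \<open>Presheaves on the base category and the action of the generators\<close>

lemmas Chat_cat = Base.category_PSh[folded Chat_def]
interpretation Chat: category Chat by (rule Chat_cat)

lemmas chat_act_in = Base.act_in[folded Chat_def]
lemmas chat_act_Ide = Base.act_Ide[folded Chat_def]
lemmas chat_act_Cmp = Base.act_Cmp[folded Chat_def]
lemmas chat_app_in = Base.app_in[folded Chat_def, simplified Base_simps]
lemmas chat_app_act = Base.app_act[folded Chat_def]
lemmas chat_eqI = Base.nat_eqI[folded Chat_def, simplified Base_simps]
lemmas chat_app_Cmp = Base.app_Cmp[folded Chat_def, simplified Base_simps]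
lemmas chat_app_Ide = Base.app_Ide[folded Chat_def, simplified Base_simps]

lemma Chat_hom: "\<alpha> \<in> hom Chat X Y \<Longrightarrow> \<alpha> \<in> Arr Chat \<and> src \<alpha> = X \<and> tgt \<alpha> = Y \<and> X \<in> Ob Chat \<and> Y \<in> Ob Chat"
  using Chat.hom_Ob[of \<alpha> X Y] by (auto simp: hom_def Chat_def functor_cat_simps)

lemma Chat_Arr: "\<alpha> \<in> Arr Chat \<Longrightarrow> \<alpha> \<in> hom Chat (src \<alpha>) (tgt \<alpha>)"
  by (auto simp: hom_def Chat_def functor_cat_simps)

lemma Chat_Dom [simp]: "Dom Chat = src" and Chat_Cod [simp]: "Cod Chat = tgt"
  by (simp_all add: Chat_def functor_cat_simps)

definition gact :: "'u psh \<Rightarrow> gen \<Rightarrow> 'u \<Rightarrow> 'u" where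
  "gact X g = act X (barrow (gsrc g) [g] (gtgt g))"

lemma act_edge: "edge a g b \<Longrightarrow> act X (barrow a [g] b) = gact X g"
  using edge_gsrc by (auto simp: gact_def)

lemma gact_in: "X \<in> Ob Chat \<Longrightarrow> edge a g b \<Longrightarrow> x \<in> FO X b \<Longrightarrow> gact X g x \<in> FO X a"
  using chat_act_in[OF _ barrow_hom[OF bpath_edge]] by (simp add: act_edge)

lemma act_Cons:
  assumes "X \<in> Ob Chat" "bpath a (g # p) b" "x \<in> FO X b"
  shows "act X (barrow a (g # p) b) x = gact X g (act X (barrow (gtgt g) p b) x)"
  using assms chat_act_Cmp[OF assms(1) barrow_hom[OF bpath_edge[of a g "gtgt g"]]
      barrow_hom[of "gtgt g" p b] assms(3)]
  by (auto simp: bpath_Cons act_edge)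

lemma app_gact:
  "\<alpha> \<in> hom Chat X Y \<Longrightarrow> edge a g b \<Longrightarrow> x \<in> FO X b \<Longrightarrow> app \<alpha> a (gact X g x) = gact Y g (app \<alpha> b x)"
  using chat_app_act[OF _ barrow_hom[OF bpath_edge]] by (simp add: act_edge)

text \<open>Every arrow is a path of generators, so naturality spreads from generators to all arrows
  by induction on the path.\<close>

lemma chat_nat_in:
  assumes X: "X \<in> Ob Chat" and Y: "Y \<in> Ob Chat"
    and h: "\<And>c x. c \<in> bobjs \<Longrightarrow> x \<in> FO X c \<Longrightarrow> h c x \<in> FO Y c"
    and g: "\<And>a g b x. edge a g b \<Longrightarrow> x \<in> FO X b \<Longrightarrow> h a (gact X g x) = gact Y g (h b x)"
  shows "mk_nat Base X h Y \<in> hom Chat X Y"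
  unfolding Chat_def
proof (rule Base.mk_nat_in)
  fix f a b x assume "f \<in> hom Base a b" and x: "x \<in> FO X b"
  then obtain p where p: "f = barrow a p b" "bpath a p b" by (auto simp: hom_Base)
  have "h a (act X (barrow a p b) x) = act Y (barrow a p b) (h b x)"
    using p(2)
  proof (induction p arbitrary: a)
    case Nil
    then show ?case using chat_act_Ide[OF X, of b x] chat_act_Ide[OF Y, of b "h b x"] x h by auto
  next
    case (Cons q p)
    then have e: "edge a q (gtgt q)" and p: "bpath (gtgt q) p b" by (auto simp: bpath_Cons)
    have b: "b \<in> bobjs" using bpath_bobjs[OF p] by simp
    show ?case
      using g[OF e chat_act_in[OF X barrow_hom[OF p] x]] Cons.IH[OF p]
        act_Cons[OF X Cons.prems x] act_Cons[OF Y Cons.prems h[OF b x]] by simp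
  qed
  then show "h a (act X f x) = act Y f (h b x)" using p by simp
qed (use X Y h in \<open>auto simp: Chat_def\<close>)

lemma app_mk_nat: "c \<in> bobjs \<Longrightarrow> x \<in> FO X c \<Longrightarrow> app (mk_nat Base X h Y) c x = h c x"
  by simp

section \<open>Countable presheaves from actions of the generators\<close>

text \<open>One fixed injection through which concrete presheaves, described with natural numbers as
  elements, are moved into the given infinite type.\<close>

definition nm :: "nat \<Rightarrow> 'u::infinite" where
  "nm = (SOME f. inj f)"

lemma inj_nm: "inj nm"
  unfolding nm_def using infinite_countable_subset[OF infinite_UNIV] by (metis (mono_tags) someI_ex)

lemma nm_eq [simp]: "nm k = nm l \<longleftrightarrow> k = l"
  using inj_nm by (auto dest: injD)

lemma inv_nm [simp]: "inv nm (nm k) = k"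
  by (rule inv_f_f[OF inj_nm])

text \<open>Paths are listed in diagrammatic order and presheaves are contravariant, so the last
  generator acts first, as in \<open>foldr\<close>.\<close>

definition pact :: "(gen \<Rightarrow> nat \<Rightarrow> nat) \<Rightarrow> gen list \<Rightarrow> nat \<Rightarrow> nat" where
  "pact G p x = foldr G p x"

text \<open>An arrow carries a whole class of paths; acting by an arbitrary member is legitimate
  once the relations are respected, as \<open>gen_action\<close> demands.\<close>

definition natpsh :: "(bobj \<Rightarrow> nat set) \<Rightarrow> (gen \<Rightarrow> nat \<Rightarrow> nat) \<Rightarrow> 'u::infinite psh" where
  "natpsh S G = mk_psh Base (\<lambda>c. nm ` S c) (\<lambda>f x. nm (pact G (SOME p. p \<in> val f) (inv nm x)))"

locale gen_action =
  fixes S :: "bobj \<Rightarrow> nat set" and G :: "gen \<Rightarrow> nat \<Rightarrow> nat"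
  assumes gen_in: "edge a g b \<Longrightarrow> x \<in> S b \<Longrightarrow> G g x \<in> S a"
    and gen_rel: "brel u v \<Longrightarrow> bpath a u b \<Longrightarrow> x \<in> S b \<Longrightarrow> pact G u x = pact G v x"
begin

lemma pact_in: "bpath a p b \<Longrightarrow> x \<in> S b \<Longrightarrow> pact G p x \<in> S a"
  by (induction p arbitrary: a) (auto simp: pact_def bpath_Cons intro: gen_in)

lemma pact_append: "pact G (p @ q) x = pact G p (pact G q x)"
  by (simp add: pact_def)

text \<open>An elementary replacement happens in the middle of a path: the common suffix acts first
  and yields an element to which the defining relation applies.\<close>

lemma pact_bcong: "bcong p q \<Longrightarrow> bpath a p b \<Longrightarrow> x \<in> S b \<Longrightarrow> pact G p x = pact G q x"
proof (induction arbitrary: a b x rule: bcong.induct)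
  case (bcong_rel u v p q)
  then obtain c d where "bpath c u d" "bpath d q b" by (auto simp: bpath_append)
  then show ?case using bcong_rel gen_rel pact_in by (auto simp: pact_append)
next
  case (bcong_sym p q)
  then show ?case using bcong_bpath by metis
next
  case (bcong_trans p q r)
  then show ?case using bcong_bpath by metis
qed simp

lemma pact_some: "bpath a p b \<Longrightarrow> x \<in> S b \<Longrightarrow> pact G (SOME q. q \<in> val (barrow a p b)) x = pact G p x"
proof -
  assume p: "bpath a p b" and x: "x \<in> S b"
  have "bcong p (SOME q. bcong p q)" by (rule someI) (rule bcong_refl)
  then show ?thesis using pact_bcong[OF _ p x] by (simp add: barrow_def)
qed

lemma natpsh_in: "natpsh S G \<in> Ob Chat"
  unfolding natpsh_def Chat_def
proof (rule Base.mk_psh_in)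
  fix f a b x assume "f \<in> hom Base a b" "x \<in> nm ` S b"
  then show "nm (pact G (SOME p. p \<in> val f) (inv nm x)) \<in> nm ` S a"
    by (auto simp: hom_Base pact_some pact_in)
next
  fix a x assume "a \<in> Ob Base" "x \<in> nm ` S a"
  then show "nm (pact G (SOME p. p \<in> val (Ide Base a)) (inv nm x)) = x"
    using pact_some[of a "[]" a] by (auto simp: pact_def)
next
  fix f g a b c x assume *: "f \<in> hom Base a b" "g \<in> hom Base b c" "x \<in> nm ` S c"
  have "bpath a (p @ q) c" if "bpath a p b" "bpath b q c" for p q
    using that by (auto simp: bpath_append)
  with * show "nm (pact G (SOME p. p \<in> val (Cmp Base g f)) (inv nm x)) =
      nm (pact G (SOME p. p \<in> val f) (inv nm (nm (pact G (SOME p. p \<in> val g) (inv nm x)))))"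
    by (auto simp: hom_Base pact_some pact_in pact_append)
qed

lemma FO_natpsh: "c \<in> bobjs \<Longrightarrow> FO (natpsh S G) c = nm ` S c"
  by (simp add: natpsh_def)

lemma gact_natpsh: "edge a g b \<Longrightarrow> k \<in> S b \<Longrightarrow> gact (natpsh S G) g (nm k) = nm (G g k)"
proof -
  assume e: "edge a g b" and k: "k \<in> S b"
  have "act (natpsh S G) (barrow a [g] b) (nm k :: 'a) =
      nm (pact G (SOME q. q \<in> val (barrow a [g] b)) (inv nm (nm k :: 'a)))"
    unfolding natpsh_def by (rule Base.act_mk_psh[OF barrow_hom[OF bpath_edge[OF e]]]) (use k in auto)
  then show ?thesis
    using e k pact_some[OF bpath_edge[OF e] k] by (simp add: act_edge pact_def)
qed

end

section \<open>Representable presheaves\<close>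

abbreviation uel :: "bobj \<Rightarrow> 'u::infinite" where
  "uel c \<equiv> enc (barrow c [] c)"

abbreviation ev :: "'u::infinite parr \<Rightarrow> bobj \<Rightarrow> 'u" where
  "ev \<alpha> c \<equiv> app \<alpha> c (uel c)"

lemma dec_enc: "f \<in> hom Base a b \<Longrightarrow> dec (enc f :: 'u::infinite) = f"
  by (simp add: dec_def hom_def inv_into_f_f[OF inj_on_enc])

lemma enc_eq_iff: "f \<in> hom Base a b \<Longrightarrow> g \<in> hom Base a' b' \<Longrightarrow> (enc f :: 'u::infinite) = enc g \<longleftrightarrow> f = g"
  by (auto simp: hom_def dest: inj_onD[OF inj_on_enc])

lemma yo_mk_psh: "yo c = mk_psh Base (\<lambda>d. enc ` hom Base d c) (\<lambda>f x. enc (Cmp Base (dec x) f))"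
  by (auto simp: yo_def mk_psh_def)

lemma yo_in: "yo c \<in> Ob Chat"
  unfolding yo_mk_psh Chat_def
proof (rule Base.mk_psh_in)
  fix f a b and x :: 'a assume "f \<in> hom Base a b" "x \<in> enc ` hom Base b c"
  then show "enc (Cmp Base (dec x) f) \<in> (enc ` hom Base a c :: 'a set)"
    using Base.cmp by (auto simp: dec_enc)
next
  fix a and x :: 'a assume "a \<in> Ob Base" "x \<in> enc ` hom Base a c"
  then show "enc (Cmp Base (dec x) (Ide Base a)) = x"
    using Base.ide_right by (auto simp: dec_enc simp del: Base_simps)
next
  fix f g a b d and x :: 'a assume "f \<in> hom Base a b" "g \<in> hom Base b d" "x \<in> enc ` hom Base d c"
  then show "enc (Cmp Base (dec x) (Cmp Base g f)) =
      (enc (Cmp Base (dec (enc (Cmp Base (dec x) g) :: 'a)) f) :: 'a)"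
    using Base.assoc[of f a b g d _ c] by (auto simp: dec_enc dec_enc[OF Base.cmp[of g b d _ c]])
qed

lemma FO_yo: "d \<in> bobjs \<Longrightarrow> FO (yo c) d = enc ` hom Base d c"
  by (simp add: yo_def)

lemma act_yo: "f \<in> hom Base a b \<Longrightarrow> g \<in> hom Base b c \<Longrightarrow> act (yo c) f (enc g) = enc (Cmp Base g f)"
  unfolding yo_mk_psh by (subst Base.act_mk_psh) (auto simp: dec_enc)

lemma uel_in: "c \<in> bobjs \<Longrightarrow> uel c \<in> FO (yo c) c"
  using barrow_hom[of c "[]" c] by (simp add: FO_yo)

lemma dec_uel: "c \<in> bobjs \<Longrightarrow> dec (uel c) = barrow c [] c"
  by (rule dec_enc[OF barrow_hom]) simp

text \<open>Naturality at the universal element: \<open>enc f\<close> is its restriction along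
  \<open>f\<close>.\<close>

lemma app_yo:
  assumes "\<alpha> \<in> hom Chat (yo c) X" "f \<in> hom Base d c"
  shows "app \<alpha> d (enc f) = act X f (ev \<alpha> c)"
proof -
  have c: "c \<in> bobjs" using Base.hom_Ob[OF assms(2)] by simp
  have "act (yo c) f (uel c) = (enc f :: 'a)"
    using act_yo[OF assms(2) barrow_hom[of c "[]" c]] c Base.ide_left[OF assms(2)] by simp
  then show ?thesis using chat_app_act[OF assms uel_in[OF c]] by simp
qed

lemma yo_eqI:
  assumes "\<alpha> \<in> hom Chat (yo c) X" "\<beta> \<in> hom Chat (yo c) X" "ev \<alpha> c = ev \<beta> c"
  shows "\<alpha> = \<beta>"
  using assms by (intro chat_eqI[OF assms(1,2)]) (auto simp: FO_yo app_yo)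

text \<open>The Yoneda correspondence: \<open>el\<close> turns an element into its classifying map,
  \<open>ev\<close> evaluates a map at the identity, and \<open>ev_el\<close> with
  \<open>yo_eqI\<close> make them mutually inverse.\<close>

definition el :: "bobj \<Rightarrow> 'u psh \<Rightarrow> 'u \<Rightarrow> 'u::infinite parr" where
  "el c X x = mk_nat Base (yo c) (\<lambda>d e. act X (dec e) x) X"

lemma el_in:
  assumes X: "X \<in> Ob Chat" and x: "x \<in> FO X c"
  shows "el c X x \<in> hom Chat (yo c) X"
  unfolding el_def Chat_def
proof (rule Base.mk_nat_in)
  fix d e assume "d \<in> Ob Base" "e \<in> FO (yo c) d"
  then show "act X (dec e) x \<in> FO X d"
    using chat_act_in[OF X _ x] by (auto simp: FO_yo dec_enc)
next
  fix f a b e assume "f \<in> hom Base a b" "e \<in> FO (yo c) b"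
  then show "act X (dec (act (yo c) f e)) x = act X f (act X (dec e) x)"
    using Base.hom_Ob[of f a b] chat_act_Cmp[OF X _ _ x]
    by (auto simp: FO_yo act_yo dec_enc dec_enc[OF Base.cmp[of f a b _ c]])
qed (use X yo_in in \<open>auto simp: Chat_def\<close>)

lemma ev_el: "X \<in> Ob Chat \<Longrightarrow> c \<in> bobjs \<Longrightarrow> x \<in> FO X c \<Longrightarrow> ev (el c X x) c = x"
  using chat_act_Ide[of X c x] by (simp add: el_def uel_in dec_uel)

lemma ev_in: "\<alpha> \<in> hom Chat (yo c) X \<Longrightarrow> c \<in> bobjs \<Longrightarrow> ev \<alpha> c \<in> FO X c"
  by (rule chat_app_in[OF _ _ uel_in])

lemma yo_arr_in:
  assumes "f \<in> hom Base a b"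
  shows "yo_arr f \<in> hom Chat (yo a) (yo b :: 'u::infinite psh)" "ev (yo_arr f) a = (enc f :: 'u)"
proof -
  have a: "a \<in> bobjs" using Base.hom_Ob[OF assms] by simp
  have f: "src f = a" "tgt f = b" using assms by (auto simp: hom_def)
  have eq: "(yo_arr f :: 'u parr) = mk_nat Base (yo a) (\<lambda>d x. enc (Cmp Base f (dec x))) (yo b)"
    by (auto simp: yo_arr_def mk_nat_def f FO_yo fun_eq_iff)
  show "yo_arr f \<in> hom Chat (yo a) (yo b :: 'u psh)"
    unfolding eq Chat_def
  proof (rule Base.mk_nat_in)
    fix d and e :: 'u assume "d \<in> Ob Base" "e \<in> FO (yo a) d"
    then show "enc (Cmp Base f (dec e)) \<in> FO (yo b :: 'u psh) d"
      using Base.cmp[OF _ assms] by (auto simp: FO_yo dec_enc)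
  next
    fix g d d' and e :: 'u assume g: "g \<in> hom Base d d'" and "e \<in> FO (yo a) d'"
    then obtain k where k: "e = enc k" "k \<in> hom Base d' a"
      using Base.hom_Ob[OF g] by (auto simp: FO_yo)
    show "enc (Cmp Base f (dec (act (yo a) g e))) = act (yo b) g (enc (Cmp Base f (dec e)) :: 'u)"
      using Base.assoc[OF g k(2) assms]
      by (simp add: k(1) act_yo[OF g k(2)] act_yo[OF g Base.cmp[OF k(2) assms]]
        dec_enc[OF k(2)] dec_enc[OF Base.cmp[OF g k(2)]])
  qed (use yo_in in \<open>auto simp: Chat_def\<close>)
  show "ev (yo_arr f) a = (enc f :: 'u)"
    unfolding eq using a Base.ide_right[OF assms] by (simp add: uel_in dec_uel)
qed

lemma yo_gen_in: "edge a g b \<Longrightarrow> yo_path a [g] b \<in> hom Chat (yo a) (yo b)"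
  by (rule yo_arr_in[OF barrow_hom[OF bpath_edge]])

lemma ev_yo_gen:
  assumes "edge a g b" "\<alpha> \<in> hom Chat (yo b) X"
  shows "ev (\<alpha> \<odot> yo_path a [g] b) a = gact X g (ev \<alpha> b)"
proof -
  note f = barrow_hom[OF bpath_edge[OF assms(1)]]
  have a: "a \<in> bobjs" using edge_bobjs[OF assms(1)] by simp
  show ?thesis
    by (simp add: chat_app_Cmp[OF yo_arr_in(1)[OF f] a uel_in[OF a]] yo_arr_in(2)[OF f]
        app_yo[OF assms(2) f] act_edge[OF assms(1)])
qed

lemma ev_Cmp: "\<alpha> \<in> hom Chat (yo c) X \<Longrightarrow> c \<in> bobjs \<Longrightarrow> ev (\<beta> \<odot> \<alpha>) c = app \<beta> c (ev \<alpha> c)"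
  by (rule chat_app_Cmp[OF _ _ uel_in])

subsection \<open>Players\<close>

text \<open>A grading that every generator strictly raises. It excludes cycles and leaves few
  candidates for paths into a given object.\<close>

fun brank :: "bobj \<Rightarrow> nat" where
  "brank Star = 0" | "brank (Pl n) = 1" | "brank (Para n) = 3" | "brank (Tau n i m j) = 3" |
      "brank _ = 2"

lemma st_obj_rank: "st_obj c n n' \<Longrightarrow> brank c = 2"
  by (induction rule: st_obj.induct) auto

lemma edge_rank: "edge a g b \<Longrightarrow> brank a < brank b"
  by (induction rule: edge.induct) (auto dest: st_obj_rank)

lemma bpath_rank: "bpath a p b \<Longrightarrow> a = b \<or> brank a < brank b"
  by (induction rule: bpath.induct) (auto dest: edge_rank)

lemma edge_into_Pl: "edge a g (Pl n) \<Longrightarrow> \<exists>i\<in>{1..n}. a = Star \<and> g = Gd n i"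
  by (erule edge.cases) (auto dest: st_obj_rank)

text \<open>Below the rank of a player there is only \<open>Star\<close>, and no generator ends
  there, so a nonempty path into a player is a single \<open>Gd\<close>.\<close>

lemma bpath_into_Pl:
  "bpath a p (Pl n) \<longleftrightarrow> a = Pl n \<and> p = [] \<or> (\<exists>i\<in>{1..n}. a = Star \<and> p = [Gd n i])"
proof
  assume "bpath a p (Pl n)"
  then show "a = Pl n \<and> p = [] \<or> (\<exists>i\<in>{1..n}. a = Star \<and> p = [Gd n i])"
  proof cases
    case (2 g b p')
    have "b = Pl n \<or> b = Star" using bpath_rank[OF 2(3)] by (cases b) auto
    moreover have "b \<noteq> Star" using edge_rank[OF 2(2)] by auto
    ultimately have b: "b = Pl n" by simp
    have "p' = []"
    proof (cases p')
      case (Cons g' p'')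
      then have "brank (Pl n) < brank (gtgt g')" "gtgt g' = Pl n \<or> brank (gtgt g') < brank (Pl n)"
        using 2(3) b edge_rank[of "Pl n" g' "gtgt g'"] bpath_rank[of "gtgt g'" p'' "Pl n"]
            by (auto simp: bpath_Cons)
      then show ?thesis by auto
    qed simp
    then show ?thesis using 2 b edge_into_Pl by auto
  qed simp
qed (use bpath_edge[OF edge.intros(1)] in auto)

abbreviation ch :: "nat \<Rightarrow> nat \<Rightarrow> 'u::infinite" where
  "ch n i \<equiv> enc (barrow Star [Gd n i] (Pl n))"

lemma edge_Gd: "i \<in> {1..n} \<Longrightarrow> edge Star (Gd n i) (Pl n)"
  by (rule edge.intros)

lemma hom_Base_Pl:
  "hom Base Star (Pl n) = (\<lambda>i. barrow Star [Gd n i] (Pl n)) ` {1..n}"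
  "hom Base (Pl m) (Pl n) = (if m = n then {barrow (Pl n) [] (Pl n)} else {})"
  "c \<noteq> Star \<Longrightarrow> c \<noteq> Pl n \<Longrightarrow> hom Base c (Pl n) = {}"
  by (auto simp: set_eq_iff hom_Base bpath_into_Pl)

lemma FO_yo_Pl_Star: "FO (yo (Pl n)) Star = ch n ` {1..n}"
  by (simp add: FO_yo hom_Base_Pl image_image)

lemma FO_yo_Pl: "FO (yo (Pl n)) (Pl m) = (if m = n then {uel (Pl n)} else {})"
  by (simp add: FO_yo hom_Base_Pl)

lemma FO_yo_Pl_other: "c \<in> bobjs \<Longrightarrow> c \<noteq> Star \<Longrightarrow> c \<noteq> Pl n \<Longrightarrow> FO (yo (Pl n)) c = {}"
  by (simp add: FO_yo hom_Base_Pl)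

lemma ch_eq_iff:
  assumes "i \<in> {1..n}" "j \<in> {1..n}"
  shows "(ch n i :: 'u::infinite) = ch n j \<longleftrightarrow> i = j"
  using enc_eq_iff[OF barrow_hom[OF bpath_edge[OF edge_Gd[OF assms(1)]]]
      barrow_hom[OF bpath_edge[OF edge_Gd[OF assms(2)]]]]
  by (auto simp: barrow_eq_iff intro: bcong.intros dest: bcong_length)

lemma app_ch: "\<alpha> \<in> hom Chat (yo (Pl n)) X \<Longrightarrow> i \<in> {1..n} \<Longrightarrow> app \<alpha> Star (ch n i) =
    gact X (Gd n i) (ev \<alpha> (Pl n))"
  using app_yo[OF _ barrow_hom[OF bpath_edge[OF edge_Gd]]] by (simp add: act_edge[OF edge_Gd])

lemma yd_in: "i \<in> {1..n} \<Longrightarrow> yd n i \<in> hom Chat (yo Star) (yo (Pl n))"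
  by (rule yo_gen_in[OF edge_Gd])

text \<open>Rigidity of players: by Yoneda such a map is an arrow between players of the base
  category, and the only ones are identities.\<close>

lemma yo_hom_Pl:
  assumes "\<alpha> \<in> hom Chat (yo (Pl m)) (yo (Pl n) :: 'u::infinite psh)"
  shows "m = n" "\<alpha> = Ide Chat (yo (Pl n))"
proof -
  have "ev \<alpha> (Pl m) \<in> FO (yo (Pl n)) (Pl m)" using ev_in[OF assms] by simp
  then show m: "m = n" by (auto simp: FO_yo_Pl split: if_splits)
  have "ev \<beta> (Pl n) = uel (Pl n)" if "\<beta> \<in> hom Chat (yo (Pl n)) (yo (Pl n) :: 'u psh)" for \<beta>
    using ev_in[OF that] by (simp add: FO_yo_Pl)
  then show "\<alpha> = Ide Chat (yo (Pl n))"
    using assms m Chat.ide[OF yo_in[of "Pl n"]] by (intro yo_eqI[of _ "Pl n"]) auto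
qed

text \<open>An isomorphism and its inverse give paths in both directions, which the rank forbids
  between different objects.\<close>

lemma yo_iso_eq:
  assumes "is_iso Chat \<alpha>" "\<alpha> \<in> hom Chat (yo a) (yo b :: 'u::infinite psh)" "a \<in> bobjs" "b \<in> bobjs"
  shows "a = b"
proof -
  obtain \<beta> where "\<beta> \<in> hom Chat (yo b) (yo a :: 'u psh)" by (rule Chat.is_isoE[OF assms(1,2)])
  from ev_in[OF this assms(4)] ev_in[OF assms(2,3)]
  obtain p q where "bpath b p a" "bpath a q b" using assms by (auto simp: FO_yo hom_Base)
  then show ?thesis using bpath_rank[of b p a] bpath_rank[of a q b] by auto
qed

subsection \<open>Copowers of the channel\<close>

lemma copower_map:
  assumes I: "is_copower_star n I \<iota>" and X: "X \<in> Ob Chat"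
      and r: "\<And>i. i \<in> {1..n} \<Longrightarrow> r i \<in> hom Chat (yo Star) X"
  obtains a where "a \<in> hom Chat I X" "\<And>i. i \<in> {1..n} \<Longrightarrow> a \<odot> \<iota> i = r i"
proof -
  have "is_cocone Chat {1..n} (\<lambda>_. yo Star) {} X r" using X r by (auto simp: is_cocone_def)
  then have "\<exists>m. m \<in> hom Chat I X \<and> (\<forall>j\<in>{1..n}. m \<odot> \<iota> j = r j)"
    using I unfolding is_copower_star_def is_colimit_def by blast
  then show ?thesis using that by blast
qed

lemma copower_eqI:
  assumes I: "is_copower_star n I \<iota>" and a: "a \<in> hom Chat I X" and b: "b \<in> hom Chat I X"
    and e: "\<And>i. i \<in> {1..n} \<Longrightarrow> a \<odot> \<iota> i = b \<odot> \<iota> i"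
  shows "a = b"
proof -
  have \<iota>: "\<iota> i \<in> hom Chat (yo Star) I" if "i \<in> {1..n}" for i
    using I that by (auto simp: is_copower_star_def is_colimit_def is_cocone_def)
  have "is_cocone Chat {1..n} (\<lambda>_. yo Star) {} X (\<lambda>i. a \<odot> \<iota> i)"
    using Chat.hom_Ob[OF a] Chat.cmp[OF \<iota> a] by (auto simp: is_cocone_def)
  then have "\<exists>!m. m \<in> hom Chat I X \<and> (\<forall>j\<in>{1..n}. m \<odot> \<iota> j = a \<odot> \<iota> j)"
    using I unfolding is_copower_star_def is_colimit_def by blast
  then show ?thesis using a b e by (metis (no_types, lifting))
qed

lemma copower_in: "is_copower_star n I \<iota> \<Longrightarrow> i \<in> {1..n} \<Longrightarrow> \<iota> i \<in> hom Chat (yo Star) I"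
  by (auto simp: is_copower_star_def is_colimit_def is_cocone_def)

lemma edge_not_Star: "edge a g b \<Longrightarrow> b \<noteq> Star"
  by (auto dest: edge_rank)

text \<open>The presheaf with \<open>n\<close> elements over \<open>Star\<close> and none elsewhere.
  No generator ends at \<open>Star\<close>, so the identity action prescribed here is never applied
  to an element.\<close>

lemma copower_exists: "\<exists>I \<iota>. is_copower_star n (I :: 'u::infinite psh) \<iota> \<and> is_position I"
proof -
  define S where "S c = (if c = Star then {1..n} else {})" for c
  interpret gen_action S "\<lambda>_ k. k"
  proof
    fix u v a b x assume "brel u v" "bpath a u b" "x \<in> S b"
    then show "pact (\<lambda>_ k. k) u x = pact (\<lambda>_ k. k) v x"
      by (induction rule: brel.induct) (auto simp: pact_def)
  qed (auto simp: S_def dest: edge_not_Star)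
  let ?I = "natpsh S (\<lambda>_ k. k) :: 'u psh"
  have FO: "FO ?I c = nm ` S c" if "c \<in> bobjs" for c using FO_natpsh[OF that] .
  let ?\<iota> = "\<lambda>i. el Star ?I (nm i)"
  have \<iota>: "?\<iota> i \<in> hom Chat (yo Star) ?I" "ev (?\<iota> i) Star = nm i" if "i \<in> {1..n}" for i
    using that FO[of Star] natpsh_in by (auto intro!: el_in ev_el simp: S_def)
  have "is_copower_star n ?I ?\<iota>"
    unfolding is_copower_star_def is_colimit_def
  proof (intro conjI allI impI)
    show "is_cocone Chat {1..n} (\<lambda>_. yo Star) {} ?I ?\<iota>" using \<iota> natpsh_in by (auto simp: is_cocone_def)
    fix Q :: "'u psh" and r assume "is_cocone Chat {1..n} (\<lambda>_. yo Star) {} Q r"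
    then have Q: "Q \<in> Ob Chat" and r: "\<And>i. i \<in> {1..n} \<Longrightarrow> r i \<in> hom Chat (yo Star) Q"
      by (auto simp: is_cocone_def)
    let ?m = "mk_nat Base ?I (\<lambda>c x. ev (r (inv nm x)) Star) Q"
    have m: "?m \<in> hom Chat ?I Q"
      by (rule chat_nat_in) (use natpsh_in Q ev_in[OF r] edge_not_Star edge_bobjs in
          \<open>auto simp: FO S_def split: if_splits\<close>)
    have e: "ev (f \<odot> ?\<iota> i) Star = app f Star (nm i)" if "i \<in> {1..n}" for f i
      using ev_Cmp[OF \<iota>(1)[OF that], of f] \<iota>(2)[OF that] by simp
    show "\<exists>!m. m \<in> hom Chat ?I Q \<and> (\<forall>j\<in>{1..n}. m \<odot> ?\<iota> j = r j)"
    proof (rule ex1I[of _ ?m], intro conjI ballI m)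
      fix i assume i: "i \<in> {1..n}"
      show "?m \<odot> ?\<iota> i = r i"
        using i e[OF i, of ?m] Chat.cmp[OF \<iota>(1)[OF i] m] r[OF i]
        by (intro yo_eqI[of _ Star Q]) (auto simp: FO S_def)
    next
      fix m' assume m': "m' \<in> hom Chat ?I Q \<and> (\<forall>j\<in>{1..n}. m' \<odot> ?\<iota> j = r j)"
      show "m' = ?m"
      proof (rule chat_eqI[OF conjunct1[OF m'] m])
        fix c and x :: 'u assume "c \<in> bobjs" "x \<in> FO ?I c"
        then obtain i where i: "c = Star" "x = nm i" "i \<in> {1..n}"
            by (auto simp: FO S_def split: if_splits)
        then show "app m' c x = app ?m c x"
          using e[OF i(3), of m'] m' by (auto simp: FO S_def)
      qed
    qed
  qed (auto simp: yo_in)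
  moreover have "is_position ?I"
  proof -
    have "(SIGMA c : Ob Base. FO ?I c) \<subseteq> {Star} \<times> nm ` {1..n}" by (auto simp: FO S_def split: if_splits)
    then have "finite (SIGMA c : Ob Base. FO ?I c)" by (rule finite_subset) simp
    then show ?thesis using natpsh_in by (auto simp: is_position_def FO S_def)
  qed
  ultimately show ?thesis by blast
qed

subsection \<open>Extended basic moves from a single player\<close>

text \<open>The identity and \<open>g\<close> form a cocone, which yields a retraction
  \<open>m\<close> of \<open>p\<close>. The composite of \<open>m\<close> followed by
  \<open>p\<close> fixes both legs of the pushout, hence is the identity by uniqueness.\<close>

lemma (in category) pushout_split_iso:
  assumes po: "is_pushout C f z p q" and g: "g \<in> hom C (Cod C z) (Cod C f)"
    and gz: "Cmp C g z = f" and pg: "Cmp C p g = q"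
  shows "is_iso C p"
proof -
  have sq: "f \<in> Arr C" "z \<in> Arr C" "p \<in> Arr C" "q \<in> Arr C" "Dom C f = Dom C z" "Dom C p = Cod C f"
    "Dom C q = Cod C z" "Cod C p = Cod C q" "Cmp C p f = Cmp C q z"
    using po by (auto simp: is_pushout_def comm_square_def)
  let ?a = "Cod C f" and ?b = "Cod C p"
  have p: "p \<in> hom C ?a ?b" and q: "q \<in> hom C (Cod C z) ?b" and f: "f \<in> hom C (Dom C f) ?a"
    and z: "z \<in> hom C (Dom C f) (Cod C z)" using sq by (auto simp: hom_def)
  have I: "Ide C ?a \<in> hom C ?a ?a" using ide dom_cod sq by blast
  have J: "Ide C ?b \<in> hom C ?b ?b" using ide dom_cod sq by blast
  have "comm_square C f z (Ide C ?a) g"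
    using sq g gz I ide_left[OF f] by (auto simp: comm_square_def hom_def)
  then obtain m where "m \<in> hom C ?b (Cod C (Ide C ?a))" "Cmp C m p = Ide C ?a" "Cmp C m q = g"
    using po unfolding is_pushout_def by blast
  then have m: "m \<in> hom C ?b ?a" "Cmp C m p = Ide C ?a" "Cmp C m q = g" using I by (auto simp: hom_def)
  have "comm_square C f z p q" using po by (simp add: is_pushout_def)
  then have uniq: "\<exists>!k. k \<in> hom C ?b ?b \<and> Cmp C k p = p \<and> Cmp C k q = q"
    using po by (simp add: is_pushout_def)
  have "Cmp C p m \<in> hom C ?b ?b" using cmp[OF m(1) p] .
  moreover have "Cmp C (Cmp C p m) p = p" using assoc[OF p m(1) p] m(2) ide_right[OF p] by simp
  moreover have "Cmp C (Cmp C p m) q = q" using assoc[OF q m(1) p] m(3) pg by simp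
  ultimately have "Cmp C p m = Ide C ?b" using uniq J ide_left[OF p] ide_left[OF q] by blast
  then show ?thesis using is_isoI[OF p m(1,2)] by simp
qed

text \<open>In this presheaf the channels of every player are the element \<open>0\<close>, so that a map into it
  may take any value on a channel that belongs to no player, and any constant value on the
  non-channels. Such maps detect which elements of a presheaf lie in the image of a given map.\<close>

definition two_psh :: "'u::infinite psh" where
  "two_psh = natpsh (\<lambda>_. {0, 1}) (\<lambda>g k. if gsrc g = Star then 0 else k)"

definition two_map :: "'u psh \<Rightarrow> (bobj \<Rightarrow> 'u \<Rightarrow> bool) \<Rightarrow> 'u::infinite parr" where
  "two_map X \<phi> = mk_nat Base X (\<lambda>c x. nm (if \<phi> c x then 1 else 0)) two_psh"

lemma two_action: "gen_action (\<lambda>_. {0, 1}) (\<lambda>g k. if gsrc g = Star then 0 else k)"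
proof
  fix u v a b and x :: nat assume "brel u v"
  then show "pact (\<lambda>g k. if gsrc g = Star then 0 else k) u x =
      pact (\<lambda>g k. if gsrc g = Star then 0 else k) v x"
    by (induction rule: brel.induct) (auto simp: pact_def)
qed auto

text \<open>The two conditions are naturality into \<open>two_psh\<close>: the generators out of
  \<open>Star\<close> act there as the constant \<open>0\<close>, all others as the
  identity.\<close>

lemma two_map_in:
  fixes X :: "'u::infinite psh"
  assumes X: "X \<in> Ob Chat"
    and "\<And>g b x. edge Star g b \<Longrightarrow> x \<in> FO X b \<Longrightarrow> \<not> \<phi> Star (gact X g x)"
    and "\<And>a g b x. edge a g b \<Longrightarrow> a \<noteq> Star \<Longrightarrow> x \<in> FO X b \<Longrightarrow> \<phi> a (gact X g x) = \<phi> b x"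
  shows "two_map X \<phi> \<in> hom Chat X two_psh"
proof -
  interpret gen_action "\<lambda>_. {0, 1}" "\<lambda>g k. if gsrc g = Star then 0 else k" by (rule two_action)
  show ?thesis
    unfolding two_map_def
  proof (rule chat_nat_in[OF X])
    show "two_psh \<in> Ob Chat" using natpsh_in by (simp add: two_psh_def)
  next
    fix a g b x assume e: "edge a g b" and x: "x \<in> FO X b"
    have "gact two_psh g (nm k :: 'u) = nm (if gsrc g = Star then 0 else k)" if "k \<in> {0, 1}" for k
      unfolding two_psh_def using gact_natpsh[OF e that] .
    moreover have "a = gsrc g" using edge_gsrc[OF e] by simp
    ultimately show "nm (if \<phi> a (gact X g x) then 1 else 0) =
        (gact two_psh g (nm (if \<phi> b x then 1 else 0)) :: 'u)"
      using assms(2)[of g b x] assms(3)[of a g b x] e x by (cases "a = Star") auto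
  next
    fix c x assume "c \<in> bobjs"
    then show "nm (if \<phi> c x then 1 else 0) \<in> FO (two_psh :: 'u psh) c"
      unfolding two_psh_def by (subst FO_natpsh) auto
  qed
qed

lemma app_two_map: "c \<in> bobjs \<Longrightarrow> x \<in> FO X c \<Longrightarrow> app (two_map X \<phi>) c x = nm (if \<phi> c x then 1 else 0)"
  by (simp add: two_map_def)


lemma pushoutD:
  assumes "is_pushout Chat f z p q"
  shows "f \<in> hom Chat (src f) (tgt f)" "z \<in> hom Chat (src f) (tgt z)"
    "p \<in> hom Chat (tgt f) (tgt p)" "q \<in> hom Chat (tgt z) (tgt p)" "p \<odot> f = q \<odot> z"
  using assms by (auto simp: is_pushout_def comm_square_def hom_def)

lemma pushout_map:
  assumes po: "is_pushout Chat f z p q" and p': "p' \<in> hom Chat (tgt f) Q"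
      and q': "q' \<in> hom Chat (tgt z) Q"
    and e: "p' \<odot> f = q' \<odot> z"
  obtains m where "m \<in> hom Chat (tgt p) Q" "m \<odot> p = p'" "m \<odot> q = q'"
proof -
  have "comm_square Chat f z p' q'" using po p' q' e
      by (auto simp: is_pushout_def comm_square_def hom_def)
  then have "\<exists>m. m \<in> hom Chat (Cod Chat p) (Cod Chat p') \<and> m \<odot> p = p' \<and> m \<odot> q = q'"
    using po unfolding is_pushout_def by blast
  then show ?thesis using that p' by (auto simp: hom_def)
qed

lemma basic_cospan_hom:
  assumes "st_obj c n n'"
  shows "fst (basic_cospan c n n') \<in> hom Chat (yo (Pl n)) (yo c :: 'u::infinite psh)"
    "snd (basic_cospan c n n') \<in> hom Chat (yo (Pl n')) (yo c :: 'u::infinite psh)"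
  using yo_gen_in[OF edge.intros(2)[OF assms]] yo_gen_in[OF edge.intros(3)[OF assms]]
  by (auto simp: basic_cospan_def)

text \<open>Since the initial position is a player, rigidity makes \<open>x\<close> invertible, and
  then \<open>w\<close> maps \<open>Z\<close> back to the initial position of \<open>M\<close>. This
  already splits the pushout giving \<open>u\<close>. Splitting the one giving \<open>y\<close>
  takes a map from \<open>Z\<close> to the final position, and to define it the elements of
  \<open>Z\<close> must be known.\<close>

lemma extended_basic_move_iso:
  fixes N :: "'u::infinite cospan"
  assumes ext: "extended basic_move N" and \<xi>: "is_iso Chat \<xi>" "\<xi> \<in> hom Chat (yo (Pl n)) (src (fst N))"
  shows "\<exists>c n' u y. st_obj c n n' \<and> cospan_iso_by \<xi> u y (basic_cospan c n n') N"
proof -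
  obtain M a b z x zx u zu y zy where N: "is_cospan N" and bm: "basic_move M a b"
    and z: "z \<in> hom Chat (src a) (tgt z)"
    and px: "is_pushout Chat a z x zx" and tx: "tgt x = src (fst N)"
    and pu: "is_pushout Chat (fst M \<odot> a) z u zu" and tu: "tgt u = tgt (fst N)"
    and py: "is_pushout Chat b z y zy" and ty: "tgt y = src (snd N)"
    and eqs: "fst N \<odot> x = u \<odot> fst M" "fst N \<odot> zx = zu" "snd N \<odot> y = u \<odot> snd M" "snd N \<odot> zy = zu"
    using ext unfolding extended_def by blast
  obtain c m n' x0 u0 y0 I \<iota> where st: "st_obj c m n'"
      and ci: "cospan_iso_by x0 u0 y0 (basic_cospan c m n') M"
    and I: "is_copower_star m I \<iota>" and a: "a \<in> hom Chat I (src (fst M))"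
        and b: "b \<in> hom Chat I (src (snd M))"
    and ab: "\<And>i. i \<in> {1..m} \<Longrightarrow> a \<odot> \<iota> i = x0 \<odot> yd m i \<and> b \<odot> \<iota> i = y0 \<odot> yd n' i"
    using bm unfolding basic_move_def by blast
  define Mx where "Mx = src (fst M)"
  define Mu where "Mu = tgt (fst M)"
  define My where "My = src (snd M)"
  define Z where "Z = tgt z"
  note bc = basic_cospan_hom[OF st, where 'u = 'u]
  have M: "fst M \<in> hom Chat Mx Mu" "snd M \<in> hom Chat My Mu"
    using ci Chat_Arr[of "fst M"] Chat_Arr[of "snd M"]
    by (auto simp: cospan_iso_by_def is_cospan_def Mx_def Mu_def My_def)
  have x0: "is_iso Chat x0" "x0 \<in> hom Chat (yo (Pl m)) Mx"
    and u0: "is_iso Chat u0" "u0 \<in> hom Chat (yo c) Mu"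
    and y0: "is_iso Chat y0" "y0 \<in> hom Chat (yo (Pl n')) My"
    using ci Chat_hom[OF bc(1)] Chat_hom[OF bc(2)] Chat_Arr[of x0] Chat_Arr[of u0] Chat_Arr[of y0]
    by (auto simp: cospan_iso_by_def is_iso_def Mx_def Mu_def My_def)
  have sq0: "fst M \<odot> x0 = u0 \<odot> fst (basic_cospan c m n')" "snd M \<odot> y0 = u0 \<odot> snd (basic_cospan c m n')"
    using ci by (auto simp: cospan_iso_by_def)
  have a: "a \<in> hom Chat I Mx" and b: "b \<in> hom Chat I My" using a b by (auto simp: Mx_def My_def)
  have z: "z \<in> hom Chat I Z" using z Chat_hom[OF a] by (simp add: Z_def)
  have Nh: "fst N \<in> hom Chat (src (fst N)) (tgt (fst N))" "snd N \<in> hom Chat (src (snd N)) (tgt (fst N))"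
    using N Chat_Arr[of "fst N"] Chat_Arr[of "snd N"] by (auto simp: is_cospan_def)
  have Ma: "fst M \<odot> a \<in> hom Chat I Mu" using Chat.cmp[OF a M(1)] .
  have x: "x \<in> hom Chat Mx (src (fst N))" and zx: "zx \<in> hom Chat Z (src (fst N))"
      and xa: "x \<odot> a = zx \<odot> z"
    using pushoutD[OF px] Chat_hom[OF a] tx by (auto simp: Z_def)
  have u: "u \<in> hom Chat Mu (tgt (fst N))" and zu: "zu \<in> hom Chat Z (tgt (fst N))"
    using pushoutD[OF pu] Chat_hom[OF Ma] tu by (auto simp: Z_def)
  have y: "y \<in> hom Chat My (src (snd N))" and zy: "zy \<in> hom Chat Z (src (snd N))"
      and yb: "y \<odot> b = zy \<odot> z"
    using pushoutD[OF py] Chat_hom[OF b] ty by (auto simp: Z_def)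
  have \<iota>: "\<iota> i \<in> hom Chat (yo Star) I" if "i \<in> {1..m}" for i using copower_in[OF I that] .

  obtain \<xi>' where \<xi>': "\<xi>' \<in> hom Chat (src (fst N)) (yo (Pl n))" "\<xi>' \<odot> \<xi> = Ide Chat (yo (Pl n))"
    "\<xi> \<odot> \<xi>' = Ide Chat (src (fst N))" by (rule Chat.is_isoE[OF \<xi>])
  obtain x0' where x0': "x0' \<in> hom Chat Mx (yo (Pl m))" "x0' \<odot> x0 = Ide Chat (yo (Pl m))"
    "x0 \<odot> x0' = Ide Chat Mx" "is_iso Chat x0'" by (rule Chat.is_isoE[OF x0])
  have xx0: "x \<odot> x0 \<in> hom Chat (yo (Pl m)) (src (fst N))" using Chat.cmp[OF x0(2) x] .
  \<comment> \<open>Composed with the inverse of \<open>\<xi>\<close>, the map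
    \<open>x \<odot> x0\<close> becomes a map between players; so the players are equal, the
    composite is the identity, and \<open>x \<odot> x0 = \<xi>\<close>.\<close>
  note triv = yo_hom_Pl[OF Chat.cmp[OF xx0 \<xi>'(1)]]
  have mn: "m = n" by (rule triv(1))
  have "\<xi> \<odot> (\<xi>' \<odot> (x \<odot> x0)) = \<xi>"
    using triv(2) Chat.ide_right[OF \<xi>(2)] by simp
  then have x_xi: "x \<odot> x0 = \<xi>"
    using Chat.assoc[OF xx0 \<xi>'(1) \<xi>(2)] \<xi>'(3) Chat.ide_left[OF xx0] by simp
  have "x = \<xi> \<odot> x0'"
    using x_xi Chat.assoc[OF x0'(1) x0(2) x] x0'(3) Chat.ide_right[OF x] by simp
  then have "is_iso Chat x" using Chat.is_iso_Cmp[OF x0'(4) \<xi>(1) x0'(1)] \<xi>(2) mn by simp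
  then obtain x' where x': "x' \<in> hom Chat (src (fst N)) Mx" "x' \<odot> x = Ide Chat Mx"
    "x \<odot> x' = Ide Chat (src (fst N))" by (rule Chat.is_isoE[OF _ x])
  \<comment> \<open>The inverse of \<open>x\<close> turns the leg out of \<open>Z\<close> into a map
    under the interface: \<open>w \<odot> z = a\<close>.\<close>
  define w where "w = x' \<odot> zx"
  have w: "w \<in> hom Chat Z Mx" unfolding w_def using Chat.cmp[OF zx x'(1)] .
  have xw: "x \<odot> w = zx"
    unfolding w_def using Chat.assoc[OF zx x'(1) x] x'(3) Chat.ide_left[OF zx] by simp
  have wz: "w \<odot> z = a"
    unfolding w_def using Chat.assoc[OF z zx x'(1)] xa Chat.assoc[OF a x x'(1)] x'(2)
        Chat.ide_left[OF a] by simp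
  \<comment> \<open>Since \<open>x\<close> is invertible, every map out of \<open>Z\<close> that agrees on the interface with a map out of the
     player is induced by the latter.\<close>
  have key: "g = f \<odot> w" if f: "f \<in> hom Chat Mx Q" and g: "g \<in> hom Chat Z Q" and fg: "f \<odot> a = g \<odot> z"
      for f g Q
  proof -
    have "f \<in> hom Chat (tgt a) Q" "g \<in> hom Chat (tgt z) Q" using f g Chat_hom[OF a] by (auto simp: Z_def)
    then obtain k where "k \<in> hom Chat (tgt x) Q" "k \<odot> x = f" "k \<odot> zx = g"
      using pushout_map[OF px _ _ fg] by metis
    then show ?thesis using Chat.assoc[OF w x, of k Q] xw tx by simp
  qed
  have Zob: "Z \<in> Ob Chat" and Mxob: "Mx \<in> Ob Chat" using Chat.hom_Ob[OF w] by auto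
  \<comment> \<open>The test map marking the elements that satisfy \<open>\<phi>\<close> agrees on
    the interface with the constant map \<open>0\<close> out of the player. By \<open>key\<close> it
    factors through the latter, so nothing is marked.\<close>
  have two: "\<not> \<phi> d p"
    if \<phi>: "\<And>g b x. edge Star g b \<Longrightarrow> x \<in> FO Z b \<Longrightarrow> \<not> \<phi> Star (gact Z g x)"
      "\<And>a g b x. edge a g b \<Longrightarrow> a \<noteq> Star \<Longrightarrow> x \<in> FO Z b \<Longrightarrow> \<phi> a (gact Z g x) = \<phi> b x"
      and i: "\<And>i. i \<in> {1..m} \<Longrightarrow> \<not> \<phi> Star (ev (z \<odot> \<iota> i) Star)"
      and p: "d \<in> bobjs" "p \<in> FO Z d" for \<phi> d p
  proof -
    let ?f = "two_map Mx (\<lambda>_ _. False)" and ?g = "two_map Z \<phi>"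
    have f: "?f \<in> hom Chat Mx two_psh" by (rule two_map_in[OF Mxob]) auto
    have g: "?g \<in> hom Chat Z two_psh" by (rule two_map_in[OF Zob]) (rule \<phi>, assumption+)+
    have "?f \<odot> a = ?g \<odot> z"
    proof (rule copower_eqI[OF I Chat.cmp[OF a f] Chat.cmp[OF z g]])
      fix k assume k: "k \<in> {1..m}"
      have ia: "a \<odot> \<iota> k \<in> hom Chat (yo Star) Mx" and iz: "z \<odot> \<iota> k \<in> hom Chat (yo Star) Z"
        using Chat.cmp[OF \<iota>[OF k] a] Chat.cmp[OF \<iota>[OF k] z] .
      have "?f \<odot> (a \<odot> \<iota> k) = ?g \<odot> (z \<odot> \<iota> k)"
        using i[OF k] ev_in[OF ia] ev_in[OF iz]
        by (intro yo_eqI[OF Chat.cmp[OF ia f] Chat.cmp[OF iz g]])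
          (simp add: ev_Cmp[OF ia] ev_Cmp[OF iz] app_two_map)
      then show "(?f \<odot> a) \<odot> \<iota> k = (?g \<odot> z) \<odot> \<iota> k"
        using Chat.assoc[OF \<iota>[OF k] a f] Chat.assoc[OF \<iota>[OF k] z g] by simp
    qed
    from key[OF f g this] have "app ?g d p = app (?f \<odot> w) d p" by simp
    then show ?thesis using p chat_app_in[OF w p]
        by (simp add: chat_app_Cmp[OF w p] app_two_map split: if_splits)
  qed
  \<comment> \<open>Here everything that is not a channel is marked.\<close>
  have Z_empty: "FO Z d = {}" if d: "d \<in> bobjs" "d \<noteq> Star" for d
    using two[of "\<lambda>d _. d \<noteq> Star" d] edge_not_Star d by auto
  \<comment> \<open>Here the channels outside the image of the interface are marked.\<close>
  have Z_star: "\<exists>i\<in>{1..m}. p = ev (z \<odot> \<iota> i) Star" if p: "p \<in> FO Z Star" for p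
    using two[of "\<lambda>d p. d = Star \<and> (\<forall>i\<in>{1..m}. p \<noteq> ev (z \<odot> \<iota> i) Star)" Star p] p Z_empty
        edge_not_Star edge_bobjs
    by fastforce
  have Z_eqI: "f = g" if f: "f \<in> hom Chat Z Q" and g: "g \<in> hom Chat Z Q" and e: "f \<odot> z = g \<odot> z" for f g Q
  proof (rule chat_eqI[OF f g])
    fix d p assume d: "d \<in> bobjs" and p: "p \<in> FO Z d"
    then have ds: "d = Star" using Z_empty by blast
    then obtain i where i: "i \<in> {1..m}" "p = ev (z \<odot> \<iota> i) Star" using Z_star p by blast
    have iz: "z \<odot> \<iota> i \<in> hom Chat (yo Star) Z" using Chat.cmp[OF \<iota>[OF i(1)] z] .
    have "f \<odot> (z \<odot> \<iota> i) = g \<odot> (z \<odot> \<iota> i)"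
      using Chat.assoc[OF \<iota>[OF i(1)] z f] Chat.assoc[OF \<iota>[OF i(1)] z g] e by simp
    then show "app f d p = app g d p" using ev_Cmp[OF iz, of f] ev_Cmp[OF iz, of g] i ds by simp
  qed

  have u_iso: "is_iso Chat u"
  proof (rule Chat.pushout_split_iso[OF pu])
    show "fst M \<odot> w \<in> hom Chat (Cod Chat z) (Cod Chat (fst M \<odot> a))"
      using Chat.cmp[OF w M(1)] Chat_hom[OF Ma] Chat_hom[OF z] by simp
    show "(fst M \<odot> w) \<odot> z = fst M \<odot> a" using Chat.assoc[OF z w M(1)] wz by simp
    show "u \<odot> (fst M \<odot> w) = zu"
      using Chat.assoc[OF w M(1) u] Chat.assoc[OF w x Nh(1)] eqs(1,2) xw by simp
  qed

  \<comment> \<open>Following \<open>w\<close> by the inverse of \<open>x0\<close> sends the image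
    of the \<open>i\<close>-th interface channel to the \<open>i\<close>-th channel of the player,
    and those are distinct.\<close>
  have z_inj: "i = j" if ij: "i \<in> {1..m}" "j \<in> {1..m}"
      and e: "ev (z \<odot> \<iota> i) Star = ev (z \<odot> \<iota> j) Star" for i j
  proof -
    have wi: "app (x0' \<odot> w) Star (ev (z \<odot> \<iota> i) Star) = ch m i" if i: "i \<in> {1..m}" for i
    proof -
      have iz: "z \<odot> \<iota> i \<in> hom Chat (yo Star) Z" using Chat.cmp[OF \<iota>[OF i] z] .
      note yd = yd_in[OF i, where 'a = 'u]
      have "(x0' \<odot> w) \<odot> (z \<odot> \<iota> i) = x0' \<odot> (a \<odot> \<iota> i)"
        using Chat.assoc[OF iz w x0'(1)] Chat.assoc[OF \<iota>[OF i] z w] wz by simp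
      also have "\<dots> = yd m i"
        using ab[OF i] Chat.assoc[OF yd x0(2) x0'(1)] x0'(2) Chat.ide_left[OF yd] by simp
      finally show ?thesis
        using ev_Cmp[OF iz, of "x0' \<odot> w"] yo_arr_in(2)[OF
            barrow_hom[OF bpath_edge[OF edge_Gd[OF i]]], where 'u = 'u] by simp
    qed
    show ?thesis using wi[OF ij(1)] wi[OF ij(2)] e ch_eq_iff[OF ij, where 'u = 'u] by simp
  qed
  \<comment> \<open>Each element of \<open>Z\<close> is the image of exactly one interface channel,
    so the map \<open>b\<close> can be transferred from the interface to \<open>Z\<close>.\<close>
  define g where "g = mk_nat Base Z (\<lambda>d p. ev (b \<odot> \<iota> (THE i. i \<in> {1..m} \<and> p = ev (z \<odot> \<iota> i) Star))
      Star) My"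
  have the: "(THE j. j \<in> {1..m} \<and> ev (z \<odot> \<iota> i) Star = ev (z \<odot> \<iota> j) Star) = i" if "i \<in> {1..m}" for i
    using that z_inj by (intro the_equality) auto
  have g: "g \<in> hom Chat Z My"
    unfolding g_def
  proof (rule chat_nat_in[OF Zob])
    show "My \<in> Ob Chat" using Chat.hom_Ob[OF b] by simp
  next
    fix d p assume d: "d \<in> bobjs" and p: "p \<in> FO Z d"
    then have ds: "d = Star" using Z_empty by blast
    then obtain i where i: "i \<in> {1..m}" "p = ev (z \<odot> \<iota> i) Star" using Z_star p by blast
    have "b \<odot> \<iota> i \<in> hom Chat (yo Star) My" using Chat.cmp[OF \<iota>[OF i(1)] b] .
    then show "ev (b \<odot> \<iota> (THE i. i \<in> {1..m} \<and> p = ev (z \<odot> \<iota> i) Star)) Star \<in> FO My d"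
      using the[OF i(1)] i(2) ds ev_in[of "b \<odot> \<iota> i" Star My] by simp
  next
    fix d q e p assume "edge d q e" "p \<in> FO Z e"
    then show "ev (b \<odot> \<iota> (THE i. i \<in> {1..m} \<and> gact Z q p = ev (z \<odot> \<iota> i) Star)) Star =
      gact My q (ev (b \<odot> \<iota> (THE i. i \<in> {1..m} \<and> p = ev (z \<odot> \<iota> i) Star)) Star)"
      using Z_empty[of e] edge_not_Star edge_bobjs by blast
  qed
  have gz: "g \<odot> z = b"
  proof (rule copower_eqI[OF I Chat.cmp[OF z g] b])
    fix i assume i: "i \<in> {1..m}"
    have iz: "z \<odot> \<iota> i \<in> hom Chat (yo Star) Z" using Chat.cmp[OF \<iota>[OF i] z] .
    have "g \<odot> (z \<odot> \<iota> i) = b \<odot> \<iota> i"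
    proof (rule yo_eqI[OF Chat.cmp[OF iz g] Chat.cmp[OF \<iota>[OF i] b]])
      show "ev (g \<odot> (z \<odot> \<iota> i)) Star = ev (b \<odot> \<iota> i) Star"
        unfolding ev_Cmp[OF iz bobjs_simps(1)] unfolding g_def
        using ev_in[OF iz] the[OF i] by simp
    qed
    then show "(g \<odot> z) \<odot> \<iota> i = b \<odot> \<iota> i" using Chat.assoc[OF \<iota>[OF i] z g] by simp
  qed
  have y_iso: "is_iso Chat y"
  proof (rule Chat.pushout_split_iso[OF py])
    show "g \<in> hom Chat (Cod Chat z) (Cod Chat b)" using g Chat_hom[OF b] Chat_hom[OF z] by simp
    show "g \<odot> z = b" by (rule gz)
    show "y \<odot> g = zy"
      using Z_eqI[OF Chat.cmp[OF g y] zy] Chat.assoc[OF z g y] gz yb by simp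
  qed
  have "cospan_iso_by \<xi> (u \<odot> u0) (y \<odot> y0) (basic_cospan c m n') N"
    unfolding cospan_iso_by_def
  proof (intro conjI)
    show "is_iso Chat (u \<odot> u0)" using Chat.is_iso_Cmp[OF u0(1) u_iso u0(2) u] .
    show "is_iso Chat (y \<odot> y0)" using Chat.is_iso_Cmp[OF y0(1) y_iso y0(2) y] .
    show "fst N \<odot> \<xi> = (u \<odot> u0) \<odot> fst (basic_cospan c m n')"
      using x_xi Chat.assoc[OF x0(2) x Nh(1)] Chat.assoc[OF x0(2) M(1) u] Chat.assoc[OF bc(1) u0(2) u]
        eqs(1) sq0(1) by simp
    show "snd N \<odot> (y \<odot> y0) = (u \<odot> u0) \<odot> snd (basic_cospan c m n')"
      using Chat.assoc[OF y0(2) y Nh(2)] Chat.assoc[OF y0(2) M(2) u] Chat.assoc[OF bc(2) u0(2) u]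
        eqs(3) sq0(2) by simp
    show "is_cospan (basic_cospan c m n' :: 'u cospan)" using Chat_hom[OF bc(1)] Chat_hom[OF bc(2)]
        by (simp add: is_cospan_def)
  qed (use N \<xi> Chat_hom[OF \<xi>(2)] Chat_hom[OF bc(1)] Chat_hom[OF bc(2)] mn
      Chat_hom[OF Chat.cmp[OF u0(2) u]] Chat_hom[OF Chat.cmp[OF y0(2) y]] in auto)
  then show ?thesis using st mn by blast
qed

section \<open>Views as words of moves\<close>

fun wt :: "nat \<Rightarrow> bobj list \<Rightarrow> bool" where
  "wt n [] \<longleftrightarrow> True"
| "wt n (c # cs) \<longleftrightarrow> st_obj c n (btgt c) \<and> wt (btgt c) cs"

text \<open>The number of channels known to the player after \<open>k\<close> moves.\<close>

definition lev :: "nat \<Rightarrow> bobj list \<Rightarrow> nat \<Rightarrow> nat" where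
  "lev n cs k = (if k = 0 then n else btgt (cs ! (k - 1)))"

lemma lev_0 [simp]: "lev n cs 0 = n" and lev_Suc [simp]: "lev n cs (Suc k) = btgt (cs ! k)"
  by (simp_all add: lev_def)

lemma wt_nth: "wt n cs \<Longrightarrow> k < length cs \<Longrightarrow> st_obj (cs ! k) (lev n cs k) (btgt (cs ! k))"
proof (induction cs arbitrary: n k)
  case (Cons c cs)
  show ?case
  proof (cases k)
    case (Suc l)
    have "lev n (c # cs) (Suc l) = lev (btgt c) cs l" by (cases l) auto
    then show ?thesis using Cons Suc by auto
  qed (use Cons in auto)
qed simp

lemma wtI: "(\<And>k. k < length cs \<Longrightarrow> st_obj (cs ! k) (lev n cs k) (btgt (cs ! k))) \<Longrightarrow> wt n cs"
proof (induction cs arbitrary: n)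
  case (Cons c cs)
  have "st_obj (cs ! k) (lev (btgt c) cs k) (btgt (cs ! k))" if "k < length cs" for k
    using Cons.prems[of "Suc k"] that by (cases k) auto
  then show ?case using Cons.prems[of 0] Cons.IH[of "btgt c"] by auto
qed simp

text \<open>Players never lose channels: \<open>Nu\<close> adds one and the other moves keep their
  number.\<close>

lemma lev_mono: "wt n cs \<Longrightarrow> k \<le> l \<Longrightarrow> l \<le> length cs \<Longrightarrow> lev n cs k \<le> lev n cs l"
proof (induction l)
  case (Suc l)
  have "lev n cs l \<le> lev n cs (Suc l)" using st_obj_le[OF wt_nth[OF Suc.prems(1), of l]] Suc.prems
      by simp
  then show ?case using Suc by (cases "k = Suc l") auto
qed simp

text \<open>A thread is the data of a map into \<open>X\<close> out of the view given by the word \<open>cs\<close>: the image \<open>x\<close> of the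
  initial player and the images \<open>e k\<close> of the moves. \<open>plr\<close> is the resulting sequence of players.\<close>

definition plr :: "'u psh \<Rightarrow> bobj list \<Rightarrow> 'u \<Rightarrow> (nat \<Rightarrow> 'u) \<Rightarrow> nat \<Rightarrow> 'u" where
  "plr X cs x e k = (if k = 0 then x else gact X (Gt (cs ! (k - 1))) (e (k - 1)))"

definition thread :: "'u psh \<Rightarrow> nat \<Rightarrow> bobj list \<Rightarrow> 'u \<Rightarrow> (nat \<Rightarrow> 'u) \<Rightarrow> bool" where
  "thread X n cs x e \<longleftrightarrow> x \<in> FO X (Pl n) \<and>
    (\<forall>k<length cs. e k \<in> FO X (cs ! k) \<and> gact X (Gs (cs ! k)) (e k) = plr X cs x e k)"

text \<open>\<open>V\<close> represents the functor sending a presheaf to its threads for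
  \<open>cs\<close>, and \<open>(x, e)\<close> is the universal thread. Later players and all
  channels are determined by these data; values of \<open>e\<close> beyond the length of the word
  carry no meaning.\<close>

definition univ :: "'u psh \<Rightarrow> nat \<Rightarrow> bobj list \<Rightarrow> 'u \<Rightarrow> (nat \<Rightarrow> 'u::infinite) \<Rightarrow> bool" where
  "univ V n cs x e \<longleftrightarrow> V \<in> Ob Chat \<and> wt n cs \<and> thread V n cs x e \<and>
    (\<forall>Q x' e'. Q \<in> Ob Chat \<longrightarrow> thread Q n cs x' e' \<longrightarrow>
      (\<exists>m\<in>hom Chat V Q. app m (Pl n) x = x' \<and> (\<forall>k<length cs. app m (cs ! k) (e k) = e' k))) \<and>
    (\<forall>Q. \<forall>m\<in>hom Chat V Q. \<forall>m'\<in>hom Chat V Q. app m (Pl n) x = app m' (Pl n) x \<longrightarrow>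
      (\<forall>k<length cs. app m (cs ! k) (e k) = app m' (cs ! k) (e k)) \<longrightarrow> m = m')"

lemma plr_0 [simp]: "plr X cs x e 0 = x"
  and plr_Suc [simp]: "plr X cs x e (Suc k) = gact X (Gt (cs ! k)) (e k)"
  by (simp_all add: plr_def)

lemma edge_Gs: "wt n cs \<Longrightarrow> k < length cs \<Longrightarrow> edge (Pl (lev n cs k)) (Gs (cs ! k)) (cs ! k)"
  by (rule edge.intros(2)[OF wt_nth])

lemma edge_Gt: "wt n cs \<Longrightarrow> k < length cs \<Longrightarrow> edge (Pl (lev n cs (Suc k))) (Gt (cs ! k)) (cs ! k)"
  using edge.intros(3)[OF wt_nth] by simp

lemma wt_bobjs: "wt n cs \<Longrightarrow> k < length cs \<Longrightarrow> cs ! k \<in> bobjs"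
  by (rule st_obj_bobjs[OF wt_nth])

lemma plr_in:
  assumes "X \<in> Ob Chat" "wt n cs" "thread X n cs x e" "k \<le> length cs"
  shows "plr X cs x e k \<in> FO X (Pl (lev n cs k))"
proof (cases k)
  case (Suc l)
  then show ?thesis using assms gact_in[OF assms(1) edge_Gt[OF assms(2)]] by (auto simp: thread_def)
qed (use assms in \<open>auto simp: thread_def\<close>)

lemma app_plr:
  assumes "m \<in> hom Chat X Y" "wt n cs" "thread X n cs x e" "k \<le> length cs"
  shows "app m (Pl (lev n cs k)) (plr X cs x e k) =
    plr Y cs (app m (Pl n) x) (\<lambda>k. app m (cs ! k) (e k)) k"
proof (cases k)
  case (Suc l)
  then show ?thesis using assms app_gact[OF assms(1) edge_Gt[OF assms(2)]] by (auto simp: thread_def)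
qed simp

lemma thread_map:
  assumes m: "m \<in> hom Chat X Y" and wt: "wt n cs" and t: "thread X n cs x e"
  shows "thread Y n cs (app m (Pl n) x) (\<lambda>k. app m (cs ! k) (e k))"
  unfolding thread_def
proof (intro conjI allI impI)
  show "app m (Pl n) x \<in> FO Y (Pl n)" using chat_app_in[OF m] t by (auto simp: thread_def)
  fix k assume k: "k < length cs"
  have e: "e k \<in> FO X (cs ! k)" "gact X (Gs (cs ! k)) (e k) = plr X cs x e k"
    using t k by (auto simp: thread_def)
  show "app m (cs ! k) (e k) \<in> FO Y (cs ! k)" using chat_app_in[OF m wt_bobjs[OF wt k] e(1)] .
  show "gact Y (Gs (cs ! k)) (app m (cs ! k) (e k)) =
      plr Y cs (app m (Pl n) x) (\<lambda>k. app m (cs ! k) (e k)) k"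
    using app_gact[OF m edge_Gs[OF wt k] e(1)] e(2) app_plr[OF m wt t, of k] k by simp
qed

lemma thread_prefix:
  assumes "thread X n cs' x e" "prefix cs cs'"
  shows "thread X n cs x e"
proof -
  have nth: "cs' ! k = cs ! k \<and> k < length cs'" if "k < length cs" for k
    using assms(2) that by (auto simp: prefix_def nth_append)
  moreover have "plr X cs' x e k = plr X cs x e k" if "k < length cs" for k
    using that nth by (cases k) auto
  ultimately show ?thesis using assms(1) unfolding thread_def by metis
qed

lemma gact_d_s_t:
  assumes X: "X \<in> Ob Chat" and st: "st_obj c n n'" and i: "i \<in> {1..n}" and x: "x \<in> FO X c"
  shows "gact X (Gd n i) (gact X (Gs c) x) = gact X (Gd n' i) (gact X (Gt c) x)"
proof -
  have i': "i \<in> {1..n'}" using i st_obj_le[OF st] by auto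
  have c: "c \<in> bobjs" using st_obj_bobjs[OF st] .
  have 1: "bpath Star [Gd n i, Gs c] c" and 2: "bpath Star [Gd n' i, Gt c] c"
    using edge_Gd[OF i] edge_Gd[OF i'] edge.intros(2,3)[OF st] c by (auto simp: bpath_Cons)
  have "bcong [Gd n i, Gs c] [Gd n' i, Gt c]"
      using bcong_rel[OF brel.intros(1)[OF st i], of "[]" "[]"] by simp
  then have "barrow Star [Gd n i, Gs c] c = barrow Star [Gd n' i, Gt c] c" by (simp add: barrow_eq_iff)
  then have "act X (barrow Star [Gd n i, Gs c] c) x = act X (barrow Star [Gd n' i, Gt c] c) x" by simp
  then show ?thesis
    using act_Cons[OF X 1 x] act_Cons[OF X 2 x]
    by (simp add: act_edge[OF edge.intros(2)[OF st]] act_edge[OF edge.intros(3)[OF st]])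
qed

text \<open>Iterating \<open>s \<circ> d_i = t \<circ> d_i\<close> along the thread: a channel known
  at one stage is the same channel at all later stages. Hence the last player knows every
  channel.\<close>

lemma thread_channels:
  assumes X: "X \<in> Ob Chat" and wt: "wt n cs" and t: "thread X n cs x e"
    and k: "k \<le> l" "l \<le> length cs" and i: "i \<in> {1..lev n cs k}"
  shows "gact X (Gd (lev n cs k) i) (plr X cs x e k) = gact X (Gd (lev n cs l) i) (plr X cs x e l)"
  using k
proof (induction l)
  case (Suc l)
  show ?case
  proof (cases "k = Suc l")
    case False
    then have kl: "k \<le> l" "l \<le> length cs" and l: "l < length cs" using Suc.prems by auto
    have i': "i \<in> {1..lev n cs l}" using i lev_mono[OF wt kl] by auto
    have e: "e l \<in> FO X (cs ! l)" "gact X (Gs (cs ! l)) (e l) = plr X cs x e l"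
      using t l by (auto simp: thread_def)
    show ?thesis using Suc.IH[OF kl] gact_d_s_t[OF X wt_nth[OF wt l] i' e(1)] e(2) by simp
  qed simp
qed simp

subsection \<open>The explicit view of a word\<close>

text \<open>Players and moves are numbered by their position in the word, with one player more than
  moves. Channels persist, so they are those of the last player.\<close>

fun wsets :: "nat \<Rightarrow> bobj list \<Rightarrow> bobj \<Rightarrow> nat set" where
  "wsets n cs Star = {1..lev n cs (length cs)}"
| "wsets n cs (Pl m) = {k. k \<le> length cs \<and> lev n cs k = m}"
| "wsets n cs c = {k. k < length cs \<and> cs ! k = c}"

text \<open>Move number \<open>k\<close> leads from player \<open>k\<close> to player
  \<open>Suc k\<close>, and every player calls its \<open>i\<close>-th channel
  \<open>i\<close>.\<close>

fun wgen :: "gen \<Rightarrow> nat \<Rightarrow> nat" where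
  "wgen (Gd n i) k = i" | "wgen (Gt c) k = Suc k" | "wgen _ k = k"

lemma wsets_move: "brank c \<ge> 2 \<Longrightarrow> wsets n cs c = {k. k < length cs \<and> cs ! k = c}"
  by (cases c) auto

lemma wt_action:
  assumes wt: "wt n cs"
  shows "gen_action (wsets n cs) wgen"
proof
  have no: "k \<notin> wsets n cs c" if "brank c = 3" for k c
    using that st_obj_rank[OF wt_nth[OF wt, of k]] by (auto simp: wsets_move)
  show "wgen g x \<in> wsets n cs a" if "edge a g b" "x \<in> wsets n cs b" for a g b x
    using that
  proof (induction rule: edge.induct)
    case (1 i m)
    then show ?case using lev_mono[OF wt, of x "length cs"] by auto
  next
    case (2 c m m')
    then have "x < length cs" "cs ! x = c" using st_obj_rank[OF 2(1)] by (auto simp: wsets_move)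
    then show ?case using st_obj_bsrc[OF 2(1)] st_obj_bsrc[OF wt_nth[OF wt, of x]] by auto
  next
    case (3 c m m')
    then have "x < length cs" "cs ! x = c" using st_obj_rank[OF 3(1)] by (auto simp: wsets_move)
    then show ?case using st_obj_bsrc[OF 3(1)] by auto
  qed (use st_obj_rank[OF wt_nth[OF wt, of x]] in auto)
  show "pact wgen u x = pact wgen v x" if "brel u v" "bpath a u b" "x \<in> wsets n cs b" for u v a b x
    using that
  proof (induction rule: brel.induct)
    \<comment> \<open>The two sides would evaluate to \<open>i\<close> and to \<open>j\<close>. The
      relation holds vacuously: letters have rank 2, so nothing lies over an object
      \<open>Tau\<close> of rank 3.\<close>
    case (3 i n' j m)
    then have "b = Tau n' i m j" using bpath_bobjs by (auto simp: bpath_Cons)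
    then show ?case using 3 no[of b x] by simp
  qed (auto simp: pact_def)
qed

definition wview :: "nat \<Rightarrow> bobj list \<Rightarrow> 'u::infinite psh" where
  "wview n cs = natpsh (wsets n cs) wgen"

lemma wview_in: "wt n cs \<Longrightarrow> wview n cs \<in> Ob Chat"
  unfolding wview_def by (rule gen_action.natpsh_in[OF wt_action])

lemma FO_wview: "wt n cs \<Longrightarrow> c \<in> bobjs \<Longrightarrow> FO (wview n cs) c = nm ` wsets n cs c"
  unfolding wview_def by (rule gen_action.FO_natpsh[OF wt_action])

lemma gact_wview: "wt n cs \<Longrightarrow> edge a g b \<Longrightarrow> k \<in> wsets n cs b \<Longrightarrow>
    gact (wview n cs) g (nm k) = nm (wgen g k)"
  unfolding wview_def by (rule gen_action.gact_natpsh[OF wt_action])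

lemma wsets_nth: "wt n cs \<Longrightarrow> k < length cs \<Longrightarrow> k \<in> wsets n cs (cs ! k)"
  using st_obj_rank[OF wt_nth[of n cs k]] by (simp add: wsets_move)

lemma gact_wview_Gs: "wt n cs \<Longrightarrow> k < length cs \<Longrightarrow> gact (wview n cs) (Gs (cs ! k)) (nm k) = nm k"
  using gact_wview[OF _ edge_Gs wsets_nth] by simp

lemma gact_wview_Gt: "wt n cs \<Longrightarrow> k < length cs \<Longrightarrow> gact (wview n cs) (Gt (cs ! k)) (nm k) = nm (Suc k)"
  using gact_wview[OF _ edge_Gt wsets_nth] by simp

lemma plr_wview: "wt n cs \<Longrightarrow> k \<le> length cs \<Longrightarrow> plr (wview n cs) cs (nm 0) nm k = nm k"
  by (cases k) (auto simp: gact_wview_Gt)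

lemma thread_wview: "wt n cs \<Longrightarrow> thread (wview n cs) n cs (nm 0) nm"
  by (auto simp: thread_def FO_wview wt_bobjs wsets_nth gact_wview_Gs plr_wview)

lemma wsets_Pl_or_move:
  assumes "c \<in> bobjs" "c \<noteq> Star" "k \<in> wsets n cs c"
  shows "k \<le> length cs \<and> c = Pl (lev n cs k) \<or> k < length cs \<and> c = cs ! k"
  using assms by (cases c) auto

text \<open>A thread prescribes the images of the moves and hence of the players; a channel is read
  off the last player. Conversely every element arises from the universal thread by acting with
  generators, which gives uniqueness.\<close>

lemma univ_wview:
  assumes wt: "wt n cs"
  shows "univ (wview n cs :: 'u::infinite psh) n cs (nm 0) nm"
  unfolding univ_def
proof (intro conjI allI impI ballI wview_in wt thread_wview)
  let ?N = "length cs" and ?W = "wview n cs :: 'u psh"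
  fix Q :: "'u psh" and x' e' assume Q: "Q \<in> Ob Chat" and t: "thread Q n cs x' e'"
  let ?p = "plr Q cs x' e'"
  define h where "h c x = (let k = inv nm x in case c of Star \<Rightarrow> gact Q (Gd (lev n cs ?N) k) (?p ?N)
    | Pl m \<Rightarrow> ?p k | _ \<Rightarrow> e' k)" for c and x :: 'u
  have h_Star: "h Star (nm k) = gact Q (Gd (lev n cs ?N) k) (?p ?N)" for k by (simp add: h_def)
  have h_Pl: "h (Pl m) (nm k) = ?p k" for m k by (simp add: h_def)
  have h_move: "h c (nm k) = e' k" if "brank c \<ge> 2" for c k using that by (cases c) (auto simp: h_def)
  have rk: "brank (cs ! k) = 2" if "k < ?N" for k using st_obj_rank[OF wt_nth[OF wt that]] .
  have m: "mk_nat Base ?W h Q \<in> hom Chat ?W Q"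
  proof (rule chat_nat_in[OF wview_in[OF wt] Q])
    fix c x assume c: "c \<in> bobjs" and "x \<in> FO ?W c"
    then obtain k where k: "x = nm k" "k \<in> wsets n cs c" by (auto simp: FO_wview[OF wt])
    show "h c x \<in> FO Q c"
    proof (cases "c = Star")
      case True
      then show ?thesis using k h_Star gact_in[OF Q edge_Gd plr_in[OF Q wt t]] by auto
    next
      case False
      from wsets_Pl_or_move[OF c False k(2)] show ?thesis
      proof
        assume "k \<le> ?N \<and> c = Pl (lev n cs k)"
        then show ?thesis using k h_Pl plr_in[OF Q wt t, of k] by simp
      next
        assume "k < ?N \<and> c = cs ! k"
        then show ?thesis using k h_move rk t by (auto simp: thread_def)
      qed
    qed
  next
    fix a g b x assume e: "edge a g b" and "x \<in> FO ?W b"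
    then obtain k where k: "x = nm k" "k \<in> wsets n cs b" using edge_bobjs by (auto simp: FO_wview[OF wt])
    have "h a (nm (wgen g k)) = gact Q g (h b (nm k))"
      using e k(2)
    proof (induction rule: edge.induct)
      \<comment> \<open>Channels were defined through the last player; that an earlier player sees
        the same channel is the persistence of channels.\<close>
      case (1 i m)
      then show ?case using thread_channels[OF Q wt t, of k ?N i] by (auto simp: h_Star h_Pl)
    next
      case (2 c m m')
      then have "k < ?N" "cs ! k = c" using st_obj_rank[OF 2(1)] by (auto simp: wsets_move)
      then show ?case using h_Pl h_move st_obj_rank[OF 2(1)] t by (auto simp: thread_def)
    next
      case (3 c m m')
      then have "k < ?N" "cs ! k = c" using st_obj_rank[OF 3(1)] by (auto simp: wsets_move)
      then show ?case using h_Pl h_move st_obj_rank[OF 3(1)] by auto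
    qed (use rk in fastforce)+
    then show "h a (gact ?W g x) = gact Q g (h b x)" by (simp add: k(1) gact_wview[OF wt e k(2)])
  qed
  show "\<exists>m\<in>hom Chat ?W Q. app m (Pl n) (nm 0) = x' \<and> (\<forall>k<length cs. app m (cs ! k) (nm k) = e' k)"
  proof (intro bexI[OF _ m] conjI allI impI)
    show "app (mk_nat Base ?W h Q) (Pl n) (nm 0) = x'"
      using h_Pl[of n 0] by (simp add: FO_wview[OF wt])
    fix k assume k: "k < length cs"
    show "app (mk_nat Base ?W h Q) (cs ! k) (nm k) = e' k"
      using h_move[of "cs ! k" k] rk[OF k] wt_bobjs[OF wt k] wsets_nth[OF wt k]
          by (simp add: FO_wview[OF wt])
  qed
next
  let ?N = "length cs" and ?W = "wview n cs :: 'u psh"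
  fix Q :: "'u psh" and m m' assume m: "m \<in> hom Chat ?W Q" "m' \<in> hom Chat ?W Q"
    and x: "app m (Pl n) (nm 0) = app m' (Pl n) (nm 0)"
    and e: "\<forall>k<length cs. app m (cs ! k) (nm k) = app m' (cs ! k) (nm k)"
  have pl: "app m (Pl (lev n cs k)) (nm k) = app m' (Pl (lev n cs k)) (nm k)" if k: "k \<le> ?N" for k
  proof -
    have "plr Q cs (app m (Pl n) (nm 0)) (\<lambda>k. app m (cs ! k) (nm k)) k =
        plr Q cs (app m' (Pl n) (nm 0)) (\<lambda>k. app m' (cs ! k) (nm k)) k"
      using k x e by (cases k) auto
    then show ?thesis
      using app_plr[OF m(1) wt thread_wview[OF wt] k] app_plr[OF m(2) wt thread_wview[OF wt] k]
      by (simp add: plr_wview[OF wt k])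
  qed
  show "m = m'"
  proof (rule chat_eqI[OF m])
    fix c x assume c: "c \<in> bobjs" and "x \<in> FO ?W c"
    then obtain k where k: "x = nm k" "k \<in> wsets n cs c" by (auto simp: FO_wview[OF wt])
    show "app m c x = app m' c x"
    proof (cases "c = Star")
      case True
      then have ki: "k \<in> {1..lev n cs ?N}" using k by simp
      have N: "?N \<in> wsets n cs (Pl (lev n cs ?N))" by simp
      have Nin: "nm ?N \<in> FO ?W (Pl (lev n cs ?N))" using N by (simp add: FO_wview[OF wt])
      have "gact ?W (Gd (lev n cs ?N) k) (nm ?N) = nm k" using gact_wview[OF wt edge_Gd[OF ki] N] by simp
      then show ?thesis
        using app_gact[OF m(1) edge_Gd[OF ki] Nin] app_gact[OF m(2) edge_Gd[OF ki] Nin] pl[of ?N]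
            k(1) True by simp
    next
      case False
      from wsets_Pl_or_move[OF c False k(2)] show ?thesis using pl e k(1) by auto
    qed
  qed
qed

subsection \<open>Maps between views\<close>

text \<open>Only move \<open>k\<close> starts at player \<open>k\<close>, so a thread beginning at
  player \<open>0\<close> has no choice but to follow the word \<open>cs'\<close>.\<close>

lemma thread_into_wview:
  assumes wt: "wt n cs" "wt n cs'" and t: "thread (wview n cs') n cs (nm 0 :: 'u::infinite) e"
  shows "prefix cs cs'" "k < length cs \<Longrightarrow> e k = nm k"
proof -
  let ?W = "wview n cs' :: 'u psh"
  have *: "e k = nm k \<and> k < length cs' \<and> cs ! k = cs' ! k" if "k < length cs" for k
    using that
  proof (induction k)
    case 0
    have "e 0 \<in> FO ?W (cs ! 0)" using t 0 by (auto simp: thread_def)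
    then obtain j where j: "e 0 = nm j" "j \<in> wsets n cs' (cs ! 0)"
      using FO_wview[OF wt(2) wt_bobjs[OF wt(1) 0]] by auto
    have "gact ?W (Gs (cs ! 0)) (e 0) = nm 0" using t 0 by (auto simp: thread_def)
    then have "j = 0" using gact_wview[OF wt(2) edge_Gs[OF wt(1) 0] j(2), where 'a = 'u] j(1) by simp
    then show ?case using j st_obj_rank[OF wt_nth[OF wt(1) 0]] by (simp add: wsets_move)
  next
    case (Suc k)
    then have IH: "e k = nm k" "k < length cs'" "cs ! k = cs' ! k" and k: "Suc k < length cs" by auto
    have "e (Suc k) \<in> FO ?W (cs ! Suc k)" using t k by (auto simp: thread_def)
    then obtain j where j: "e (Suc k) = nm j" "j \<in> wsets n cs' (cs ! Suc k)"
      using FO_wview[OF wt(2) wt_bobjs[OF wt(1) k]] by auto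
    have "gact ?W (Gs (cs ! Suc k)) (e (Suc k)) = gact ?W (Gt (cs ! k)) (e k)" using t k
        by (auto simp: thread_def)
    then have "nm j = (nm (Suc k) :: 'u)"
      using gact_wview[OF wt(2) edge_Gs[OF wt(1) k] j(2), where 'a = 'u] j(1) IH
          gact_wview_Gt[OF wt(2) IH(2), where 'a = 'u] by simp
    then have "j = Suc k" by simp
    then show ?case using j st_obj_rank[OF wt_nth[OF wt(1) k]] by (simp add: wsets_move)
  qed
  show "e k = nm k" if "k < length cs" using *[OF that] by simp
  have "length cs \<le> length cs'"
  proof (cases "length cs")
    case (Suc l) then show ?thesis using *[of l] by simp
  qed simp
  then have "take (length cs) cs' = cs" using * by (intro nth_equalityI) auto
  then show "prefix cs cs'" by (metis take_is_prefix)
qed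

lemma univ_to_wview:
  assumes "univ V n cs x e"
  obtains m where "m \<in> hom Chat V (wview n cs)" "app m (Pl n) x = nm 0"
      "\<And>k. k < length cs \<Longrightarrow> app m (cs ! k) (e k) = nm k"
  using assms wview_in thread_wview unfolding univ_def by metis

text \<open>\<open>V\<close> and \<open>wview\<close> represent the same functor. The canonical map
  back, composed with \<open>m\<close>, fixes the universal thread of \<open>V\<close> and is
  therefore the identity.\<close>

lemma univ_inj_wview:
  assumes V: "univ (V :: 'u::infinite psh) n cs x e"
    and m: "m \<in> hom Chat V (wview n cs)" "app m (Pl n) x = nm 0"
        "\<And>k. k < length cs \<Longrightarrow> app m (cs ! k) (e k) = nm k"
    and c: "c \<in> bobjs" "y \<in> FO V c" "y' \<in> FO V c" "app m c y = app m c y'"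
  shows "y = y'"
proof -
  have Vo: "V \<in> Ob Chat" and wt: "wt n cs" and t: "thread V n cs x e" using V by (auto simp: univ_def)
  obtain r where r: "r \<in> hom Chat (wview n cs) V" "app r (Pl n) (nm 0) = x"
      "\<forall>k<length cs. app r (cs ! k) (nm k) = e k"
    using univ_wview[OF wt, where 'u = 'u] Vo t unfolding univ_def by meson
  have xin: "x \<in> FO V (Pl n)" "\<And>k. k < length cs \<Longrightarrow> e k \<in> FO V (cs ! k)" using t
      by (auto simp: thread_def)
  have rm: "r \<odot> m \<in> hom Chat V V" using Chat.cmp[OF m(1) r(1)] .
  have I: "Ide Chat V \<in> hom Chat V V" using Chat.ide[OF Vo] .
  have "r \<odot> m = Ide Chat V"
  proof -
    have "app (r \<odot> m) (Pl n) x = app (Ide Chat V) (Pl n) x"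
      using m r xin by (simp add: chat_app_Cmp[OF m(1)] chat_app_Ide)
    moreover have "\<forall>k<length cs. app (r \<odot> m) (cs ! k) (e k) = app (Ide Chat V) (cs ! k) (e k)"
      using m r xin wt_bobjs[OF wt] by (simp add: chat_app_Cmp[OF m(1)] chat_app_Ide)
    ultimately show ?thesis using V rm I unfolding univ_def by meson
  qed
  then show ?thesis
    using c chat_app_Cmp[OF m(1) c(1,2), of r] chat_app_Cmp[OF m(1) c(1,3), of r]
    by (simp add: chat_app_Ide)
qed

text \<open>A map sends the universal thread to a thread in \<open>V'\<close>, which is tested in
  \<open>wview n cs'\<close>. Conversely, cutting the universal thread of \<open>V'\<close> at a
  prefix yields a thread, hence a map.\<close>

lemma univ_hom_iff_prefix:
  assumes V: "univ (V :: 'u::infinite psh) n cs x e" and V': "univ V' n cs' x' e'"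
  shows "(\<exists>m\<in>hom Chat V V'. app m (Pl n) x = x') \<longleftrightarrow> prefix cs cs'"
proof
  have t: "wt n cs" "thread V n cs x e" and t': "V' \<in> Ob Chat" "wt n cs'" "thread V' n cs' x' e'"
    using V V' by (auto simp: univ_def)
  {
    assume "\<exists>m\<in>hom Chat V V'. app m (Pl n) x = x'"
    then obtain m where m: "m \<in> hom Chat V V'" "app m (Pl n) x = x'" by blast
    obtain r where r: "r \<in> hom Chat V' (wview n cs')" "app r (Pl n) x' = nm 0"
        using univ_to_wview[OF V'] by blast
    have "thread (wview n cs') n cs (nm 0) (\<lambda>k. app (r \<odot> m) (cs ! k) (e k))"
      using thread_map[OF Chat.cmp[OF m(1) r(1)] t] t(2) m(2) r(2)
      by (simp add: chat_app_Cmp[OF m(1)] thread_def)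
    then show "prefix cs cs'" by (rule thread_into_wview(1)[OF t(1) t'(2)])
  next
    assume "prefix cs cs'"
    then have "thread V' n cs x' e'" by (rule thread_prefix[OF t'(3)])
    then show "\<exists>m\<in>hom Chat V V'. app m (Pl n) x = x'" using V t'(1) unfolding univ_def by meson
  }
qed

text \<open>After passing to \<open>wview n cs'\<close> the images of the moves are forced, and the
  passage is injective.\<close>

lemma univ_hom_unique:
  assumes V: "univ (V :: 'u::infinite psh) n cs x e" and V': "univ V' n cs' x' e'"
    and m: "m \<in> hom Chat V V'" "app m (Pl n) x = x'" and m': "m' \<in> hom Chat V V'" "app m' (Pl n) x = x'"
  shows "m = m'"
proof -
  have t: "wt n cs" "thread V n cs x e" and t': "V' \<in> Ob Chat" "wt n cs'" "thread V' n cs' x' e'"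
    using V V' by (auto simp: univ_def)
  have xin: "x \<in> FO V (Pl n)" "\<And>k. k < length cs \<Longrightarrow> e k \<in> FO V (cs ! k)" using t
      by (auto simp: thread_def)
  obtain r where r: "r \<in> hom Chat V' (wview n cs')" "app r (Pl n) x' = nm 0"
    "\<And>k. k < length cs' \<Longrightarrow> app r (cs' ! k) (e' k) = nm k" using univ_to_wview[OF V'] by blast
  have a: "app r (cs ! k) (app f (cs ! k) (e k)) = nm k"
    if k: "k < length cs" and f: "f \<in> hom Chat V V'" "app f (Pl n) x = x'" for k f
  proof -
    have "thread (wview n cs') n cs (nm 0) (\<lambda>k. app (r \<odot> f) (cs ! k) (e k))"
      using thread_map[OF Chat.cmp[OF f(1) r(1)] t] xin f(2) r(2) by (simp add: chat_app_Cmp[OF f(1)])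
    from thread_into_wview(2)[OF t(1) t'(2) this k] show ?thesis
      using wt_bobjs[OF t(1) k] xin(2)[OF k] by (simp add: chat_app_Cmp[OF f(1)])
  qed
  have "app m (cs ! k) (e k) = app m' (cs ! k) (e k)" if k: "k < length cs" for k
  proof (rule univ_inj_wview[OF V' r])
    show "cs ! k \<in> bobjs" using wt_bobjs[OF t(1) k] .
    then show "app m (cs ! k) (e k) \<in> FO V' (cs ! k)" "app m' (cs ! k) (e k) \<in> FO V' (cs ! k)"
      using chat_app_in[OF m(1)] chat_app_in[OF m'(1)] xin(2)[OF k] by auto
    show "app r (cs ! k) (app m (cs ! k) (e k)) = app r (cs ! k) (app m' (cs ! k) (e k))"
      using a[OF k m] a[OF k m'] by simp
  qed
  then show ?thesis using V m m' unfolding univ_def by metis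
qed

lemma univ_word_unique: "univ V n cs x e \<Longrightarrow> univ V n cs' x e' \<Longrightarrow> cs = cs'"
proof -
  assume u: "univ V n cs x e" "univ V n cs' x e'"
  have "Ide Chat V \<in> hom Chat V V" "app (Ide Chat V) (Pl n) x = x"
    using u Chat.ide[of V] by (auto simp: univ_def thread_def chat_app_Ide)
  then have "prefix cs cs'" "prefix cs' cs"
    using univ_hom_iff_prefix[OF u] univ_hom_iff_prefix[OF u(2,1)] by blast+
  then show ?thesis by (rule prefix_order.antisym)
qed

subsection \<open>Every word is a view\<close>

lemma (in category) pushout_Ide:
  assumes f: "f \<in> hom C a b"
  shows "is_pushout C f (Ide C a) (Ide C b) f"
proof -
  have ob: "a \<in> Ob C" "b \<in> Ob C" using hom_Ob[OF f] by auto
  note I = homD[OF ide[OF ob(1)]] homD[OF ide[OF ob(2)]] homD[OF f]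
  have "\<exists>!m. m \<in> hom C (Cod C (Ide C b)) (Cod C p) \<and> Cmp C m (Ide C b) = p \<and> Cmp C m f = q"
    if "comm_square C f (Ide C a) p q" for p q
  proof -
    have p: "p \<in> hom C b (Cod C p)" and q: "q \<in> hom C a (Cod C p)" and e: "Cmp C p f = Cmp C q (Ide C a)"
      using that I by (auto simp: comm_square_def hom_def)
    have "Cmp C p f = q" using e ide_right[OF q] by simp
    then have "p \<in> hom C (Cod C (Ide C b)) (Cod C p) \<and> Cmp C p (Ide C b) = p \<and> Cmp C p f = q"
      using p I(2) ide_right[OF p] by simp
    then show ?thesis
    proof (rule ex1I)
      fix m assume m: "m \<in> hom C (Cod C (Ide C b)) (Cod C p) \<and> Cmp C m (Ide C b) = p \<and> Cmp C m f = q"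
      then have "m \<in> hom C b (Cod C p)" using I(2) by simp
      then show "m = p" using m ide_right[of m b "Cod C p"] by simp
    qed
  qed
  moreover have "comm_square C f (Ide C a) (Ide C b) f"
    using I ide_left[OF f] ide_right[OF f] by (auto simp: comm_square_def)
  ultimately show ?thesis by (simp add: is_pushout_def)
qed

lemma gact_uel: "edge a g b \<Longrightarrow> gact (yo b) g (uel b) = enc (barrow a [g] b)"
  using act_yo[OF barrow_hom[OF bpath_edge] barrow_hom[of b "[]" b]] edge_bobjs
  by (auto simp: act_edge[symmetric])

lemma cospan_iso_by_basic_refl:
  assumes "st_obj c n n'"
  shows "cospan_iso_by (Ide Chat (yo (Pl n))) (Ide Chat (yo c)) (Ide Chat (yo (Pl n')))
    (basic_cospan c n n') (basic_cospan c n n' :: 'u::infinite cospan)"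
proof -
  note bc = basic_cospan_hom[OF assms, where 'u = 'u]
  have I: "Ide Chat (yo d :: 'u psh) \<in> hom Chat (yo d) (yo d)"
      "is_iso Chat (Ide Chat (yo d :: 'u psh))" for d
    using Chat.ide[OF yo_in] Chat.is_iso_Ide[OF yo_in] by auto
  show ?thesis
    using Chat_hom[OF bc(1)] Chat_hom[OF bc(2)] I(2) Chat_hom[OF I(1)] Chat.ide_left[OF bc(1)]
        Chat.ide_right[OF bc(1)]
      Chat.ide_left[OF bc(2)] Chat.ide_right[OF bc(2)]
    by (auto simp: cospan_iso_by_def is_cospan_def)
qed

text \<open>The two inclusions of the interface agree inside the move because
  \<open>s \<circ> d_i = t \<circ> d_i\<close>; this is what makes an extension of the move
  possible.\<close>

lemma basic_cospan_move:
  assumes st: "st_obj c n n'"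
  obtains a b I where "basic_move (basic_cospan c n n' :: 'u::infinite cospan) a b" "is_position I"
    "a \<in> hom Chat I (yo (Pl n))" "b \<in> hom Chat I (yo (Pl n'))"
    "fst (basic_cospan c n n') \<odot> a = snd (basic_cospan c n n') \<odot> b"
proof -
  note bc = basic_cospan_hom[OF st, where 'u = 'u]
  obtain I :: "'u psh" and \<iota> where I: "is_copower_star n I \<iota>" "is_position I" using copower_exists
      by blast
  have le: "i \<in> {1..n'}" if "i \<in> {1..n}" for i using that st_obj_le[OF st] by auto
  obtain a where a: "a \<in> hom Chat I (yo (Pl n))" "\<And>i. i \<in> {1..n} \<Longrightarrow> a \<odot> \<iota> i = yd n i"
    using copower_map[OF I(1) yo_in, where r = "yd n"] yd_in[of _ n, where 'a = 'u] by metis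
  obtain b where b: "b \<in> hom Chat I (yo (Pl n'))" "\<And>i. i \<in> {1..n} \<Longrightarrow> b \<odot> \<iota> i = yd n' i"
    using copower_map[OF I(1) yo_in, where r = "yd n'"] yd_in[OF le, where 'a = 'u] by metis
  have src: "src (fst (basic_cospan c n n' :: 'u cospan)) = yo (Pl n)"
      "src (snd (basic_cospan c n n' :: 'u cospan)) = yo (Pl n')"
    using Chat_hom[OF bc(1)] Chat_hom[OF bc(2)] by auto
  have id: "Ide Chat (yo (Pl m)) \<odot> yd m i = (yd m i :: 'u parr)" if "i \<in> {1..m}" for m i
    using Chat.ide_left[OF yd_in[OF that]] .
  have "basic_move (basic_cospan c n n') a b"
    unfolding basic_move_def
    using st cospan_iso_by_basic_refl[OF st, where 'u = 'u] I(1) a b src id id[OF le]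
    by (intro exI[of _ c] exI[of _ n] exI[of _ n'] exI[of _ "Ide Chat (yo (Pl n))"]
        exI[of _ "Ide Chat (yo c)"]
        exI[of _ "Ide Chat (yo (Pl n'))"] exI[of _ I] exI[of _ \<iota>]) auto
  moreover have "fst (basic_cospan c n n') \<odot> a = snd (basic_cospan c n n') \<odot> b"
  proof (rule copower_eqI[OF I(1) Chat.cmp[OF a(1) bc(1)] Chat.cmp[OF b(1) bc(2)]])
    fix i assume i: "i \<in> {1..n}"
    note y = yd_in[OF i, where 'a = 'u] yd_in[OF le[OF i], where 'a = 'u]
    have c: "c \<in> bobjs" using st_obj_bobjs[OF st] .
    have e: "ev (fst (basic_cospan c n n')) (Pl n) = gact (yo c) (Gs c) (uel c :: 'u)"
      "ev (snd (basic_cospan c n n')) (Pl n') = gact (yo c) (Gt c) (uel c :: 'u)"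
      unfolding basic_cospan_def
      using yo_arr_in(2)[OF barrow_hom[OF bpath_edge[OF edge.intros(2)[OF st]]], where 'u = 'u]
          gact_uel[OF edge.intros(2)[OF st], where 'a = 'u]
        yo_arr_in(2)[OF barrow_hom[OF bpath_edge[OF edge.intros(3)[OF st]]], where 'u = 'u]
            gact_uel[OF edge.intros(3)[OF st], where 'a = 'u]
      by auto
    have "fst (basic_cospan c n n') \<odot> yd n i = snd (basic_cospan c n n') \<odot> (yd n' i :: 'u parr)"
    proof (rule yo_eqI[OF Chat.cmp[OF y(1) bc(1)] Chat.cmp[OF y(2) bc(2)]])
      show "ev (fst (basic_cospan c n n') \<odot> yd n i) Star =
          ev (snd (basic_cospan c n n') \<odot> (yd n' i :: 'u parr)) Star"
        unfolding ev_yo_gen[OF edge_Gd[OF i] bc(1)] ev_yo_gen[OF edge_Gd[OF le[OF i]] bc(2)] e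
        by (rule gact_d_s_t[OF yo_in st i uel_in[OF c]])
    qed
    then show "(fst (basic_cospan c n n') \<odot> a) \<odot> \<iota> i = (snd (basic_cospan c n n') \<odot> b) \<odot> \<iota> i"
      using Chat.assoc[OF copower_in[OF I(1) i] a(1) bc(1)]
          Chat.assoc[OF copower_in[OF I(1) i] b(1) bc(2)]
        a(2)[OF i] b(2)[OF i] by simp
  qed
  ultimately show ?thesis using that I a(1) b(1) by blast
qed

text \<open>A basic move is its own extension, along the identity of its interface.\<close>

lemma extended_basic_cospan:
  assumes st: "st_obj c n n'"
  shows "extended basic_move (basic_cospan c n n' :: 'u::infinite cospan)"
proof -
  let ?M = "basic_cospan c n n' :: 'u cospan"
  note bc = basic_cospan_hom[OF st, where 'u = 'u]
  obtain a b I where m: "basic_move ?M a b" "is_position I" and a: "a \<in> hom Chat I (yo (Pl n))"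
    and b: "b \<in> hom Chat I (yo (Pl n'))" and e: "fst ?M \<odot> a = snd ?M \<odot> b"
        by (rule basic_cospan_move[OF st])
  have I: "I \<in> Ob Chat" using Chat.hom_Ob[OF a] by simp
  note z = Chat_hom[OF Chat.ide[OF I]]
  have tg: "tgt (Ide Chat (yo d :: 'u psh)) = yo d" for d using Chat_hom[OF Chat.ide[OF yo_in]] by blast
  show ?thesis
    unfolding extended_def
  proof (intro conjI exI)
    show "is_cospan ?M" using cospan_iso_by_basic_refl[OF st, where 'u = 'u]
        by (simp add: cospan_iso_by_def)
    show "basic_move ?M a b" by fact
    show "Ide Chat I \<in> hom Chat (src a) (tgt (Ide Chat I))" using Chat.ide[OF I] z Chat_hom[OF a] by simp
    show "is_position (tgt (Ide Chat I))" using m z by simp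
    show "is_pushout Chat a (Ide Chat I) (Ide Chat (yo (Pl n))) a" by (rule Chat.pushout_Ide[OF a])
    show "is_pushout Chat (fst ?M \<odot> a) (Ide Chat I) (Ide Chat (yo c)) (fst ?M \<odot> a)"
      by (rule Chat.pushout_Ide[OF Chat.cmp[OF a bc(1)]])
    show "is_pushout Chat b (Ide Chat I) (Ide Chat (yo (Pl n'))) b" by (rule Chat.pushout_Ide[OF b])
    show "tgt (Ide Chat (yo (Pl n))) = src (fst ?M)" "tgt (Ide Chat (yo c)) = tgt (fst ?M)"
      "tgt (Ide Chat (yo (Pl n'))) = src (snd ?M)"
      using tg Chat_hom[OF bc(1)] Chat_hom[OF bc(2)] by auto
    show "fst ?M \<odot> Ide Chat (yo (Pl n)) = Ide Chat (yo c) \<odot> fst ?M"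
        "snd ?M \<odot> Ide Chat (yo (Pl n')) = Ide Chat (yo c) \<odot> snd ?M"
      using Chat.ide_left[OF bc(1)] Chat.ide_right[OF bc(1)] Chat.ide_left[OF bc(2)]
          Chat.ide_right[OF bc(2)] by auto
    show "fst ?M \<odot> a = fst ?M \<odot> a" "snd ?M \<odot> b = fst ?M \<odot> a" using e by auto
  qed
qed

lemma position_Pl: "is_position (yo (Pl n) :: 'a::infinite psh)"
proof -
  have "FO (yo (Pl n) :: 'a psh) c = {}" if "c \<in> Ob Base - ({Star} \<union> range Pl)" for c
    using that by (intro FO_yo_Pl_other) auto
  moreover
  have "(SIGMA c : Ob Base. FO (yo (Pl n) :: 'a psh) c) \<subseteq> {Star} \<times> ch n ` {1..n} \<union> {(Pl n, uel (Pl n))}"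
  proof
    fix z assume "z \<in> (SIGMA c : Ob Base. FO (yo (Pl n) :: 'a psh) c)"
    then obtain c x where z: "z = (c, x)" "c \<in> bobjs" "x \<in> FO (yo (Pl n)) c" by auto
    consider "c = Star" | "c = Pl n" | "c \<noteq> Star" "c \<noteq> Pl n" by blast
    then show "z \<in> {Star} \<times> ch n ` {1..n} \<union> {(Pl n, uel (Pl n))}"
      using z by cases (auto simp: FO_yo_Pl_Star FO_yo_Pl FO_yo_Pl_other)
  qed
  then have "finite (SIGMA c : Ob Base. FO (yo (Pl n) :: 'a psh) c)" by (rule finite_subset) auto
  ultimately show ?thesis using yo_in[of "Pl n", where 'a = 'a] unfolding is_position_def by blast
qed

lemma Chat_mono:
  assumes i: "i \<in> hom Chat X Y" and inj: "\<And>c. c \<in> bobjs \<Longrightarrow> inj_on (app i c) (FO X c)"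
  shows "is_mono Chat i"
  unfolding is_mono_def
proof (intro conjI allI ballI impI)
  show "i \<in> Arr Chat" using Chat_hom[OF i] by simp
  fix a f g assume f: "f \<in> hom Chat a (Dom Chat i)" and g: "g \<in> hom Chat a (Dom Chat i)"
      and e: "i \<odot> f = i \<odot> g"
  have f: "f \<in> hom Chat a X" and g: "g \<in> hom Chat a X" using f g Chat_hom[OF i] by auto
  show "f = g"
  proof (rule chat_eqI[OF f g])
    fix c x assume c: "c \<in> bobjs" and x: "x \<in> FO a c"
    have "app i c (app f c x) = app i c (app g c x)"
      using chat_app_Cmp[OF f c x, of i] chat_app_Cmp[OF g c x, of i] e by simp
    then show "app f c x = app g c x"
      using inj_onD[OF inj[OF c]] chat_app_in[OF f c x] chat_app_in[OF g c x] by blast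
  qed
qed

text \<open>For the zigzag of the basic cospans of the letters, a cocone is by Yoneda the same as a
  thread in its apex. So the presheaf representing threads is the colimit.\<close>

lemma word_is_view:
  assumes wt: "wt n cs"
  defines "i \<equiv> el (Pl n) (wview n cs :: 'u::infinite psh) (nm 0)"
  shows "is_view i" "src i = yo (Pl n)" "univ (tgt i) n cs (ev i (Pl n)) nm"
proof -
  let ?W = "wview n cs :: 'u psh" and ?N = "length cs"
  note W = wview_in[OF wt, where 'a = 'u] and U = univ_wview[OF wt, where 'u = 'u]
  have zero: "nm 0 \<in> FO ?W (Pl n)" by (simp add: FO_wview[OF wt])
  have i: "i \<in> hom Chat (yo (Pl n)) ?W" "ev i (Pl n) = nm 0"
    unfolding i_def using el_in[OF W zero] ev_el[OF W _ zero] by auto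
  show src: "src i = yo (Pl n)" and "univ (tgt i) n cs (ev i (Pl n)) nm"
      using Chat_hom[OF i(1)] i(2) U by auto
  \<comment> \<open>The player has one element over itself, and its \<open>k\<close>-th channel goes
    to the channel numbered \<open>k\<close>; so the map is pointwise injective.\<close>
  have mono: "is_mono Chat i"
  proof (rule Chat_mono[OF i(1)])
    fix c assume c: "c \<in> bobjs"
    consider "c = Star" | "c = Pl n" | "c \<noteq> Star" "c \<noteq> Pl n" by blast
    then show "inj_on (app i c) (FO (yo (Pl n)) c)"
    proof cases
      case 1
      have "app i Star (ch n k) = nm k" if "k \<in> {1..n}" for k
        using app_ch[OF i(1) that] i(2) gact_wview[OF wt edge_Gd[OF that], of 0, where 'a = 'u] by simp
      then show ?thesis using 1 by (auto simp: FO_yo_Pl_Star inj_on_def)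
    qed (use c in \<open>auto simp: FO_yo_Pl FO_yo_Pl_other\<close>)
  qed
  define X where "X k = (yo (Pl (lev n cs k)) :: 'u psh)" for k
  define M where "M k = (basic_cospan (cs ! k) (lev n cs k) (lev n cs (Suc k)) :: 'u cospan)" for k
  define q where "q = case_sum (\<lambda>k. el (Pl (lev n cs k)) ?W (nm k)) (\<lambda>k. el (cs ! k) ?W (nm k))"
  have st: "st_obj (cs ! k) (lev n cs k) (lev n cs (Suc k))" if "k < ?N" for k
      using wt_nth[OF wt that] by simp
  note bobj = wt_bobjs[OF wt]
  have Mh: "fst (M k) \<in> hom Chat (X k) (yo (cs ! k))"
      "snd (M k) \<in> hom Chat (X (Suc k)) (yo (cs ! k))" if "k < ?N" for k
    using basic_cospan_hom[OF st[OF that], where 'u = 'u] by (auto simp: M_def X_def)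
  have p_in: "nm k \<in> FO ?W (Pl (lev n cs k))" if "k \<le> ?N" for k using that by (simp add: FO_wview[OF wt])
  have e_in: "nm k \<in> FO ?W (cs ! k)" if "k < ?N" for k
      using thread_wview[OF wt, where 'a = 'u] that by (auto simp: thread_def)
  have ql: "q (Inl k) \<in> hom Chat (X k) ?W" "ev (q (Inl k)) (Pl (lev n cs k)) = nm k" if "k \<le> ?N" for k
    using el_in[OF W p_in[OF that]] ev_el[OF W _ p_in[OF that]] by (auto simp: q_def X_def)
  have qr: "q (Inr k) \<in> hom Chat (yo (cs ! k)) ?W" "ev (q (Inr k)) (cs ! k) = nm k" if "k < ?N" for k
    using el_in[OF W e_in[OF that]] ev_el[OF W bobj[OF that] e_in[OF that]] by (auto simp: q_def)
  have evs: "ev (r \<odot> fst (M k)) (Pl (lev n cs k)) = gact Q (Gs (cs ! k)) (ev r (cs ! k))"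
    "ev (r \<odot> snd (M k)) (Pl (lev n cs (Suc k))) = gact Q (Gt (cs ! k)) (ev r (cs ! k))"
    if "k < ?N" "r \<in> hom Chat (yo (cs ! k)) Q" for k r Q
    using ev_yo_gen[OF edge_Gs[OF wt that(1)] that(2)] ev_yo_gen[OF edge_Gt[OF wt that(1)] that(2)]
    by (simp_all add: M_def basic_cospan_def)
  define J where "J = Inl ` {k. k \<le> ?N} \<union> (Inr ` {k. k < ?N} :: (nat + nat) set)"
  define D where "D = case_sum X (\<lambda>k. tgt (fst (M k)))"
  define E where "E = (\<lambda>k. (Inl k, Inr k, fst (M k))) ` {k. k < ?N} \<union>
    (\<lambda>k. (Inl (Suc k) :: nat + nat, Inr k :: nat + nat, snd (M k))) ` {k. k < ?N}"
  have "is_colimit Chat J D E (tgt i) q"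
    unfolding is_colimit_def
  proof (intro conjI allI impI)
    show "\<forall>j\<in>J. D j \<in> Ob Chat"
      using Chat_hom[OF Mh(1)] yo_in by (auto simp: X_def J_def D_def)
    show "\<forall>(j, k, f)\<in>E. j \<in> J \<and> k \<in> J \<and> f \<in> hom Chat (D j) (D k)"
      using Mh Chat_hom[OF Mh(1)] by (auto simp: J_def D_def E_def)
    have "q (Inr k) \<odot> fst (M k) = q (Inl k)" if k: "k < ?N" for k
      using evs(1)[OF k qr(1)[OF k]] ql[of k] k qr(2)[OF k] Chat.cmp[OF Mh(1)[OF k] qr(1)[OF k]]
          gact_wview_Gs[OF wt k, where 'a = 'u]
      by (intro yo_eqI[of _ "Pl (lev n cs k)" ?W]) (auto simp: X_def)
    moreover have "q (Inr k) \<odot> snd (M k) = q (Inl (Suc k))" if k: "k < ?N" for k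
      using evs(2)[OF k qr(1)[OF k]] ql[of "Suc k"] k qr(2)[OF k]
          Chat.cmp[OF Mh(2)[OF k] qr(1)[OF k]] gact_wview_Gt[OF wt k, where 'a = 'u]
      by (intro yo_eqI[of _ "Pl (lev n cs (Suc k))" ?W]) (auto simp: X_def)
    ultimately show "is_cocone Chat J D E (tgt i) q"
      using W Chat_hom[OF i(1)] ql qr Chat_hom[OF Mh(1)] by (auto simp: is_cocone_def J_def D_def E_def)
    fix Q r assume "is_cocone Chat J D E Q r"
    then have Q: "Q \<in> Ob Chat" and rl: "\<And>k. k \<le> ?N \<Longrightarrow> r (Inl k) \<in> hom Chat (X k) Q"
      and rr: "\<And>k. k < ?N \<Longrightarrow> r (Inr k) \<in> hom Chat (yo (cs ! k)) Q"
      and rs: "\<And>k. k < ?N \<Longrightarrow> r (Inr k) \<odot> fst (M k) = r (Inl k)"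
      and rt: "\<And>k. k < ?N \<Longrightarrow> r (Inr k) \<odot> snd (M k) = r (Inl (Suc k))"
      using Chat_hom[OF Mh(1)] by (auto simp: is_cocone_def J_def D_def E_def ball_Un)
    \<comment> \<open>The thread of a cocone: the legs at the moves are evaluated at the universal
      elements, and commutation with the cospans becomes the thread equations.\<close>
    define e' where "e' k = ev (r (Inr k)) (cs ! k)" for k
    define x' where "x' = ev (r (Inl 0)) (Pl n)"
    have pl: "plr Q cs x' e' k = ev (r (Inl k)) (Pl (lev n cs k))" if "k \<le> ?N" for k
    proof (cases k)
      case (Suc l)
      then have l: "l < ?N" using that by simp
      show ?thesis using Suc evs(2)[OF l rr[OF l]] rt[OF l] by (simp add: e'_def)
    qed (simp add: x'_def)
    have t: "thread Q n cs x' e'"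
      unfolding thread_def
    proof (intro conjI allI impI)
      show "x' \<in> FO Q (Pl n)" unfolding x'_def using rl[of 0] ev_in[of "r (Inl 0)" "Pl n" Q]
          by (simp add: X_def)
      fix k assume k: "k < ?N"
      show "e' k \<in> FO Q (cs ! k)" unfolding e'_def using ev_in[OF rr[OF k] bobj[OF k]] .
      show "gact Q (Gs (cs ! k)) (e' k) = plr Q cs x' e' k"
        using pl[of k] k evs(1)[OF k rr[OF k]] rs[OF k] by (simp add: e'_def)
    qed
    then obtain m where m: "m \<in> hom Chat ?W Q" "app m (Pl n) (nm 0) = x'"
        "\<forall>k<?N. app m (cs ! k) (nm k) = e' k"
      using U Q unfolding univ_def by meson
    \<comment> \<open>Every leg starts at a representable, so a map with the prescribed values on
      the universal thread mediates the whole cocone.\<close>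
    have mq: "f \<odot> q j = r j" if f: "f \<in> hom Chat ?W Q" "app f (Pl n) (nm 0) = x'"
        "\<forall>k<?N. app f (cs ! k) (nm k) = e' k"
      and j: "j \<in> J" for f j
    proof -
      from j consider k where "j = Inl k" "k \<le> ?N" | k where "j = Inr k" "k < ?N" by (auto simp: J_def)
      then show ?thesis
      proof cases
        case 1
        have "plr Q cs (app f (Pl n) (nm 0)) (\<lambda>k. app f (cs ! k) (nm k)) k = plr Q cs x' e' k"
          using 1 f(2,3) by (cases k) auto
        then have "app f (Pl (lev n cs k)) (nm k) = ev (r (Inl k)) (Pl (lev n cs k))"
          using app_plr[OF f(1) wt thread_wview[OF wt] 1(2)] pl[OF 1(2)]
              by (simp add: plr_wview[OF wt 1(2)])
        moreover have "ev (f \<odot> q (Inl k)) (Pl (lev n cs k)) = app f (Pl (lev n cs k)) (nm k)"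
          using ev_Cmp[of "q (Inl k)" "Pl (lev n cs k)" ?W f] ql[OF 1(2)] by (simp add: X_def)
        ultimately show ?thesis
          using 1 Chat.cmp[OF ql(1)[OF 1(2)] f(1)] rl[OF 1(2)]
              by (intro yo_eqI[of _ "Pl (lev n cs k)" Q]) (auto simp: X_def)
      next
        case 2
        have "ev (f \<odot> q (Inr k)) (cs ! k) = ev (r (Inr k)) (cs ! k)"
          using ev_Cmp[OF qr(1)[OF 2(2)] bobj[OF 2(2)], of f] qr(2)[OF 2(2)] f(3) 2 by (simp add: e'_def)
        then show ?thesis
          using 2 Chat.cmp[OF qr(1)[OF 2(2)] f(1)] rr[OF 2(2)] by (intro yo_eqI[of _ "cs ! k" Q]) auto
      qed
    qed
    show "\<exists>!m. m \<in> hom Chat (tgt i) Q \<and> (\<forall>j\<in>J. m \<odot> q j = r j)"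
    proof (rule ex1I[of _ m])
      show "m \<in> hom Chat (tgt i) Q \<and> (\<forall>j\<in>J. m \<odot> q j = r j)"
        using m mq Chat_hom[OF i(1)] by auto
      fix m' assume m': "m' \<in> hom Chat (tgt i) Q \<and> (\<forall>j\<in>J. m' \<odot> q j = r j)"
      then have h: "m' \<in> hom Chat ?W Q" using Chat_hom[OF i(1)] by simp
      have "app m' (Pl n) (nm 0) = x'"
        using m' ev_Cmp[of "q (Inl 0)" "Pl n" ?W m'] ql[of 0] by (auto simp: X_def x'_def J_def ball_Un)
      moreover have "app m' (cs ! k) (nm k) = e' k" if k: "k < ?N" for k
        using m' k ev_Cmp[OF qr(1)[OF k] bobj[OF k], of m'] qr(2)[OF k]
            by (auto simp: e'_def J_def ball_Un)
      ultimately show "m' = m" using U h m unfolding univ_def by metis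
    qed
  qed
  note colim = this
  have ext: "extended basic_move (M k)" if "k < ?N" for k
    unfolding M_def by (rule extended_basic_cospan[OF st[OF that]])
  have ends: "src (fst (M k)) = X k" "src (snd (M k)) = X (Suc k)" if "k < ?N" for k
    using Chat_hom[OF Mh(1)[OF that]] Chat_hom[OF Mh(2)[OF that]] by auto
  have "chain_play (extended basic_move) (enat ?N) i"
    unfolding chain_play_def
  proof (intro conjI exI[of _ X] exI[of _ M] exI[of _ q] allI impI)
    show "is_mono Chat i" by (rule mono)
    show "is_position (src i)" unfolding src by (rule position_Pl)
    show "X 0 = src i" using src by (simp add: X_def)
    show "q (Inl 0) = i" by (simp add: q_def i_def)
  qed (use colim in \<open>simp_all add: ext ends J_def D_def E_def\<close>)
  then show "is_view i" unfolding is_view_def using src by blast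
qed

subsection \<open>Every view is a word\<close>

lemma Chat_is_iso_hom: "is_iso Chat x \<Longrightarrow> x \<in> hom Chat (src x) (tgt x)"
  by (simp add: is_iso_def Chat_Arr)

lemma cospan_iso_byD:
  fixes M N :: "'u cospan"
  assumes "cospan_iso_by x u y M N"
  shows "is_iso Chat x" "x \<in> hom Chat (src (fst M)) (src (fst N))"
    "is_iso Chat u" "u \<in> hom Chat (tgt (fst M)) (tgt (fst N))"
    "is_iso Chat y" "y \<in> hom Chat (src (snd M)) (src (snd N))"
    "fst M \<in> hom Chat (src (fst M)) (tgt (fst M))" "snd M \<in> hom Chat (src (snd M)) (tgt (fst M))"
    "fst N \<in> hom Chat (src (fst N)) (tgt (fst N))" "snd N \<in> hom Chat (src (snd N)) (tgt (fst N))"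
    "fst N \<odot> x = u \<odot> fst M" "snd N \<odot> y = u \<odot> snd M"
  using assms Chat_is_iso_hom[of x] Chat_is_iso_hom[of u] Chat_is_iso_hom[of y]
    Chat_Arr[of "fst M"] Chat_Arr[of "snd M"] Chat_Arr[of "fst N"] Chat_Arr[of "snd N"]
  by (simp_all add: cospan_iso_by_def is_cospan_def)

text \<open>Along the chain every position is a player up to isomorphism, because an extended basic
  move from a player is isomorphic to a standard one and ends at a player again. The view is thus a
  colimit of objects isomorphic to representables, and maps out of it are threads.\<close>

lemma view_univ:
  fixes i :: "'u::infinite parr"
  assumes view: "is_view i" and src: "src i = yo (Pl n)"
  shows "\<exists>cs e. univ (tgt i) n cs (ev i (Pl n)) e"
proof -
  obtain N where "chain_play (extended basic_move) (enat N) i"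
    using view unfolding is_view_def by blast
  then obtain X M q where X0: "X 0 = src i" and q0: "q (Inl 0) = i"
    and MK0: "\<forall>k. enat k < enat N \<longrightarrow> extended basic_move (M k) \<and> src (fst (M k)) = X k \<and>
        src (snd (M k)) = X (Suc k)"
    and colim0: "is_colimit Chat (Inl ` {k. enat k \<le> enat N} \<union> Inr ` {k. enat k < enat N})
        (case_sum X (\<lambda>k. tgt (fst (M k))))
        ((\<lambda>k. (Inl k, Inr k, fst (M k))) ` {k. enat k < enat N} \<union>
         (\<lambda>k. (Inl (Suc k), Inr k, snd (M k))) ` {k. enat k < enat N})
        (tgt i) q"
    unfolding chain_play_def by blast
  have MK: "extended basic_move (M k) \<and> src (fst (M k)) = X k \<and> src (snd (M k)) = X (Suc k)"
      if "k < N" for k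
    using MK0 that by simp
  define V where "V = tgt i"
  define J where "J = Inl ` {k. k \<le> N} \<union> (Inr ` {k. k < N} :: (nat + nat) set)"
  define D where "D = case_sum X (\<lambda>k. tgt (fst (M k)))"
  define E where "E = (\<lambda>k. (Inl k, Inr k, fst (M k))) ` {k. k < N} \<union>
         (\<lambda>k. (Inl (Suc k) :: nat + nat, Inr k :: nat + nat, snd (M k))) ` {k. k < N}"
  have colim: "is_colimit Chat J D E V q"
    using colim0 by (simp add: J_def D_def E_def V_def)
  define Uo where "Uo k = tgt (fst (M k))" for k
  have cc: "is_cocone Chat J D E V q" using colim by (simp add: is_colimit_def)
  have V: "V \<in> Ob Chat" using cc by (simp add: is_cocone_def)
  have ql: "q (Inl k) \<in> hom Chat (X k) V" if "k \<le> N" for k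
    using cc that by (auto simp: is_cocone_def J_def D_def ball_Un)
  have qr: "q (Inr k) \<in> hom Chat (Uo k) V" if "k < N" for k
    using cc that by (auto simp: is_cocone_def J_def D_def Uo_def ball_Un)
  have qs: "q (Inr k) \<odot> fst (M k) = q (Inl k)" and qt: "q (Inr k) \<odot> snd (M k) = q (Inl (Suc k))"
      if "k < N" for k
    using cc that by (auto simp: is_cocone_def E_def ball_Un)
  \<comment> \<open>The isomorphism at the end of one move must be the one at the beginning of the
    next, so they are chosen successively. Dependent choice yields an infinite sequence, hence the
    guards against stages beyond \<open>N\<close>. Starting with the identity keeps the inclusion
    \<open>i\<close> unchanged.\<close>
  let ?P = "\<lambda>k (m, \<xi>). k \<le> N \<longrightarrow> is_iso Chat \<xi> \<and> \<xi> \<in> hom Chat (yo (Pl m)) (X k) \<and>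
    (k = 0 \<longrightarrow> m = n \<and> \<xi> = Ide Chat (yo (Pl n)))"
  let ?Q = "\<lambda>k (m, \<xi>) (m', \<xi>'). k < N \<longrightarrow>
      (\<exists>c u. st_obj c m m' \<and> cospan_iso_by \<xi> u \<xi>' (basic_cospan c m m') (M k))"
  have "\<exists>f. \<forall>k. ?P k (f k) \<and> ?Q k (f k) (f (Suc k))"
  proof (rule dependent_nat_choice)
    show "\<exists>x. ?P 0 x"
      using Chat.is_iso_Ide[OF yo_in[of "Pl n", where 'a = 'u]]
          Chat.ide[OF yo_in[of "Pl n", where 'a = 'u]] X0 src
      by (intro exI[of _ "(n, Ide Chat (yo (Pl n)))"]) auto
    fix x k assume "?P k x"
    show "\<exists>y. ?P (Suc k) y \<and> ?Q k x y"
    proof (cases "k < N")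
      case True
      obtain m \<xi> where x: "x = (m, \<xi>)" by (cases x)
      have \<xi>: "is_iso Chat \<xi>" "\<xi> \<in> hom Chat (yo (Pl m)) (src (fst (M k)))"
        using \<open>?P k x\<close> True MK[OF True] x by auto
      obtain c m' u \<xi>' where c: "st_obj c m m'" "cospan_iso_by \<xi> u \<xi>' (basic_cospan c m m') (M k)"
        using extended_basic_move_iso[OF _ \<xi>] MK[OF True] by blast
      have "is_iso Chat \<xi>'" "\<xi>' \<in> hom Chat (yo (Pl m')) (X (Suc k))"
        using cospan_iso_byD(5,6)[OF c(2)] Chat_hom[OF basic_cospan_hom(2)[OF c(1), where 'u = 'u]]
            MK[OF True] by auto
      then show ?thesis using c x by (intro exI[of _ "(m', \<xi>')"]) auto
    qed auto
  qed
  then obtain f where f0: "\<forall>k. ?P k (f k) \<and> ?Q k (f k) (f (Suc k))" by (rule exE)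
  have f: "?P k (f k)" "?Q k (f k) (f (Suc k))" for k
    by (rule conjunct1[OF spec[OF f0]], rule conjunct2[OF spec[OF f0]])
  define l where "l k = fst (f k)" for k
  define \<xi> where "\<xi> k = snd (f k)" for k
  have l0: "l 0 = n" and \<xi>0: "\<xi> 0 = Ide Chat (yo (Pl n))" using f(1)[of 0]
      by (auto simp: l_def \<xi>_def split: prod.splits)
  have \<xi>: "is_iso Chat (\<xi> k)" "\<xi> k \<in> hom Chat (yo (Pl (l k))) (X k)" if "k \<le> N" for k
    using f(1)[of k] that by (auto simp: l_def \<xi>_def split: prod.splits)
  have "\<exists>c u. st_obj c (l k) (l (Suc k)) \<and>
      cospan_iso_by (\<xi> k) u (\<xi> (Suc k)) (basic_cospan c (l k) (l (Suc k))) (M k)"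
    if "k < N" for k
    using f(2)[of k] that by (auto simp: l_def \<xi>_def split: prod.splits)
  then obtain c u where st: "\<And>k. k < N \<Longrightarrow> st_obj (c k) (l k) (l (Suc k))"
    and iso: "\<And>k. k < N \<Longrightarrow> cospan_iso_by (\<xi> k) (u k) (\<xi> (Suc k))
        (basic_cospan (c k) (l k) (l (Suc k))) (M k)"
    by metis
  define cs where "cs = map c [0..<N]"
  have len: "length cs = N" and nth: "\<And>k. k < N \<Longrightarrow> cs ! k = c k" by (auto simp: cs_def)
  have lev: "lev n cs k = l k" if "k \<le> N" for k
    using that l0 nth st_obj_bsrc[OF st] by (cases k) auto
  have wt: "wt n cs"
    by (rule wtI) (use len nth lev st st_obj_bsrc[OF st] in auto)
  have cb: "c k \<in> bobjs" if "k < N" for k using st_obj_bobjs[OF st[OF that]] .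
  have u: "is_iso Chat (u k)" "u k \<in> hom Chat (yo (c k)) (Uo k)" if "k < N" for k
    using cospan_iso_byD(3,4)[OF iso[OF that]]
        Chat_hom[OF basic_cospan_hom(1)[OF st[OF that], where 'u = 'u]]
    by (auto simp: Uo_def)
  have Mh: "fst (M k) \<in> hom Chat (X k) (Uo k)" "snd (M k) \<in> hom Chat (X (Suc k)) (Uo k)" if "k < N" for k
    using cospan_iso_byD(9,10)[OF iso[OF that]] MK[OF that] by (auto simp: Uo_def)
  have es: "edge (Pl (l k)) (Gs (c k)) (c k)" and et: "edge (Pl (l (Suc k))) (Gt (c k)) (c k)"
      if "k < N" for k
    using edge.intros(2,3)[OF st[OF that]] by auto
  have sq: "fst (M k) \<odot> \<xi> k = u k \<odot> yo_path (Pl (l k)) [Gs (c k)] (c k)"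
    "snd (M k) \<odot> \<xi> (Suc k) = u k \<odot> yo_path (Pl (l (Suc k))) [Gt (c k)] (c k)" if "k < N" for k
    using cospan_iso_byD(11,12)[OF iso[OF that]] by (auto simp: basic_cospan_def)
  \<comment> \<open>The universal thread: each leg of the colimit is read through the isomorphism of
    its node with a representable.\<close>
  define e where "e k = ev (q (Inr k) \<odot> u k) (c k)" for k
  define x where "x = ev i (Pl n)"
  have i: "i \<in> hom Chat (yo (Pl n)) V" using ql[of 0] q0 X0 src by simp
  have qu: "q (Inr k) \<odot> u k \<in> hom Chat (yo (c k)) V" if "k < N" for k
      using Chat.cmp[OF u(2)[OF that] qr[OF that]] .
  have res_s: "ev (r \<odot> (fst (M k) \<odot> \<xi> k)) (Pl (l k)) = gact Q (Gs (c k)) (ev (r \<odot> u k) (c k))"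
    and res_t: "ev (r \<odot> (snd (M k) \<odot> \<xi> (Suc k))) (Pl (l (Suc k))) =
        gact Q (Gt (c k)) (ev (r \<odot> u k) (c k))"
    if k: "k < N" and r: "r \<in> hom Chat (Uo k) Q" for r k Q
    using ev_yo_gen[OF es[OF k] Chat.cmp[OF u(2)[OF k] r]]
        ev_yo_gen[OF et[OF k] Chat.cmp[OF u(2)[OF k] r]]
      Chat.assoc[OF yo_gen_in[OF es[OF k]] u(2)[OF k] r]
          Chat.assoc[OF yo_gen_in[OF et[OF k]] u(2)[OF k] r] sq[OF k]
    by auto
  have plV: "plr V cs x e k = ev (q (Inl k) \<odot> \<xi> k) (Pl (l k))" if k: "k \<le> N" for k
  proof (cases k)
    case 0
    then show ?thesis using q0 \<xi>0 l0 Chat.ide_right[OF i] by (simp add: x_def)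
  next
    case (Suc j)
    then have j: "j < N" using k by simp
    show ?thesis
      using Suc nth[OF j] res_t[OF j qr[OF j]] Chat.assoc[OF \<xi>(2) Mh(2)[OF j] qr[OF j]] qt[OF j] j
          by (simp add: e_def)
  qed
  have thV: "thread V n cs x e"
    unfolding thread_def
  proof (intro conjI allI impI)
    show "x \<in> FO V (Pl n)" unfolding x_def using ev_in[OF i] by simp
    fix k assume "k < length cs"
    then have k: "k < N" using len by simp
    show "e k \<in> FO V (cs ! k)" using ev_in[OF qu[OF k] cb[OF k]] nth[OF k] by (simp add: e_def)
    show "gact V (Gs (cs ! k)) (e k) = plr V cs x e k"
      using res_s[OF k qr[OF k]] Chat.assoc[OF \<xi>(2) Mh(1)[OF k] qr[OF k]] qs[OF k] plV[of k] k nth[OF k]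
      by (simp add: e_def)
  qed
  have "\<exists>ui. ui \<in> hom Chat (Uo k) (yo (c k)) \<and> ui \<odot> u k = Ide Chat (yo (c k)) \<and> u k \<odot> ui =
      Ide Chat (Uo k)" if "k < N" for k
    using Chat.is_isoE[OF u[OF that]] by blast
  then obtain ui where ui: "\<And>k. k < N \<Longrightarrow> ui k \<in> hom Chat (Uo k) (yo (c k)) \<and> ui k \<odot> u k =
      Ide Chat (yo (c k)) \<and> u k \<odot> ui k = Ide Chat (Uo k)"
    by metis
  have "\<exists>xi. xi \<in> hom Chat (X k) (yo (Pl (l k))) \<and> xi \<odot> \<xi> k = Ide Chat (yo (Pl (l k))) \<and> \<xi> k \<odot> xi =
      Ide Chat (X k)" if "k \<le> N" for k
    using Chat.is_isoE[OF \<xi>[OF that]] by blast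
  then obtain xi where xi: "\<And>k. k \<le> N \<Longrightarrow> xi k \<in> hom Chat (X k) (yo (Pl (l k))) \<and> xi k \<odot> \<xi> k =
      Ide Chat (yo (Pl (l k))) \<and> \<xi> k \<odot> xi k = Ide Chat (X k)"
    by metis
  \<comment> \<open>A map out of a node isomorphic to a representable is determined by one element;
    \<open>U_eqI\<close> says the same for the moves.\<close>
  have X_eqI: "r = r'" if k: "k \<le> N" and r: "r \<in> hom Chat (X k) Q" "r' \<in> hom Chat (X k) Q"
    and eq: "ev (r \<odot> \<xi> k) (Pl (l k)) = ev (r' \<odot> \<xi> k) (Pl (l k))" for k r r' Q
  proof -
    have "r \<odot> \<xi> k = r' \<odot> \<xi> k"
      by (rule yo_eqI[OF Chat.cmp[OF \<xi>(2)[OF k] r(1)] Chat.cmp[OF \<xi>(2)[OF k] r(2)] eq])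
    then show ?thesis
      using Chat.assoc[OF conjunct1[OF xi[OF k]] \<xi>(2)[OF k] r(1)]
          Chat.assoc[OF conjunct1[OF xi[OF k]] \<xi>(2)[OF k] r(2)]
        xi[OF k] Chat.ide_right[OF r(1)] Chat.ide_right[OF r(2)] by simp
  qed
  have U_eqI: "r = r'" if k: "k < N" and r: "r \<in> hom Chat (Uo k) Q" "r' \<in> hom Chat (Uo k) Q"
    and eq: "ev (r \<odot> u k) (c k) = ev (r' \<odot> u k) (c k)" for k r r' Q
  proof -
    have "r \<odot> u k = r' \<odot> u k"
      by (rule yo_eqI[OF Chat.cmp[OF u(2)[OF k] r(1)] Chat.cmp[OF u(2)[OF k] r(2)] eq])
    then show ?thesis
      using Chat.assoc[OF conjunct1[OF ui[OF k]] u(2)[OF k] r(1)]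
          Chat.assoc[OF conjunct1[OF ui[OF k]] u(2)[OF k] r(2)]
        ui[OF k] Chat.ide_right[OF r(1)] Chat.ide_right[OF r(2)] by simp
  qed
  have ex: "\<exists>m\<in>hom Chat V Q. app m (Pl n) x = x' \<and> (\<forall>k<length cs. app m (cs ! k) (e k) = e' k)"
    if Q: "Q \<in> Ob Chat" and t: "thread Q n cs x' e'" for Q :: "'u psh" and x' e'
  proof -
    let ?p = "plr Q cs x' e'"
    \<comment> \<open>The cocone of a thread: classifying maps of its players and moves, preceded by
      the inverse isomorphisms of the nodes.\<close>
    define r where "r = case_sum (\<lambda>k. el (Pl (l k)) Q (?p k) \<odot> xi k) (\<lambda>k. el (c k) Q (e' k) \<odot> ui k)"
    have p_in: "?p k \<in> FO Q (Pl (l k))" if "k \<le> N" for k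
        using plr_in[OF Q wt t, of k] lev[OF that] len that by simp
    have e_in: "e' k \<in> FO Q (c k)" "gact Q (Gs (c k)) (e' k) = ?p k" if "k < N" for k
      using t that len nth by (auto simp: thread_def)
    note elp = el_in[OF Q p_in] and ele = el_in[OF Q e_in(1)]
    have rl: "r (Inl k) \<in> hom Chat (X k) Q" "ev (r (Inl k) \<odot> \<xi> k) (Pl (l k)) = ?p k" if k: "k \<le> N" for k
    proof -
      show "r (Inl k) \<in> hom Chat (X k) Q" using Chat.cmp[OF conjunct1[OF xi[OF k]] elp[OF k]]
          by (simp add: r_def)
      have "r (Inl k) \<odot> \<xi> k = el (Pl (l k)) Q (?p k)"
        using Chat.assoc[OF \<xi>(2)[OF k] conjunct1[OF xi[OF k]] elp[OF k]] xi[OF k]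
            Chat.ide_right[OF elp[OF k]] by (simp add: r_def)
      then show "ev (r (Inl k) \<odot> \<xi> k) (Pl (l k)) = ?p k" using ev_el[OF Q _ p_in[OF k]] by simp
    qed
    have rr: "r (Inr k) \<in> hom Chat (Uo k) Q" "ev (r (Inr k) \<odot> u k) (c k) = e' k" if k: "k < N" for k
    proof -
      show "r (Inr k) \<in> hom Chat (Uo k) Q" using Chat.cmp[OF conjunct1[OF ui[OF k]] ele[OF k]]
          by (simp add: r_def)
      have "r (Inr k) \<odot> u k = el (c k) Q (e' k)"
        using Chat.assoc[OF u(2)[OF k] conjunct1[OF ui[OF k]] ele[OF k]] ui[OF k]
            Chat.ide_right[OF ele[OF k]] by (simp add: r_def)
      then show "ev (r (Inr k) \<odot> u k) (c k) = e' k" using ev_el[OF Q cb[OF k] e_in(1)[OF k]] by simp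
    qed
    have "r (Inr k) \<odot> fst (M k) = r (Inl k)" if k: "k < N" for k
    proof (rule X_eqI[of k])
      show "k \<le> N" using k by simp
      then show "ev ((r (Inr k) \<odot> fst (M k)) \<odot> \<xi> k) (Pl (l k)) = ev (r (Inl k) \<odot> \<xi> k) (Pl (l k))"
        using rl(2)[of k] res_s[OF k rr(1)[OF k]] rr(2)[OF k] e_in(2)[OF k]
            Chat.assoc[OF \<xi>(2)[of k] Mh(1)[OF k] rr(1)[OF k]] by simp
    qed (use k rl(1)[of k] Chat.cmp[OF Mh(1)[OF k] rr(1)[OF k]] in auto)
    moreover have "r (Inr k) \<odot> snd (M k) = r (Inl (Suc k))" if k: "k < N" for k
    proof (rule X_eqI[of "Suc k"])
      show "Suc k \<le> N" using k by simp
      then show "ev ((r (Inr k) \<odot> snd (M k)) \<odot> \<xi> (Suc k)) (Pl (l (Suc k))) =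
          ev (r (Inl (Suc k)) \<odot> \<xi> (Suc k)) (Pl (l (Suc k)))"
        using rl(2)[of "Suc k"] res_t[OF k rr(1)[OF k]] rr(2)[OF k] nth[OF k]
            Chat.assoc[OF \<xi>(2)[of "Suc k"] Mh(2)[OF k] rr(1)[OF k]] by simp
    qed (use k rl(1)[of "Suc k"] Chat.cmp[OF Mh(2)[OF k] rr(1)[OF k]] in auto)
    ultimately have "is_cocone Chat J D E Q r"
      using Q rl(1) rr(1) by (auto simp: is_cocone_def J_def D_def E_def Uo_def)
    then obtain m where m: "m \<in> hom Chat V Q" "\<And>j. j \<in> J \<Longrightarrow> m \<odot> q j = r j"
      using colim unfolding is_colimit_def by blast
    have "m \<odot> i = r (Inl 0)" using m(2)[of "Inl 0"] q0 by (auto simp: J_def)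
    then have "ev (m \<odot> i) (Pl n) = x'"
      using rl(1)[of 0] rl(2)[of 0] \<xi>0 l0 X0 src Chat.ide_right[of "r (Inl 0)" "yo (Pl n)" Q] by simp
    then have "app m (Pl n) x = x'" using ev_Cmp[OF i, of m] by (simp add: x_def)
    moreover have "app m (cs ! k) (e k) = e' k" if "k < length cs" for k
    proof -
      have k: "k < N" using that len by simp
      have "m \<odot> q (Inr k) = r (Inr k)" using m(2)[of "Inr k"] k by (auto simp: J_def)
      then have "m \<odot> (q (Inr k) \<odot> u k) = r (Inr k) \<odot> u k"
          using Chat.assoc[OF u(2)[OF k] qr[OF k] m(1)] by simp
      then show ?thesis using ev_Cmp[OF qu[OF k] cb[OF k], of m] rr(2)[OF k] nth[OF k]
          by (simp add: e_def)
    qed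
    ultimately show ?thesis using m(1) by blast
  qed
  have uniq: "m = m'" if m: "m \<in> hom Chat V Q" "m' \<in> hom Chat V Q"
      and xx: "app m (Pl n) x = app m' (Pl n) x"
    and ee: "\<forall>k<length cs. app m (cs ! k) (e k) = app m' (cs ! k) (e k)" for Q :: "'u psh" and m m'
  proof -
    have r: "m \<odot> q (Inr k) = m' \<odot> q (Inr k)" if k: "k < N" for k
    proof (rule U_eqI[OF k Chat.cmp[OF qr[OF k] m(1)] Chat.cmp[OF qr[OF k] m(2)]])
      show "ev ((m \<odot> q (Inr k)) \<odot> u k) (c k) = ev ((m' \<odot> q (Inr k)) \<odot> u k) (c k)"
        using Chat.assoc[OF u(2)[OF k] qr[OF k] m(1)] Chat.assoc[OF u(2)[OF k] qr[OF k] m(2)]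
          ev_Cmp[OF qu[OF k] cb[OF k], of m] ev_Cmp[OF qu[OF k] cb[OF k], of m']
              ee[rule_format, of k] k len nth[OF k] by (simp add: e_def)
    qed
    have l: "m \<odot> q (Inl k) = m' \<odot> q (Inl k)" if k: "k \<le> N" for k
    proof (cases k)
      case 0
      have "m \<odot> i = m' \<odot> i"
        using xx by (intro yo_eqI[OF Chat.cmp[OF i m(1)] Chat.cmp[OF i m(2)]])
            (simp add: x_def ev_Cmp[OF i])
      then show ?thesis using 0 q0 by simp
    next
      case (Suc j)
      then have j: "j < N" using k by simp
      show ?thesis using Suc r[OF j] qt[OF j] Chat.assoc[OF Mh(2)[OF j] qr[OF j] m(1)]
          Chat.assoc[OF Mh(2)[OF j] qr[OF j] m(2)] by simp
    qed
    have cc': "is_cocone Chat J D E Q (\<lambda>j. m \<odot> q j)"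
      unfolding is_cocone_def
    proof (intro conjI ballI)
      show "Q \<in> Ob Chat" using Chat.hom_Ob[OF m(1)] by simp
      fix j assume "j \<in> J"
      then show "m \<odot> q j \<in> hom Chat (D j) Q"
        using Chat.cmp[OF ql m(1)] Chat.cmp[OF qr m(1)] by (auto simp: J_def D_def Uo_def)
    next
      fix z assume "z \<in> E"
      then show "case z of (j, k, f) \<Rightarrow> (m \<odot> q k) \<odot> f = m \<odot> q j"
        using Chat.assoc[OF Mh(1) qr m(1)] Chat.assoc[OF Mh(2) qr m(1)] qs qt by (auto simp: E_def)
    qed
    have "\<exists>!g. g \<in> hom Chat V Q \<and> (\<forall>j\<in>J. g \<odot> q j = m \<odot> q j)"
      using colim cc' unfolding is_colimit_def by blast
    moreover have "\<forall>j\<in>J. m' \<odot> q j = m \<odot> q j" using l r by (auto simp: J_def)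
    ultimately show ?thesis using m by blast
  qed
  have "univ V n cs x e" unfolding univ_def using V wt thV ex uniq by blast
  then show ?thesis unfolding V_def x_def by blast
qed

subsection \<open>The category of views of a player\<close>

lemma category_full_subcat:
  assumes "category C"
  shows "category (full_subcat C P)"
proof -
  interpret category C by fact
  have hom: "hom (full_subcat C P) a b = (if P a \<and> P b then hom C a b else {})" for a b
    by (auto simp: hom_def full_subcat_def)
  have s: "Ide (full_subcat C P) = Ide C" "Cmp (full_subcat C P) = Cmp C"
      "Ob (full_subcat C P) = {a \<in> Ob C. P a}"
    by (simp_all add: full_subcat_def)
  show ?thesis
  proof
    fix f assume "f \<in> Arr (full_subcat C P)"
    then show "Dom (full_subcat C P) f \<in> Ob (full_subcat C P) \<and> Cod (full_subcat C P) f \<in>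
        Ob (full_subcat C P)"
      using dom_cod by (auto simp: full_subcat_def)
  qed (use ide cmp ide_left ide_right assoc in \<open>auto simp: hom s split: if_splits\<close>)
qed

lemma is_play_hom: "is_play i \<Longrightarrow> i \<in> hom Chat (src i) (tgt i)"
  by (auto simp: is_play_def chain_play_def is_mono_def intro: Chat_Arr)

lemma Plays_Ob: "(i, p) \<in> Ob (Plays X) \<longleftrightarrow> is_play i \<and> p \<in> hom Chat (src i) X"
  by (simp add: Plays_def)

lemma Plays_hom:
  "f \<in> hom (Plays X) (i, p) (i', p') \<longleftrightarrow> (i, p) \<in> Ob (Plays X) \<and> (i', p') \<in> Ob (Plays X) \<and>
    (\<exists>h k. f = Arrow (i, p) (h, k) (i', p') \<and> h \<in> hom Chat (src i) (src i') \<and> k \<in> hom Chat (tgt i)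
        (tgt i') \<and>
      k \<odot> i = i' \<odot> h \<and> p' \<odot> h = p)"
  by (auto simp: Plays_def hom_def Let_def)

lemma Plays_simps:
  "Ide (Plays X) (i, p) = Arrow (i, p) (Ide Chat (src i), Ide Chat (tgt i)) (i, p)"
  "Cmp (Plays X) (Arrow b (h', k') c) (Arrow a (h, k) b') = Arrow a (h' \<odot> h, k' \<odot> k) c"
  by (simp_all add: Plays_def Let_def)

lemma category_Plays: "category (Plays X)"
proof
  fix f assume "f \<in> Arr (Plays X)"
  then show "Dom (Plays X) f \<in> Ob (Plays X) \<and> Cod (Plays X) f \<in> Ob (Plays X)"
    by (auto simp: Plays_def Let_def)
next
  fix a assume a: "a \<in> Ob (Plays X)"
  obtain i p where [simp]: "a = (i, p)" by (cases a)
  have i: "i \<in> hom Chat (src i) (tgt i)" and p: "p \<in> hom Chat (src i) X"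
    using a is_play_hom by (auto simp: Plays_Ob)
  show "Ide (Plays X) a \<in> hom (Plays X) a a"
    using a Chat.ide Chat.hom_Ob[OF i] Chat.ide_left[OF i] Chat.ide_right[OF i] Chat.ide_right[OF p]
    by (auto simp: Plays_hom Plays_simps)
next
  fix f a b g c assume f: "f \<in> hom (Plays X) a b" and g: "g \<in> hom (Plays X) b c"
  obtain i p i' p' i'' p'' where [simp]: "a = (i, p)" "b = (i', p')" "c = (i'', p'')"
      by (cases a; cases b; cases c)
  obtain h k where hk: "f = Arrow (i, p) (h, k) (i', p')" "h \<in> hom Chat (src i) (src i')"
      "k \<in> hom Chat (tgt i) (tgt i')"
    "k \<odot> i = i' \<odot> h" "p' \<odot> h = p" using f by (auto simp: Plays_hom)
  obtain h' k' where hk': "g = Arrow (i', p') (h', k') (i'', p'')"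
      "h' \<in> hom Chat (src i') (src i'')" "k' \<in> hom Chat (tgt i') (tgt i'')"
    "k' \<odot> i' = i'' \<odot> h'" "p'' \<odot> h' = p'" using g by (auto simp: Plays_hom)
  have ob: "(i, p) \<in> Ob (Plays X)" "(i', p') \<in> Ob (Plays X)" "(i'', p'') \<in> Ob (Plays X)" using f g
      by (auto simp: Plays_hom)
  have i: "i \<in> hom Chat (src i) (tgt i)" "i' \<in> hom Chat (src i') (tgt i')"
      "i'' \<in> hom Chat (src i'') (tgt i'')"
    and p: "p'' \<in> hom Chat (src i'') X"
    using ob is_play_hom by (auto simp: Plays_Ob)
  have "(k' \<odot> k) \<odot> i = i'' \<odot> (h' \<odot> h)"
    using Chat.assoc[OF i(1) hk(3) hk'(3)] Chat.assoc[OF hk(2) i(2) hk'(3)]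
        Chat.assoc[OF hk(2) hk'(2) i(3)] hk(4) hk'(4) by simp
  moreover have "p'' \<odot> (h' \<odot> h) = p" using Chat.assoc[OF hk(2) hk'(2) p] hk(5) hk'(5) by simp
  ultimately show "Cmp (Plays X) g f \<in> hom (Plays X) a c"
    using ob Chat.cmp[OF hk(2) hk'(2)] Chat.cmp[OF hk(3) hk'(3)]
        by (simp add: Plays_hom Plays_simps hk(1) hk'(1))
next
  fix f a b assume f: "f \<in> hom (Plays X) a b"
  then show "Cmp (Plays X) f (Ide (Plays X) a) = f" "Cmp (Plays X) (Ide (Plays X) b) f = f"
    by (cases a; cases b; auto simp: Plays_hom Plays_simps intro: Chat.ide_right Chat.ide_left)+
next
  fix f a b g c h d assume "f \<in> hom (Plays X) a b" "g \<in> hom (Plays X) b c" "h \<in> hom (Plays X) c d"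
  then show "Cmp (Plays X) h (Cmp (Plays X) g f) = Cmp (Plays X) (Cmp (Plays X) h g) f"
    by (cases a; cases b; cases c; cases d) (auto simp: Plays_hom Plays_simps intro: Chat.assoc)
qed

lemma chain_play_mono: "chain_play K N i \<Longrightarrow> (\<And>M. K M \<Longrightarrow> K' M) \<Longrightarrow> chain_play K' N i"
  unfolding chain_play_def by blast

lemma view_is_play:
  assumes "is_view i"
  shows "is_play i"
proof -
  have "extended move M" if "extended basic_move M" for M :: "'a cospan"
    using that unfolding extended_def move_def by blast
  then show ?thesis using assms chain_play_mono unfolding is_view_def is_play_def by blast
qed

text \<open>The word is taken from the universal property and not from a chain of moves, so no chain
  has to be chosen; \<open>univ_word_unique\<close> makes it unambiguous.\<close>

definition wd :: "nat \<Rightarrow> 'u::infinite play_over \<Rightarrow> bobj list" where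
  "wd n V = (SOME cs. \<exists>e. univ (tgt (fst V)) n cs (ev (fst V) (Pl n)) e)"

text \<open>The map from the initial player to \<open>[n]\<close> is a map between players, so
  rigidity fixes both the player and the map.\<close>

lemma Views_Ob:
  "(i, p) \<in> Ob (Views (yo (Pl n))) \<longleftrightarrow> is_view i \<and> src i = yo (Pl n) \<and> p =
      Ide Chat (yo (Pl n) :: 'u::infinite psh)"
proof
  assume "(i, p) \<in> Ob (Views (yo (Pl n)))"
  then have v: "is_view i" and p: "p \<in> hom Chat (src i) (yo (Pl n))"
    by (auto simp: Views_def full_subcat_def Plays_Ob)
  obtain m where m: "src i = yo (Pl m)" using v by (auto simp: is_view_def)
  show "is_view i \<and> src i = yo (Pl n) \<and> p = Ide Chat (yo (Pl n))"
    using v m p yo_hom_Pl[of p m n] by auto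
next
  assume *: "is_view i \<and> src i = yo (Pl n) \<and> p = Ide Chat (yo (Pl n) :: 'u psh)"
  then show "(i, p) \<in> Ob (Views (yo (Pl n)))"
    using view_is_play[of i] Chat.ide[OF yo_in[of "Pl n"]]
        by (auto simp: Views_def full_subcat_def Plays_Ob)
qed

text \<open>Rigidity forces \<open>h\<close> to be the identity, and \<open>k \<odot> i = i'\<close>
  is by Yoneda an equation between two elements. This is the form in which the lemmas on
  \<open>univ\<close> apply.\<close>

lemma Views_hom:
  fixes a b :: "'u::infinite play_over"
  assumes a: "a \<in> Ob (Views (yo (Pl n)))" and b: "b \<in> Ob (Views (yo (Pl n)))"
  shows "f \<in> hom (Views (yo (Pl n))) a b \<longleftrightarrow>
    (\<exists>k. f = Arrow a (Ide Chat (yo (Pl n)), k) b \<and> k \<in> hom Chat (tgt (fst a)) (tgt (fst b)) \<and>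
      app k (Pl n) (ev (fst a) (Pl n)) = ev (fst b) (Pl n))"
proof -
  let ?I = "Ide Chat (yo (Pl n) :: 'u psh)"
  obtain i i' where ab: "a = (i, ?I)" "b = (i', ?I)" and v: "is_view i" "is_view i'"
    and src: "src i = yo (Pl n)" "src i' = yo (Pl n)"
    using a b by (cases a; cases b) (auto simp: Views_Ob)
  have I: "?I \<in> hom Chat (yo (Pl n)) (yo (Pl n))" using Chat.ide[OF yo_in] .
  have i: "i \<in> hom Chat (yo (Pl n)) (tgt i)" "i' \<in> hom Chat (yo (Pl n)) (tgt i')"
    using is_play_hom[OF view_is_play[OF v(1)]] is_play_hom[OF view_is_play[OF v(2)]] src by auto
  have ob: "(i, ?I) \<in> Ob (Plays (yo (Pl n)))" "(i', ?I) \<in> Ob (Plays (yo (Pl n)))"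
    using a b ab by (auto simp: Views_def full_subcat_def)
  have "f \<in> hom (Views (yo (Pl n))) a b \<longleftrightarrow> f \<in> hom (Plays (yo (Pl n))) a b"
    using v ab by (auto simp: Views_def full_subcat_def hom_def)
  also have "\<dots> \<longleftrightarrow> (\<exists>k. f = Arrow a (?I, k) b \<and> k \<in> hom Chat (tgt i) (tgt i') \<and> k \<odot> i = i')"
  proof
    assume "f \<in> hom (Plays (yo (Pl n))) a b"
    then obtain h k where hk: "f = Arrow a (h, k) b" "h \<in> hom Chat (yo (Pl n)) (yo (Pl n))"
      "k \<in> hom Chat (tgt i) (tgt i')" "k \<odot> i = i' \<odot> h"
      unfolding ab Plays_hom src by blast
    have "h = ?I" by (rule yo_hom_Pl(2)[OF hk(2)])
    then show "\<exists>k. f = Arrow a (?I, k) b \<and> k \<in> hom Chat (tgt i) (tgt i') \<and> k \<odot> i = i'"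
      using hk Chat.ide_right[OF i(2)] by simp
  next
    assume "\<exists>k. f = Arrow a (?I, k) b \<and> k \<in> hom Chat (tgt i) (tgt i') \<and> k \<odot> i = i'"
    then obtain k where "f = Arrow a (?I, k) b" "k \<in> hom Chat (tgt i) (tgt i')" "k \<odot> i = i'" by blast
    then show "f \<in> hom (Plays (yo (Pl n))) a b"
      unfolding ab Plays_hom src using ob I Chat.ide_left[OF I] Chat.ide_right[OF i(2)] by simp
  qed
  also have "\<dots> \<longleftrightarrow> (\<exists>k. f = Arrow a (?I, k) b \<and> k \<in> hom Chat (tgt i) (tgt i') \<and>
      app k (Pl n) (ev i (Pl n)) = ev i' (Pl n))"
  proof -
    have "k \<odot> i = i' \<longleftrightarrow> app k (Pl n) (ev i (Pl n)) = ev i' (Pl n)"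
        if k: "k \<in> hom Chat (tgt i) (tgt i')" for k
      using ev_Cmp[OF i(1), of k] yo_eqI[OF Chat.cmp[OF i(1) k] i(2)] by auto
    then show ?thesis by blast
  qed
  finally show ?thesis using ab by simp
qed

lemma wd_univ:
  assumes "V \<in> Ob (Views (yo (Pl n)))"
  shows "\<exists>e. univ (tgt (fst V)) n (wd n V) (ev (fst V) (Pl n)) e"
proof -
  have "\<exists>cs e. univ (tgt (fst V)) n cs (ev (fst V) (Pl n)) e"
    using assms by (cases V) (auto simp: Views_Ob intro: view_univ)
  then show ?thesis unfolding wd_def by (rule someI_ex)
qed

lemma word_category_Views:
  "word_category (Views (yo (Pl n) :: 'u::infinite psh)) (wd n) {cs. wt n cs}"
proof -
  let ?V = "Views (yo (Pl n) :: 'u psh)"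
  interpret V: category ?V unfolding Views_def by (rule category_full_subcat[OF category_Plays])
  show ?thesis
  proof
    fix f g a b assume f: "f \<in> hom ?V a b" and g: "g \<in> hom ?V a b"
    have ob: "a \<in> Ob ?V" "b \<in> Ob ?V" using V.hom_Ob[OF f] by auto
    obtain k where k: "f = Arrow a (Ide Chat (yo (Pl n)), k) b"
        "k \<in> hom Chat (tgt (fst a)) (tgt (fst b))"
      "app k (Pl n) (ev (fst a) (Pl n)) = ev (fst b) (Pl n)" using f unfolding Views_hom[OF ob] by blast
    obtain k' where k': "g = Arrow a (Ide Chat (yo (Pl n)), k') b"
        "k' \<in> hom Chat (tgt (fst a)) (tgt (fst b))"
      "app k' (Pl n) (ev (fst a) (Pl n)) = ev (fst b) (Pl n)" using g unfolding Views_hom[OF ob] by blast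
    obtain e e' where "univ (tgt (fst a)) n (wd n a) (ev (fst a) (Pl n)) e"
      "univ (tgt (fst b)) n (wd n b) (ev (fst b) (Pl n)) e'"
          using wd_univ[OF ob(1)] wd_univ[OF ob(2)] by blast
    then have "k = k'" using univ_hom_unique k(2,3) k'(2,3) by blast
    then show "f = g" using k(1) k'(1) by simp
  next
    fix a b assume ob: "a \<in> Ob ?V" "b \<in> Ob ?V"
    obtain e e' where e: "univ (tgt (fst a)) n (wd n a) (ev (fst a) (Pl n)) e"
      "univ (tgt (fst b)) n (wd n b) (ev (fst b) (Pl n)) e'"
          using wd_univ[OF ob(1)] wd_univ[OF ob(2)] by blast
    have "hom ?V a b \<noteq> {} \<longleftrightarrow> (\<exists>f. f \<in> hom ?V a b)" by blast
    then show "hom ?V a b \<noteq> {} \<longleftrightarrow> prefix (wd n a) (wd n b)"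
      using univ_hom_iff_prefix[OF e] unfolding Views_hom[OF ob] by blast
  next
    show "wd n ` Ob ?V = {cs. wt n cs}"
    proof (intro equalityI subsetI)
      fix cs assume "cs \<in> wd n ` Ob ?V"
      then show "cs \<in> {cs. wt n cs}" using wd_univ[where 'a = 'u] by (auto simp: univ_def)
    next
      fix cs assume "cs \<in> {cs. wt n cs}"
      then have wt: "wt n cs" by simp
      let ?a = "(el (Pl n) (wview n cs) (nm 0), Ide Chat (yo (Pl n))) :: 'u play_over"
      have a: "?a \<in> Ob ?V" using word_is_view(1,2)[OF wt, where 'u = 'u] by (simp add: Views_Ob)
      obtain e where "univ (tgt (fst ?a)) n (wd n ?a) (ev (fst ?a) (Pl n)) e" using wd_univ[OF a]
          by blast
      then have "wd n ?a = cs" using univ_word_unique word_is_view(3)[OF wt, where 'u = 'u] by fastforce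
      then show "cs \<in> wd n ` Ob ?V" using a by force
    qed
  qed
qed

section \<open>Classes of basic moves\<close>

lemma cospan_iso_byI:
  assumes "is_cospan M" "is_cospan N" "is_iso Chat x" "x \<in> hom Chat (src (fst M)) (src (fst N))"
    "is_iso Chat u" "u \<in> hom Chat (tgt (fst M)) (tgt (fst N))"
    "is_iso Chat y" "y \<in> hom Chat (src (snd M)) (src (snd N))"
    "fst N \<odot> x = u \<odot> fst M" "snd N \<odot> y = u \<odot> snd M"
  shows "cospan_iso_by x u y M N"
  using assms Chat_hom[OF assms(4)] Chat_hom[OF assms(6)] Chat_hom[OF assms(8)]
      by (simp add: cospan_iso_by_def)

lemma (in category) square_inverse:
  assumes "f \<in> hom C a b" "f' \<in> hom C a' b'" "x \<in> hom C a a'" "u \<in> hom C b b'"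
    and x': "x' \<in> hom C a' a" "Cmp C x x' = Ide C a'" and u': "u' \<in> hom C b' b" "Cmp C u' u = Ide C b"
    and sq: "Cmp C f' x = Cmp C u f"
  shows "Cmp C f x' = Cmp C u' f'"
proof -
  have "Cmp C f x' = Cmp C (Cmp C u' (Cmp C u f)) x'"
    using assoc[OF assms(1,4) u'(1)] u'(2) ide_left[OF assms(1)] by simp
  also have "\<dots> = Cmp C (Cmp C u' (Cmp C f' x)) x'" using sq by simp
  also have "\<dots> = Cmp C u' (Cmp C f' (Cmp C x x'))"
    using assoc[OF x'(1) cmp[OF assms(3,2)] u'(1)] assoc[OF x'(1) assms(3,2)] by simp
  also have "\<dots> = Cmp C u' f'" using x'(2) ide_right[OF assms(2)] by simp
  finally show ?thesis .
qed

lemma cospan_iso_by_sym: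
  fixes M N :: "'u cospan"
  assumes "cospan_iso_by x u y M N"
  shows "\<exists>x u y. cospan_iso_by x u y N M"
proof -
  note d = cospan_iso_byD[OF assms]
  obtain x' where x': "x' \<in> hom Chat (src (fst N)) (src (fst M))" "x \<odot> x' = Ide Chat (src (fst N))"
      "is_iso Chat x'"
    using Chat.is_isoE[OF d(1,2)] by metis
  obtain u' where u': "u' \<in> hom Chat (tgt (fst N)) (tgt (fst M))" "u' \<odot> u = Ide Chat (tgt (fst M))"
      "is_iso Chat u'"
    using Chat.is_isoE[OF d(3,4)] by metis
  obtain y' where y': "y' \<in> hom Chat (src (snd N)) (src (snd M))" "y \<odot> y' = Ide Chat (src (snd N))"
      "is_iso Chat y'"
    using Chat.is_isoE[OF d(5,6)] by metis
  have "cospan_iso_by x' u' y' N M"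
    using assms x' u' y' Chat.square_inverse[OF d(7,9,2,4) x'(1,2) u'(1,2) d(11)]
      Chat.square_inverse[OF d(8,10,6,4) y'(1,2) u'(1,2) d(12)]
    by (intro cospan_iso_byI) (auto simp: cospan_iso_by_def)
  then show ?thesis by blast
qed

lemma cospan_iso_by_trans:
  fixes M N :: "'u cospan"
  assumes "cospan_iso_by x u y M N" "cospan_iso_by x' u' y' N R"
  shows "cospan_iso_by (x' \<odot> x) (u' \<odot> u) (y' \<odot> y) M R"
proof -
  note d = cospan_iso_byD[OF assms(1)] and d' = cospan_iso_byD[OF assms(2)]
  have "fst R \<odot> (x' \<odot> x) = (u' \<odot> u) \<odot> fst M"
    using Chat.assoc[OF d(2) d'(2) d'(9)] d'(11) Chat.assoc[OF d(2) d(9) d'(4)] d(11)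
        Chat.assoc[OF d(7) d(4) d'(4)] by simp
  moreover have "snd R \<odot> (y' \<odot> y) = (u' \<odot> u) \<odot> snd M"
    using Chat.assoc[OF d(6) d'(6) d'(10)] d'(12) Chat.assoc[OF d(6) d(10) d'(4)] d(12)
        Chat.assoc[OF d(8) d(4) d'(4)] by simp
  ultimately show ?thesis
    using assms Chat.cmp[OF d(2) d'(2)] Chat.cmp[OF d(4) d'(4)] Chat.cmp[OF d(6) d'(6)]
      Chat.is_iso_Cmp[OF d(1) d'(1) d(2) d'(2)] Chat.is_iso_Cmp[OF d(3) d'(3) d(4) d'(4)]
          Chat.is_iso_Cmp[OF d(5) d'(5) d(6) d'(6)]
    by (intro cospan_iso_byI) (auto simp: cospan_iso_by_def)
qed

abbreviation move_iso :: "nat \<Rightarrow> ('u::infinite cospan \<times> 'u cospan) set" where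
  "move_iso n \<equiv> {(M, N) \<in> basic_moves_from n \<times> basic_moves_from n. \<exists>x u y. cospan_iso_by x u y M N}"

lemma basic_move_iso_basic_cospan:
  assumes "M \<in> basic_moves_from n"
  shows "\<exists>c x u y. st_obj c n (btgt c) \<and>
      cospan_iso_by x u y (basic_cospan c n (btgt c)) (M :: 'u::infinite cospan)"
proof -
  obtain c m n' x u y where st: "st_obj c m n'" and i: "cospan_iso_by x u y (basic_cospan c m n') M"
    and src: "src (fst M) = yo (Pl n)"
    using assms unfolding basic_moves_from_def basic_move_def by blast
  have "m = n"
    using yo_hom_Pl(1)[of x m n] cospan_iso_byD(2)[OF i] src
        Chat_hom[OF basic_cospan_hom(1)[OF st, where 'u = 'u]] by simp
  moreover have "n' = btgt c" using st_obj_bsrc[OF st] by simp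
  ultimately show ?thesis using st i by blast
qed

lemma basic_cospan_from: "st_obj c n n' \<Longrightarrow> (basic_cospan c n n' :: 'u::infinite cospan) \<in>
    basic_moves_from n"
  using basic_cospan_move[of c n n', where 'u = 'u]
      Chat_hom[OF basic_cospan_hom(1)[of c n n', where 'u = 'u]]
  unfolding basic_moves_from_def by blast

text \<open>The isomorphism between the apexes is one between representables, so the objects
  agree.\<close>

lemma basic_cospan_iso_eq:
  assumes "cospan_iso_by x u y (basic_cospan c n n') (basic_cospan c' m m' :: 'u::infinite cospan)"
      "st_obj c n n'" "st_obj c' m m'"
  shows "c = c'"
  using cospan_iso_byD(3,4)[OF assms(1)] yo_iso_eq[of u c c'] st_obj_bobjs[OF assms(2)]
      st_obj_bobjs[OF assms(3)]
    Chat_hom[OF basic_cospan_hom(1)[OF assms(2), where 'u = 'u]]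
        Chat_hom[OF basic_cospan_hom(1)[OF assms(3), where 'u = 'u]] by simp

lemma equiv_move_iso: "equiv (basic_moves_from n) (move_iso n :: ('u::infinite cospan \<times> 'u cospan) set)"
proof (rule equivI)
  show "refl_on (basic_moves_from n) (move_iso n :: ('u cospan \<times> 'u cospan) set)"
  proof (rule refl_onI)
    fix M :: "'u cospan" assume M: "M \<in> basic_moves_from n"
    then obtain c x u y where "cospan_iso_by x u y (basic_cospan c n (btgt c)) M"
      using basic_move_iso_basic_cospan by blast
    then show "(M, M) \<in> move_iso n" using M cospan_iso_by_sym cospan_iso_by_trans by blast
  qed
  show "sym (move_iso n :: ('u cospan \<times> 'u cospan) set)"
    using cospan_iso_by_sym by (fastforce intro!: symI)
  show "trans (move_iso n :: ('u cospan \<times> 'u cospan) set)"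
    using cospan_iso_by_trans by (fastforce intro!: transI)
qed auto

text \<open>Every class contains exactly one standard cospan, so the classes of moves from
  \<open>[n]\<close> correspond bijectively to the letters that can begin a word.\<close>

definition move_letter :: "nat \<Rightarrow> 'u::infinite cospan set \<Rightarrow> bobj" where
  "move_letter n \<M> = (SOME c. st_obj c n (btgt c) \<and> basic_cospan c n (btgt c) \<in> \<M>)"

lemma move_letter:
  assumes "\<M> \<in> move_classes n"
  shows "st_obj (move_letter n \<M>) n (btgt (move_letter n \<M>))"
    "basic_cospan (move_letter n \<M>) n (btgt (move_letter n \<M>)) \<in> (\<M> :: 'u::infinite cospan set)"
proof -
  obtain M where M: "M \<in> basic_moves_from n" "\<M> = move_iso n `` {M}"
    using assms unfolding move_classes_def by (rule quotientE)
  obtain c x u y where c: "st_obj c n (btgt c)" "cospan_iso_by x u y (basic_cospan c n (btgt c)) M"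
    using basic_move_iso_basic_cospan[OF M(1)] by blast
  then have "basic_cospan c n (btgt c) \<in> \<M>"
    using cospan_iso_by_sym[OF c(2)] basic_cospan_from[OF c(1)] M by auto
  then have "\<exists>c. st_obj c n (btgt c) \<and> basic_cospan c n (btgt c) \<in> \<M>" using c(1) by blast
  from someI_ex[OF this]
  show "st_obj (move_letter n \<M>) n (btgt (move_letter n \<M>))"
    "basic_cospan (move_letter n \<M>) n (btgt (move_letter n \<M>)) \<in> \<M>"
    unfolding move_letter_def by auto
qed

lemma move_letter_inj: "inj_on (move_letter n) (move_classes n :: 'u::infinite cospan set set)"
proof (rule inj_onI)
  fix \<M> \<N> :: "'u cospan set" assume *: "\<M> \<in> move_classes n" "\<N> \<in> move_classes n"
      "move_letter n \<M> = move_letter n \<N>"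
  then have "\<M> \<inter> \<N> \<noteq> {}" using move_letter(2)[OF *(1)] move_letter(2)[OF *(2)] by auto
  then show "\<M> = \<N>" using quotient_disj[OF equiv_move_iso] *(1,2) unfolding move_classes_def by blast
qed

lemma move_class_iso:
  assumes "\<M> \<in> move_classes n" "M \<in> \<M>" "N \<in> \<M>"
  shows "\<exists>x u y. cospan_iso_by x u y M (N :: 'u::infinite cospan)"
  using quotient_eq_iff[OF equiv_move_iso, of \<M> n \<M> M N] assms unfolding move_classes_def by auto

lemma move_letter_surj:
  assumes "st_obj c n n'"
  shows "c \<in> move_letter n ` (move_classes n :: 'u::infinite cospan set set)"
proof -
  let ?M = "basic_cospan c n n' :: 'u cospan"
  let ?C = "move_iso n `` {?M}"
  have C: "?C \<in> move_classes n" unfolding move_classes_def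
      by (rule quotientI[OF basic_cospan_from[OF assms]])
  have M: "?M \<in> ?C" by (rule equiv_class_self[OF equiv_move_iso basic_cospan_from[OF assms]])
  obtain x u y where "cospan_iso_by x u y
      (basic_cospan (move_letter n ?C) n (btgt (move_letter n ?C))) ?M"
    using move_class_iso[OF C move_letter(2)[OF C] M] by blast
  from basic_cospan_iso_eq[OF this move_letter(1)[OF C] assms] show ?thesis by (rule image_eqI[OF sym C])
qed

text \<open>Members of a class have isomorphic final positions, and isomorphic players know equally
  many channels, so the description in \<open>cod_pos\<close> denotes a unique number. The standard
  cospan shows that it denotes one at all.\<close>

lemma cod_pos_eq:
  assumes C: "\<M> \<in> move_classes n"
  shows "cod_pos \<M> = (yo (Pl (btgt (move_letter n \<M>))) :: 'u::infinite psh)"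
proof -
  let ?c = "move_letter n \<M>"
  let ?B = "basic_cospan ?c n (btgt ?c) :: 'u cospan"
  have B: "src (snd ?B) = yo (Pl (btgt ?c))"
      using Chat_hom[OF basic_cospan_hom(2)[OF move_letter(1)[OF C], where 'u = 'u]] by simp
  have "(THE n'. \<exists>M\<in>\<M>. src (snd M) = yo (Pl n')) = btgt ?c"
  proof (rule the_equality)
    show "\<exists>M\<in>\<M>. src (snd M) = yo (Pl (btgt ?c))" using move_letter(2)[OF C] B by blast
    fix m assume "\<exists>M\<in>\<M>. src (snd M) = yo (Pl m)"
    then obtain M where M: "M \<in> \<M>" "src (snd M) = yo (Pl m)" by blast
    obtain x u y where "cospan_iso_by x u y ?B M"
        using move_class_iso[OF C move_letter(2)[OF C] M(1)] by blast
    from cospan_iso_byD(6)[OF this] have "y \<in> hom Chat (yo (Pl (btgt ?c))) (yo (Pl m))"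
        using B M(2) by simp
    from yo_hom_Pl(1)[OF this] show "m = btgt ?c" by simp
  qed
  then show ?thesis by (simp add: cod_pos_def)
qed

theorem mainTheorem4:
  fixes n :: nat
  shows "equivalent_categories
    (Strat (yo (Pl n)) :: ('u::infinite strategy, 'u strategy_arr) cat)
    (Fam (product_cat (move_classes n) (\<lambda>M :: 'u cospan set. Strat (cod_pos M)))
      :: (('u, 'u cospan set \<Rightarrow> 'u strategy) fam, _) cat)"
proof -
  interpret word_branching "Views (yo (Pl n) :: 'u psh)" "wd n" "{cs. wt n cs}" "move_classes n"
      "move_letter n"
    "\<lambda>\<M>. Views (cod_pos \<M> :: 'u psh)" "\<lambda>\<M>. wd (btgt (move_letter n \<M>))"
  proof (intro word_branching.intro word_branching_axioms.intro)
    show "word_category (Views (yo (Pl n) :: 'u psh)) (wd n) {cs. wt n cs}" by (rule word_category_Views)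
    show "[] \<in> {cs. wt n cs}" by simp
    show "inj_on (move_letter n) (move_classes n :: 'u cospan set set)" by (rule move_letter_inj)
    show "c \<in> move_letter n ` (move_classes n :: 'u cospan set set)" if "c # w \<in> {cs. wt n cs}" for c w
      using that by (auto intro: move_letter_surj)
    fix \<M> :: "'u cospan set" assume C: "\<M> \<in> move_classes n"
    \<comment> \<open>A word with a given admissible first letter is well typed exactly when its
      tail is well typed from the codomain of that letter.\<close>
    have "{w. move_letter n \<M> # w \<in> {cs. wt n cs}} = {w. wt (btgt (move_letter n \<M>)) w}"
      using move_letter(1)[OF C] by auto
    then show "word_category (Views (cod_pos \<M> :: 'u psh)) (wd (btgt (move_letter n \<M>)))
        {w. move_letter n \<M> # w \<in> {cs. wt n cs}}"
      unfolding cod_pos_eq[OF C] using word_category_Views by simp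
  qed
  show ?thesis unfolding Strat_def by (rule PSh_equivalent_Fam)
qed

end
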